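(* Let $0<p<1$ and $\theta\ge 0$, and let $\mathcal{M}=\{M_n\}_{n\ge 0}$ be a $p$-regular sequence with infinite $p$-characteristic $\kappa(p,\mathcal{M})=+\infty$. Then \[ c_0(L^p,\mathcal{M})\subset\boldsymbol{\pi}W_{\mathcal{M}}^{p,\theta}\subset\ell^\infty(L^p,\mathcal{M}). \]
   Context: $\|f\|_p=(\int_{\mathbb{R}}|f|^p\,dx)^{1/p}$ is the quasinorm of $L^p=L^p(\mathbb{R})$. A weight sequence $\mathcal{M}=\{M_n\}_{n\ge 0}$ is a sequence of positive real numbers; it is logarithmically convex if $n\mapsto\log M_n$ is convex. The $p$-characteristic is $\kappa(p,\mathcal{M})=\limsup_{n\to+\infty}\sum_{j=1}^{n}(1-p)^j\log M_j$. A logarithmically convex sequence $\mathcal{M}$ with $\kappa(p,\mathcal{M})=+\infty$ is called $p$-regular if one of the following holds: (i) $\liminf_{n\to+\infty}(1-p)^n\log M_n>0$; or (ii) $\log M_n=\mathrm{o}((1-p)^{-n})$ and $n\log n\le(\delta+\mathrm{o}(1))\log M_n$ as $n\to+\infty$, for some $\delta<1$. For $f\in C^\infty(\mathbb{R})$ put $\|f\|_{p,\mathcal{M}}=\sup_{n\ge 0}\|f^{(n)}\|_p/M_n$. The test class is \[ \mathscr{S}_{p,\theta,\mathcal{M}}^\circledast=\Big\{f\in C^\infty(\mathbb{R}):\ \|f\|_{p,\mathcal{M}}<+\infty\ \text{ and }\ \limsup_{n\to+\infty}(1-p)^n\log\|f^{(n)}\|_\infty\le\theta\Big\} \] (with $\log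 0=-\infty$). The $L^p$-Carleman space $W^{p,\theta}_{\mathcal{M}}$ is the abstract completion of $\mathscr{S}_{p,\theta,\mathcal{M}}^\circledast$ with respect to $\|\cdot\|_{p,\mathcal{M}}$. Let $\ell^\infty(L^p,\mathcal{M})$ be the space of sequences $(f_0,f_1,f_2,\ldots)$ in $L^p$ with finite quasinorm $\sup_{n\ge 0}\|f_n\|_p/M_n$, and let $c_0(L^p,\mathcal{M})$ be its subspace of sequences with $\lim_{n\to+\infty}\|f_n\|_p/M_n=0$. The map $\boldsymbol{\pi}f=(f,f',f'',\ldots)$ on test functions extends to an isometry $\boldsymbol{\pi}:W^{p,\theta}_{\mathcal{M}}\to\ell^\infty(L^p,\mathcal{M})$. *)

theory Defs
  imports "HOL-Analysis.Analysis" "HOL-Library.Landau_Symbols"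
begin

section \<open>Weight sequences\<close>

definition p_characteristic :: "real \<Rightarrow> (nat \<Rightarrow> real) \<Rightarrow> ereal" where
  "p_characteristic p M = limsup (\<lambda>n. ereal (\<Sum>j=1..n. (1 - p) ^ j * ln (M j)))"

text \<open>Convexity of \<open>n \<mapsto> ln (M n)\<close> as a function on the natural numbers
  (\<open>convex_on\<close> is not applicable because the naturals are not a convex subset of the reals).\<close>

definition log_convex :: "(nat \<Rightarrow> real) \<Rightarrow> bool" where
  "log_convex M \<longleftrightarrow>
     (\<forall>i j k. i < j \<and> j < k \<longrightarrow>
        (real k - real i) * ln (M j) \<le>
        (real k - real j) * ln (M i) + (real j - real i) * ln (M k))"

text \<open>In the second alternative the sequence \<open>\<epsilon>\<close> is the \<open>o(1)\<close> term.\<close>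

definition p_regular :: "real \<Rightarrow> (nat \<Rightarrow> real) \<Rightarrow> bool" where
  "p_regular p M \<longleftrightarrow>
     log_convex M \<and> p_characteristic p M = \<infinity> \<and>
     (liminf (\<lambda>n. ereal ((1 - p) ^ n * ln (M n))) > 0 \<or>
      (\<lambda>n. ln (M n)) \<in> o(\<lambda>n. inverse ((1 - p) ^ n)) \<and>
      (\<exists>\<delta><1. \<exists>\<epsilon>. \<epsilon> \<longlonglongrightarrow> 0 \<and>
         (\<forall>\<^sub>F n in sequentially. real n * ln (real n) \<le> (\<delta> + \<epsilon> n) * ln (M n))))"

section \<open>The space \<open>L\<^sup>p\<close> of the real line\<close>

text \<open>The quasinorm of a function, with value \<open>\<infinity>\<close> if the integral diverges.\<close>

definition lp_qnorm :: "real \<Rightarrow> (real \<Rightarrow> complex) \<Rightarrow> ennreal" where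
  "lp_qnorm p f =
     (let I = (\<integral>\<^sup>+x. ennreal (cmod (f x) powr p) \<partial>lborel)
      in if I = \<infinity> then \<infinity> else ennreal (enn2real I powr (1 / p)))"

text \<open>Complex-valued measurable functions on the line modulo equality almost everywhere.
  Every Lebesgue measurable function agrees almost everywhere with a Borel measurable one, so
  Borel measurable representatives suffice.\<close>

definition ae_rel :: "(real \<Rightarrow> complex) \<Rightarrow> (real \<Rightarrow> complex) \<Rightarrow> bool" where
  "ae_rel f g \<longleftrightarrow> f \<in> borel_measurable lborel \<and> g \<in> borel_measurable lborel \<and>
     (AE x in lborel. f x = g x)"

quotient_type mclass = "real \<Rightarrow> complex" / partial: ae_rel
  morphisms rep_mclass mclass_of
proof (rule part_equivpI)
  show "\<exists>f. ae_rel f f"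
    by (rule exI[of _ "\<lambda>_. 0"]) (simp add: ae_rel_def)
  show "symp ae_rel"
    by (auto simp: symp_def ae_rel_def elim: eventually_mono)
  show "transp ae_rel"
    unfolding transp_def ae_rel_def by (auto elim: eventually_elim2)
qed

instantiation mclass :: minus
begin

lift_definition minus_mclass :: "mclass \<Rightarrow> mclass \<Rightarrow> mclass" is "\<lambda>f g x. f x - g x"
  unfolding ae_rel_def by (auto elim: eventually_elim2)

instance ..

end

lift_definition mclass_qnorm :: "real \<Rightarrow> mclass \<Rightarrow> ennreal" is lp_qnorm
proof -
  fix p f g assume "ae_rel f g"
  then have "AE x in lborel. ennreal (cmod (f x) powr p) = ennreal (cmod (g x) powr p)"
    unfolding ae_rel_def by (auto elim: eventually_mono)
  then have "(\<integral>\<^sup>+x. ennreal (cmod (f x) powr p) \<partial>lborel) =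
             (\<integral>\<^sup>+x. ennreal (cmod (g x) powr p) \<partial>lborel)"
    by (rule nn_integral_cong_AE)
  then show "lp_qnorm p f = lp_qnorm p g"
    by (simp add: lp_qnorm_def)
qed

definition Lp :: "real \<Rightarrow> mclass set" where
  "Lp p = {u. mclass_qnorm p u < \<infinity>}"

definition seq_qnorm :: "real \<Rightarrow> (nat \<Rightarrow> real) \<Rightarrow> (nat \<Rightarrow> mclass) \<Rightarrow> ennreal" where
  "seq_qnorm p M F = (SUP n. mclass_qnorm p (F n) / ennreal (M n))"

definition linfty_Lp :: "real \<Rightarrow> (nat \<Rightarrow> real) \<Rightarrow> (nat \<Rightarrow> mclass) set" where
  "linfty_Lp p M = {F. (\<forall>n. F n \<in> Lp p) \<and> seq_qnorm p M F < \<infinity>}"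

definition c0_Lp :: "real \<Rightarrow> (nat \<Rightarrow> real) \<Rightarrow> (nat \<Rightarrow> mclass) set" where
  "c0_Lp p M = {F \<in> linfty_Lp p M. (\<lambda>n. mclass_qnorm p (F n) / ennreal (M n)) \<longlonglongrightarrow> 0}"

section \<open>Test functions\<close>

definition nth_deriv :: "nat \<Rightarrow> (real \<Rightarrow> complex) \<Rightarrow> real \<Rightarrow> complex" where
  "nth_deriv n f = ((\<lambda>g x. vector_derivative g (at x)) ^^ n) f"

definition smooth :: "(real \<Rightarrow> complex) \<Rightarrow> bool" where
  "smooth f \<longleftrightarrow> (\<forall>n x. nth_deriv n f differentiable at x)"

definition carleman_qnorm :: "real \<Rightarrow> (nat \<Rightarrow> real) \<Rightarrow> (real \<Rightarrow> complex) \<Rightarrow> ennreal" where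
  "carleman_qnorm p M f = (SUP n. lp_qnorm p (nth_deriv n f) / ennreal (M n))"

definition sup_norm :: "(real \<Rightarrow> complex) \<Rightarrow> ereal" where
  "sup_norm f = (SUP x. ereal (cmod (f x)))"

definition log_ereal :: "ereal \<Rightarrow> ereal" where
  "log_ereal t = (if t \<le> 0 then -\<infinity> else if t = \<infinity> then \<infinity> else ereal (ln (real_of_ereal t)))"

definition test_class :: "real \<Rightarrow> real \<Rightarrow> (nat \<Rightarrow> real) \<Rightarrow> (real \<Rightarrow> complex) set" where
  "test_class p \<theta> M =
     {f. smooth f \<and> carleman_qnorm p M f < \<infinity> \<and>
         limsup (\<lambda>n. ereal ((1 - p) ^ n) * log_ereal (sup_norm (nth_deriv n f))) \<le> ereal \<theta>}"

section \<open>The \<open>L\<^sup>p\<close>-Carleman space and the map \<open>\<pi>\<close>\<close>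

definition cauchy_seqs :: "real \<Rightarrow> real \<Rightarrow> (nat \<Rightarrow> real) \<Rightarrow> (nat \<Rightarrow> real \<Rightarrow> complex) set" where
  "cauchy_seqs p \<theta> M =
     {f. (\<forall>k. f k \<in> test_class p \<theta> M) \<and>
         (\<forall>e>0. \<exists>N. \<forall>j\<ge>N. \<forall>k\<ge>N. carleman_qnorm p M (\<lambda>x. f j x - f k x) < ennreal e)}"

definition cauchy_rel ::
  "real \<Rightarrow> real \<Rightarrow> (nat \<Rightarrow> real) \<Rightarrow> ((nat \<Rightarrow> real \<Rightarrow> complex) \<times> (nat \<Rightarrow> real \<Rightarrow> complex)) set" where
  "cauchy_rel p \<theta> M =
     {(f, g). f \<in> cauchy_seqs p \<theta> M \<and> g \<in> cauchy_seqs p \<theta> M \<and>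
        (\<lambda>k. carleman_qnorm p M (\<lambda>x. f k x - g k x)) \<longlonglongrightarrow> 0}"

text \<open>The abstract completion of the test class: Cauchy sequences modulo null sequences.\<close>

definition carleman_space :: "real \<Rightarrow> real \<Rightarrow> (nat \<Rightarrow> real) \<Rightarrow> (nat \<Rightarrow> real \<Rightarrow> complex) set set" where
  "carleman_space p \<theta> M = cauchy_seqs p \<theta> M // cauchy_rel p \<theta> M"

definition pi_test :: "(real \<Rightarrow> complex) \<Rightarrow> nat \<Rightarrow> mclass" where
  "pi_test f = (\<lambda>n. mclass_of (nth_deriv n f))"

text \<open>The continuous extension of \<^const>\<open>pi_test\<close> to the completion: an element \<open>w\<close> of the
  completion is sent to the limit in \<^const>\<open>linfty_Lp\<close> of the images of any Cauchy sequence
  representing \<open>w\<close>.\<close>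

definition pi_map :: "real \<Rightarrow> (nat \<Rightarrow> real) \<Rightarrow> (nat \<Rightarrow> real \<Rightarrow> complex) set \<Rightarrow> nat \<Rightarrow> mclass" where
  "pi_map p M w =
     (THE F. F \<in> linfty_Lp p M \<and>
        (\<forall>f\<in>w. (\<lambda>k. seq_qnorm p M (\<lambda>n. pi_test (f k) n - F n)) \<longlonglongrightarrow> 0))"

end

(*
  For p < 1 a function can jump by 1 while its derivative is small in L^p.  Smoothing the Heaviside
  step by averages over intervals of lengths a_0, a_1, ... gives Phi whose n-th derivative (n >= 1)
  is at most 2^n / (a_0 ... a_(n-1)) and lives on 2^n short intervals.  If the p-characteristic is
  infinite, the lengths can be chosen, by a backward recursion started at a late index, such that all
  derivatives of Phi are arbitrarily small relative to the weights and their sup norms have zero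
  growth exponent.  Differences of such steps approximate (1_[a,b), 0, 0, ...), hence
  (g, 0, 0, ...) for all g in L^p.  A primitive of a test function can be made small by subtracting
  many tiny smooth steps, which costs nothing in the derivatives; this moves the approximated entry
  one place to the right.  So all finite sequences, and with them c_0, are limits of test functions.
  The other inclusion is the completeness of L^p.
*)
theory Submission
  imports Defs "HOL-Real_Asymp.Real_Asymp"
begin

section \<open>The integral of the p-th power\<close>


text \<open>The widths have two opposing duties. The product of the first n of them enters the n-th
  derivative with power -p and must not be too small, while the sum of the later ones, the length of
  the remaining transition, must stay below the p-th power of the same product times the weight. So
  each bound on a tail involves all earlier widths. In logarithms, equality in consecutive bounds is
  a linear recursion: one exponent is 1 - p times the next one plus a multiple of a weight
  increment. Solved backwards it contracts, and its discount factors (1 - p)^j are those of the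
  p-characteristic, whose divergence makes even the first exponent large. Convexity keeps the
  exponents monotone, so the first exponent of a tail controls its sum.

  Both alternatives of regularity reduce to one notion, \<open>admissible\<close>, for a minorant of
  the log weights: approximation relative to smaller weights is the harder task, and growth exponent
  0 is the strictest demand, so success there serves every nonnegative \<open>\<theta>\<close>. The
  quasinorm itself has no triangle inequality, hence all estimates are made for its p-th power
  \<open>pint\<close>.\<close>

definition pint :: "real \<Rightarrow> (real \<Rightarrow> complex) \<Rightarrow> ennreal" where
  "pint p f = (\<integral>\<^sup>+x. ennreal (cmod (f x) powr p) \<partial>lborel)"

text \<open>As p - 1 <= 0, every t in [0, a + b] satisfies t (a + b)^(p-1) <= t^p; adding the cases
  t = a and t = b gives the claim.\<close>

lemma powr_add_le:
  fixes a b p :: real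
  assumes "0 < p" "p \<le> 1" "0 \<le> a" "0 \<le> b"
  shows "(a + b) powr p \<le> a powr p + b powr p"
proof (cases "a + b = 0")
  case False
  then have s: "0 < a + b" using assms by linarith
  have *: "t * (a + b) powr (p - 1) \<le> t powr p" if "0 \<le> t" "t \<le> a + b" for t
  proof (cases "t = 0")
    case False
    then have "(a + b) powr (p - 1) \<le> t powr (p - 1)"
      using that assms by (intro powr_mono2') auto
    then have "t * (a + b) powr (p - 1) \<le> t * t powr (p - 1)"
      using that by (intro mult_left_mono) auto
    also have "\<dots> = t powr p" using that False by (simp add: powr_diff)
    finally show ?thesis .
  qed simp
  have "(a + b) powr p = a * (a + b) powr (p - 1) + b * (a + b) powr (p - 1)"
    using s by (simp add: powr_diff distrib_right [symmetric] add_divide_distrib [symmetric])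
  also have "\<dots> \<le> a powr p + b powr p"
    using *[of a] *[of b] assms by auto
  finally show ?thesis .
qed (use assms in auto)

lemma cmod_powr_add_le:
  assumes "0 < p" "p \<le> 1"
  shows "cmod (u + v) powr p \<le> cmod u powr p + cmod v powr p"
proof -
  have "cmod (u + v) powr p \<le> (cmod u + cmod v) powr p"
    using assms by (intro powr_mono2) (auto intro: norm_triangle_ineq)
  also have "\<dots> \<le> cmod u powr p + cmod v powr p"
    using assms by (intro powr_add_le) auto
  finally show ?thesis .
qed

lemma pint_0 [simp]: "pint p (\<lambda>x. 0) = 0"
  by (simp add: pint_def)

lemma pint_add:
  assumes "0 < p" "p \<le> 1"
    and [measurable]: "f \<in> borel_measurable borel" "g \<in> borel_measurable borel"
  shows "pint p (\<lambda>x. f x + g x) \<le> pint p f + pint p g"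
proof -
  have "pint p (\<lambda>x. f x + g x) \<le>
      (\<integral>\<^sup>+x. ennreal (cmod (f x) powr p) + ennreal (cmod (g x) powr p) \<partial>lborel)"
    unfolding pint_def
    by (intro nn_integral_mono)
      (auto simp: ennreal_plus [symmetric] simp del: ennreal_plus
        intro!: ennreal_leI cmod_powr_add_le assms)
  also have "\<dots> = pint p f + pint p g"
    unfolding pint_def by (subst nn_integral_add) auto
  finally show ?thesis .
qed

lemma pint_cmult:
  assumes [measurable]: "f \<in> borel_measurable borel"
  shows "pint p (\<lambda>x. c * f x) = ennreal (cmod c powr p) * pint p f"
  unfolding pint_def
  by (subst nn_integral_cmult [symmetric]) (auto simp: norm_mult powr_mult ennreal_mult)

lemma pint_minus_commute: "pint p (\<lambda>x. f x - g x) = pint p (\<lambda>x. g x - f x)"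
  unfolding pint_def by (simp add: norm_minus_commute)

lemma pint_diff:
  assumes "0 < p" "p \<le> 1"
    and [measurable]: "f \<in> borel_measurable borel" "g \<in> borel_measurable borel"
  shows "pint p (\<lambda>x. f x - g x) \<le> pint p f + pint p g"
proof -
  have "pint p (\<lambda>x. f x - g x) \<le> pint p f + pint p (\<lambda>x. - g x)"
    using pint_add[OF assms(1-3), of "\<lambda>x. - g x"] by simp
  then show ?thesis by (simp add: pint_def)
qed

lemma pint_triangle:
  assumes "0 < p" "p \<le> 1"
    and [measurable]: "f \<in> borel_measurable borel" "g \<in> borel_measurable borel"
      "h \<in> borel_measurable borel"
  shows "pint p (\<lambda>x. f x - h x) \<le> pint p (\<lambda>x. f x - g x) + pint p (\<lambda>x. g x - h x)"
  using pint_add[OF assms(1,2), of "\<lambda>x. f x - g x" "\<lambda>x. g x - h x"] by simp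

lemma pint_sum:
  assumes "0 < p" "p \<le> 1" "finite I"
    and m: "\<And>i. i \<in> I \<Longrightarrow> f i \<in> borel_measurable borel"
  shows "pint p (\<lambda>x. \<Sum>i\<in>I. f i x) \<le> (\<Sum>i\<in>I. pint p (f i))"
  using assms(3) m
proof (induction I rule: finite_induct)
  case (insert i I)
  have "pint p (\<lambda>x. f i x + (\<Sum>i\<in>I. f i x)) \<le> pint p (f i) + pint p (\<lambda>x. \<Sum>i\<in>I. f i x)"
    using insert.prems by (intro pint_add assms(1,2) borel_measurable_sum) blast+
  also have "\<dots> \<le> pint p (f i) + (\<Sum>i\<in>I. pint p (f i))"
    using insert.prems by (intro add_left_mono insert.IH) blast
  finally show ?case using insert by simp
qed simp

lemma pint_translate:
  assumes [measurable]: "f \<in> borel_measurable borel"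
  shows "pint p (\<lambda>x. f (x - t)) = pint p f"
  unfolding pint_def
  using nn_integral_real_affine[of "\<lambda>x. ennreal (cmod (f x) powr p)" 1 "-t"] by simp

lemma pint_le_interval:
  assumes "0 < p" "a \<le> b" "\<And>x. x < a \<or> x > b \<Longrightarrow> f x = 0" "\<And>x. cmod (f x) \<le> K"
  shows "pint p f \<le> ennreal (K powr p * (b - a))"
proof -
  have "pint p f \<le> (\<integral>\<^sup>+x. ennreal (K powr p) * indicator {a..b} x \<partial>lborel)"
    unfolding pint_def
    using assms by (intro nn_integral_mono)
      (auto simp: indicator_def not_le intro!: ennreal_leI powr_mono2)
  also have "\<dots> = ennreal (K powr p * (b - a))"
    using assms(2) by (simp add: nn_integral_cmult ennreal_mult)
  finally show ?thesis .
qed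

section \<open>Comparison of the quasinorm with its p-th power\<close>

lemma lp_qnorm_le_iff:
  assumes "0 < p" "0 \<le> c"
  shows "lp_qnorm p f \<le> ennreal c \<longleftrightarrow> pint p f \<le> ennreal (c powr p)"
proof (cases "pint p f = \<infinity>")
  case True
  then show ?thesis by (auto simp: lp_qnorm_def pint_def top_unique)
next
  case False
  then obtain r where r: "pint p f = ennreal r" "0 \<le> r" by (cases "pint p f") auto
  have "r powr (1/p) \<le> c \<longleftrightarrow> r \<le> c powr p"
  proof
    assume "r powr (1/p) \<le> c"
    then have "(r powr (1/p)) powr p \<le> c powr p" using assms by (intro powr_mono2) auto
    then show "r \<le> c powr p" using assms r by (simp add: powr_powr)
  next
    assume "r \<le> c powr p"
    then have "r powr (1/p) \<le> (c powr p) powr (1/p)" using assms r by (intro powr_mono2) auto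
    then show "r powr (1/p) \<le> c" using assms r by (simp add: powr_powr)
  qed
  then show ?thesis using r assms by (simp add: lp_qnorm_def pint_def [symmetric])
qed

lemma lp_qnorm_finite_iff: "lp_qnorm p f < top \<longleftrightarrow> pint p f < top"
  by (auto simp: lp_qnorm_def pint_def Let_def top.not_eq_extremum)

section \<open>Admissible logarithmic weights\<close>


text \<open>Here \<open>x n\<close> is the logarithm of the \<open>n\<close>-th weight. The summability clause is the only trace of the
  condition \<open>n log n \<le> (\<delta> + o(1)) log M\<^sub>n\<close>.\<close>

definition admissible :: "real \<Rightarrow> (nat \<Rightarrow> real) \<Rightarrow> bool" where
  "admissible p x \<longleftrightarrow>
     (\<forall>n. x (Suc n) - x n \<le> x (Suc (Suc n)) - x (Suc n)) \<and>
     (\<forall>B. \<exists>\<^sub>F n in sequentially. B \<le> (\<Sum>j=1..n. (1 - p) ^ j * x j)) \<and>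
     (\<forall>e>0. \<forall>\<^sub>F n in sequentially. (1 - p) ^ n * x n \<le> e) \<and>
     (\<exists>\<eta>>0. \<eta> < 1 \<and> summable (\<lambda>n. exp (- (1 - \<eta>) * (x (Suc n) - x n))))"

lemma increments_at_top:
  assumes "summable (\<lambda>n. exp (- (1 - \<eta>) * (x (Suc n) - x n)))" "\<eta> < (1::real)"
  shows "filterlim (\<lambda>n. x (Suc n) - x n) at_top sequentially"
proof -
  have "(\<lambda>n. exp (- (1 - \<eta>) * (x (Suc n) - x n))) \<longlonglongrightarrow> 0"
    using assms(1) by (rule summable_LIMSEQ_zero)
  then have "filterlim (\<lambda>n. exp (- (1 - \<eta>) * (x (Suc n) - x n))) (at_right 0) sequentially"
    by (auto simp: filterlim_at)
  then have "filterlim (\<lambda>n. ln (exp (- (1 - \<eta>) * (x (Suc n) - x n)))) at_bot sequentially"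
    by (rule filterlim_compose[OF ln_at_0])
  then have "filterlim (\<lambda>n. (1 - \<eta>) * (x (Suc n) - x n)) at_top sequentially"
    by (simp add: filterlim_uminus_at_top minus_mult_left del: mult_minus_left)
  then have "filterlim (\<lambda>n. inverse (1 - \<eta>) * ((1 - \<eta>) * (x (Suc n) - x n))) at_top sequentially"
    by (rule filterlim_tendsto_pos_mult_at_top[OF tendsto_const, rotated]) (use assms(2) in simp)
  moreover have "inverse (1 - \<eta>) * ((1 - \<eta>) * y) = y" for y
    using assms(2) by simp
  ultimately show ?thesis by (simp only:)
qed

lemma eventually_nonneg:
  assumes "filterlim (\<lambda>n. x (Suc n) - x n) at_top sequentially"
  shows "\<forall>\<^sub>F n in sequentially. (0::real) \<le> x n"
proof -
  obtain m where m: "\<And>n. n \<ge> m \<Longrightarrow> 1 \<le> x (Suc n) - x n"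
    using assms by (auto simp: filterlim_at_top eventually_sequentially)
  have ge: "x (m + k) \<ge> x m + real k" for k
    proof (induction k)
    case (Suc k)
    then show ?case using m[of "m + k"] by simp
  qed simp
  have "0 \<le> x n" if "n \<ge> m + nat \<lceil>- x m\<rceil>" for n
  proof -
    have "real (n - m) \<ge> - x m" using that by linarith
    then show ?thesis using ge[of "n - m"] that by auto
  qed
  then show ?thesis unfolding eventually_sequentially by blast
qed

text \<open>The shift divides the partial sums by 1 - p up to a constant, so they stay unbounded. It
  is needed because moving an approximated entry one place to the right replaces the weights by
  shifted ones.\<close>

lemma admissible_shift:
  assumes "admissible p x" "p < 1"
  shows "admissible p (\<lambda>n. x (Suc n))"
  unfolding admissible_def
proof (intro conjI allI impI)
  fix n show "x (Suc (Suc n)) - x (Suc n) \<le> x (Suc (Suc (Suc n))) - x (Suc (Suc n))"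
    using assms by (auto simp: admissible_def)
next
  fix B
  have eq: "(1 - p) * (\<Sum>j=1..n. (1 - p) ^ j * x (Suc j)) =
      (\<Sum>j=1..Suc n. (1 - p) ^ j * x j) - (1 - p) * x 1" for n
    by (induction n) (auto simp: algebra_simps)
  have "\<exists>\<^sub>F n in sequentially. (1 - p) * B + (1 - p) * x 1 \<le> (\<Sum>j=1..n. (1 - p) ^ j * x j)"
    using assms by (auto simp: admissible_def)
  then have "\<exists>\<^sub>F n in sequentially. (1 - p) * B + (1 - p) * x 1 \<le> (\<Sum>j=1..Suc n. (1 - p) ^ j * x j)"
    by (subst (asm) frequently_def, subst (asm) eventually_sequentially_Suc[symmetric],
        subst frequently_def)
  then show "\<exists>\<^sub>F n in sequentially. B \<le> (\<Sum>j=1..n. (1 - p) ^ j * x (Suc j))"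
  proof (rule frequently_elim1)
    fix n assume "(1 - p) * B + (1 - p) * x 1 \<le> (\<Sum>j=1..Suc n. (1 - p) ^ j * x j)"
    then have "(1 - p) * B \<le> (1 - p) * (\<Sum>j=1..n. (1 - p) ^ j * x (Suc j))"
      by (simp only: eq)
    then show "B \<le> (\<Sum>j=1..n. (1 - p) ^ j * x (Suc j))"
      using assms by simp
  qed
next
  fix e :: real assume "e > 0"
  then have "\<forall>\<^sub>F n in sequentially. (1 - p) ^ n * x n \<le> (1 - p) * e"
    using assms by (auto simp: admissible_def)
  then have "\<forall>\<^sub>F n in sequentially. (1 - p) ^ Suc n * x (Suc n) \<le> (1 - p) * e"
    by (subst eventually_sequentially_Suc)
  then show "\<forall>\<^sub>F n in sequentially. (1 - p) ^ n * x (Suc n) \<le> e"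
    by (rule eventually_mono) (use assms in \<open>auto simp: mult.assoc\<close>)
next
  obtain \<eta> where "\<eta> > 0" "\<eta> < 1" "summable (\<lambda>n. exp (- (1 - \<eta>) * (x (Suc n) - x n)))"
    using assms by (auto simp: admissible_def)
  then show "\<exists>\<eta>>0. \<eta> < 1 \<and> summable (\<lambda>n. exp (- (1 - \<eta>) * (x (Suc (Suc n)) - x (Suc n))))"
    by (subst (asm) summable_Suc_iff[symmetric]) blast
qed

lemma summable_nat_power:
  fixes s :: real assumes "0 < s" "s < 1"
  shows "summable (\<lambda>n. real n * s ^ n)"
proof (rule summable_comparison_test')
  show "summable (\<lambda>n. real (Suc n) * s ^ n)"
    using geometric_deriv_sums[of s] assms by (simp add: sums_iff)
  show "norm (real n * s ^ n) \<le> real (Suc n) * s ^ n" for n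
    using assms by simp
qed

text \<open>The series of (j + 1) (1 - p)^j converges, so an affine change moves the partial sums by
  a bounded amount only. This room pays for factors C^n and for arbitrarily small constants in the
  later estimates.\<close>

lemma admissible_affine:
  assumes "admissible p x" "0 < p" "p < 1"
  shows "admissible p (\<lambda>n. x n - c * real n - d)"
  unfolding admissible_def
proof (intro conjI allI impI)
  fix n show "x (Suc n) - c * real (Suc n) - d - (x n - c * real n - d)
       \<le> x (Suc (Suc n)) - c * real (Suc (Suc n)) - d - (x (Suc n) - c * real (Suc n) - d)"
    using assms by (auto simp: admissible_def algebra_simps)
next
  fix B
  have s: "summable (\<lambda>j. \<bar>c\<bar> * (real j * (1 - p) ^ j) + \<bar>d\<bar> * (1 - p) ^ j)"
    using assms by (intro summable_add summable_mult summable_nat_power summable_geometric) auto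
  define K where "K = (\<Sum>j. \<bar>c\<bar> * (real j * (1 - p) ^ j) + \<bar>d\<bar> * (1 - p) ^ j)"
  have le: "(\<Sum>j=1..n. (1 - p) ^ j * x j) - K \<le> (\<Sum>j=1..n. (1 - p) ^ j * (x j - c * real j - d))" for n
  proof -
    have "(\<Sum>j=1..n. (1 - p) ^ j * x j) - (\<Sum>j=1..n. (1 - p) ^ j * (x j - c * real j - d)) =
       (\<Sum>j=1..n. c * (real j * (1 - p) ^ j) + d * (1 - p) ^ j)"
      by (simp add: sum_subtractf[symmetric] algebra_simps)
    also have "\<dots> \<le> (\<Sum>j=1..n. \<bar>c\<bar> * (real j * (1 - p) ^ j) + \<bar>d\<bar> * (1 - p) ^ j)"
      using assms by (intro sum_mono add_mono mult_right_mono) auto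
    also have "\<dots> \<le> K"
      unfolding K_def using assms by (intro sum_le_suminf s) auto
    finally show ?thesis by simp
  qed
  have "\<exists>\<^sub>F n in sequentially. B + K \<le> (\<Sum>j=1..n. (1 - p) ^ j * x j)"
    using assms by (auto simp: admissible_def)
  then show "\<exists>\<^sub>F n in sequentially. B \<le> (\<Sum>j=1..n. (1 - p) ^ j * (x j - c * real j - d))"
    by (rule frequently_elim1) (use le in \<open>smt (verit)\<close>)
next
  fix e :: real assume "e > 0"
  then have 1: "\<forall>\<^sub>F n in sequentially. (1 - p) ^ n * x n \<le> e / 2"
    using assms unfolding admissible_def by (meson half_gt_zero)
  have "(\<lambda>n. (1 - p) ^ n * (c * real n + d)) \<longlonglongrightarrow> 0"
    using assms by real_asymp
  then have 2: "\<forall>\<^sub>F n in sequentially. dist ((1 - p) ^ n * (c * real n + d)) 0 < e / 2"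
    using \<open>e > 0\<close> by (intro tendstoD) auto
  show "\<forall>\<^sub>F n in sequentially. (1 - p) ^ n * (x n - c * real n - d) \<le> e"
    using 1 2
  proof eventually_elim
    case (elim n)
    have "(1 - p) ^ n * (x n - c * real n - d) = (1 - p) ^ n * x n - (1 - p) ^ n * (c * real n + d)"
      by (simp add: algebra_simps)
    then show ?case using elim by (simp add: dist_real_def)
  qed
next
  obtain \<eta> where \<eta>: "\<eta> > 0" "\<eta> < 1" "summable (\<lambda>n. exp (- (1 - \<eta>) * (x (Suc n) - x n)))"
    using assms by (auto simp: admissible_def)
  have "exp (- (1 - \<eta>) * (x (Suc n) - c * real (Suc n) - d - (x n - c * real n - d))) =
     exp ((1 - \<eta>) * c) * exp (- (1 - \<eta>) * (x (Suc n) - x n))" for n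
    by (simp add: exp_add[symmetric] algebra_simps)
  then show "\<exists>\<eta>>0. \<eta> < 1 \<and> summable (\<lambda>n. exp (- (1 - \<eta>) *
      (x (Suc n) - c * real (Suc n) - d - (x n - c * real n - d))))"
    using \<eta> by (intro exI[of _ \<eta>]) (simp add: summable_mult)
qed

text \<open>With \<open>\<mu> j\<close> the increments of \<open>x\<close>, take \<open>a j = exp (-(1 - \<eta>) \<mu> j - l j)\<close>. The first factor makes the
  tails summable; in the second, \<open>l j = \<eta> \<mu> j\<close> from some index \<open>n\<close> on, so that the product of the \<open>j\<close>-th
  weight with the first \<open>j\<close> widths is eventually constant, and for \<open>j < n\<close> the exponent \<open>l j\<close> is the average
  of \<open>l (j + 1)\<close> and \<open>\<eta> \<mu> (j + 1)\<close> with weights \<open>1 - p\<close> and \<open>p\<close>, which propagates the tail estimate with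
  equality. Abel summation expresses \<open>l 0\<close> by the partial sums of the characteristic, hence \<open>l 0\<close> is large
  for suitable \<open>n\<close>.\<close>

lemma width_sequence:
  assumes adm: "admissible p x" and p: "0 < p" "p < 1" and "0 < (\<epsilon>::real)"
  shows "\<exists>a. (\<forall>j. 0 < a j) \<and> summable a \<and> suminf a \<le> \<epsilon> \<and>
    (\<forall>j. (\<Sum>i. a (i + j)) \<le> (exp (x (Suc j)) * (\<Prod>i<Suc j. a i)) powr p) \<and>
    (\<forall>e>0. \<forall>\<^sub>F n in sequentially. (1 - p) ^ n * - ln (\<Prod>i<n. a i) \<le> e)"
proof -
  define \<mu> where "\<mu> = (\<lambda>n. x (Suc n) - x n)"
  obtain \<eta> where \<eta>: "\<eta> > 0" "\<eta> < 1" "summable (\<lambda>n. exp (- (1 - \<eta>) * \<mu> n))"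
    using adm by (auto simp: admissible_def \<mu>_def)
  define S where "S = (\<Sum>n. exp (- (1 - \<eta>) * \<mu> n))"
  have Spos: "S > 0" unfolding S_def using \<eta>(3) by (intro suminf_pos) auto
  have mono\<mu>: "\<mu> n \<le> \<mu> (Suc n)" for n
    using adm by (auto simp: admissible_def \<mu>_def)
  have lim\<mu>: "filterlim \<mu> at_top sequentially"
    unfolding \<mu>_def using \<eta>(3) unfolding \<mu>_def by (rule increments_at_top) (rule \<eta>(2))
  have ev1: "\<forall>\<^sub>F n in sequentially. 0 \<le> \<mu> n"
    using lim\<mu> by (auto simp: filterlim_at_top)
  have ev2: "\<forall>\<^sub>F n in sequentially. 0 \<le> x (Suc n)"
    using eventually_nonneg[of x] lim\<mu> unfolding \<mu>_def by (subst eventually_sequentially_Suc) auto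
  \<comment> \<open>\<open>B1\<close> is the base case of \<open>key\<close> solved for
    \<open>l 0\<close>; the second entry of \<open>B\<close> makes the total width, at most
    \<open>S * exp (- l 0)\<close>, no larger than \<open>\<epsilon>\<close>.\<close>
  define B1 where "B1 = (ln S - p * (x 0 + \<eta> * \<mu> 0)) / (1 - p)"
  define B where "B = max B1 (ln (S / \<epsilon>))"
  define X where "X = (\<lambda>n. \<Sum>j=1..n. (1 - p) ^ j * x j)"
  \<comment> \<open>This is the inequality \<open>B \<le> l 0\<close> traced back through
    \<open>l0\<close> and \<open>abel\<close> below. The boundary terms with \<open>\<mu> n\<close>
    and \<open>x (Suc n)\<close> are dropped there, so both have to be nonnegative at the chosen
    \<open>n\<close>.\<close>
  have "\<exists>\<^sub>F n in sequentially. ((1 - p)\<^sup>2 * B / (\<eta> * p) + (1 - p) * x 1) / p \<le> X n"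
    using adm unfolding X_def by (auto simp: admissible_def)
  then have "\<exists>\<^sub>F n in sequentially. ((1 - p)\<^sup>2 * B / (\<eta> * p) + (1 - p) * x 1) / p \<le> X n
      \<and> 0 \<le> \<mu> n \<and> 0 \<le> x (Suc n)"
    using eventually_conj[OF ev1 ev2] by (rule frequently_eventually_frequently)
  then obtain n where n: "((1 - p)\<^sup>2 * B / (\<eta> * p) + (1 - p) * x 1) / p \<le> X n"
     "0 \<le> \<mu> n" "0 \<le> x (Suc n)"
    by (auto dest!: frequently_ex)
  \<comment> \<open>\<open>L k\<close> is the exponent at index \<open>n - k\<close>: counting down
    from \<open>n\<close> turns the backward recursion into a primitive recursion.\<close>
  define L where "L = rec_nat (\<eta> * \<mu> n) (\<lambda>k y. (1 - p) * y + p * \<eta> * \<mu> (n - k))"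
  define l where "l = (\<lambda>j. if j \<le> n then L (n - j) else \<eta> * \<mu> j)"
  have l_ge: "l j = \<eta> * \<mu> j" if "j \<ge> n" for j
    using that by (auto simp: l_def L_def)
  have l_lt: "l j = (1 - p) * l (Suc j) + p * \<eta> * \<mu> (Suc j)" if "j < n" for j
  proof -
    have "n - j = Suc (n - Suc j)" "n - (n - Suc j) = Suc j" using that by auto
    then show ?thesis using that by (simp add: l_def L_def)
  qed
  have l_mu: "\<eta> * \<mu> j \<le> l j" for j
  proof (cases "j \<le> n")
    case True
    then show ?thesis
    proof (induction j rule: inc_induct)
      case base then show ?case by (simp add: l_ge)
    next
      case (step j)
      have "\<eta> * \<mu> j \<le> \<eta> * \<mu> (Suc j)" using \<eta> mono\<mu> by auto
      also have "\<dots> = (1 - p) * (\<eta> * \<mu> (Suc j)) + p * \<eta> * \<mu> (Suc j)" by (simp add: algebra_simps)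
      also have "\<dots> \<le> l j" unfolding l_lt[OF step(2)]
        using step p by (intro add_right_mono mult_left_mono) auto
      finally show ?case .
    qed
  qed (simp add: l_ge)
  \<comment> \<open>This is the induction step of \<open>key\<close>: from \<open>j\<close> to
    \<open>Suc j\<close> the left side of \<open>key\<close> drops by
    \<open>l (Suc j) - l j\<close>, the right side by
    \<open>p * (l (Suc j) - \<eta> * \<mu> (Suc j))\<close>. Below \<open>n\<close> the recursion
    gives equality; from \<open>n\<close> on the second drop is 0 and the monotonicity of
    \<open>\<mu>\<close> suffices.\<close>
  have l_step: "l (Suc j) - l j \<ge> p * (l (Suc j) - \<eta> * \<mu> (Suc j))" for j
  proof (cases "j < n")
    case True then show ?thesis by (simp add: l_lt algebra_simps)
  next
    case False then show ?thesis using mono\<mu>[of j] \<eta> by (simp add: l_ge)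
  qed
  have l_mono: "l j \<le> l (Suc j)" for j
  proof -
    have "0 \<le> p * (l (Suc j) - \<eta> * \<mu> (Suc j))" using p l_mu[of "Suc j"] by auto
    then show ?thesis using l_step[of j] by linarith
  qed
  have incl: "incseq l" by (rule incseq_SucI) (rule l_mono)
  have l0: "l 0 = (1 - p) ^ k * l k + \<eta> * p * (\<Sum>i=1..k. (1 - p) ^ (i - 1) * \<mu> i)" if "k \<le> n" for k
    using that
  proof (induction k)
    case (Suc k)
    then show ?case using l_lt[of k] by (simp add: algebra_simps)
  qed simp
  have abel: "(1 - p)\<^sup>2 * (\<Sum>i=1..k. (1 - p) ^ (i - 1) * \<mu> i) =
      (1 - p) ^ Suc k * x (Suc k) + p * X k - (1 - p) * x 1" for k
    by (induction k) (auto simp: X_def \<mu>_def algebra_simps power2_eq_square)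
  have "B \<le> l 0"
  proof -
    have "(1 - p)\<^sup>2 * B / (\<eta> * p) + (1 - p) * x 1 \<le> p * X n"
      using n(1) p by (simp add: pos_divide_le_eq mult.commute)
    then have "(1 - p)\<^sup>2 * B / (\<eta> * p) \<le> (1 - p)\<^sup>2 * (\<Sum>i=1..n. (1 - p) ^ (i - 1) * \<mu> i)"
      unfolding abel using mult_nonneg_nonneg[OF _ n(3), of "(1 - p) ^ Suc n"] p by simp
    then have "(1 - p)\<^sup>2 * (B / (\<eta> * p)) \<le> (1 - p)\<^sup>2 * (\<Sum>i=1..n. (1 - p) ^ (i - 1) * \<mu> i)"
      by simp
    then have "B / (\<eta> * p) \<le> (\<Sum>i=1..n. (1 - p) ^ (i - 1) * \<mu> i)"
      by (rule mult_left_le_imp_le) (use p in auto)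
    then have "B \<le> \<eta> * p * (\<Sum>i=1..n. (1 - p) ^ (i - 1) * \<mu> i)"
      using p \<eta> by (simp add: pos_divide_le_eq mult.commute)
    moreover have "0 \<le> (1 - p) ^ n * l n" using n(2) p \<eta> by (simp add: l_ge)
    ultimately show ?thesis using l0[of n] by simp
  qed
  define a where "a = (\<lambda>j. exp (- (1 - \<eta>) * \<mu> j) * exp (- l j))"
  define v where "v = (\<lambda>j. exp (x j) * (\<Prod>i<j. a i))"
  have apos: "a j > 0" for j by (simp add: a_def)
  have vpos: "v j > 0" for j unfolding v_def using apos by (simp add: prod_pos)
  have vSuc: "v (Suc j) = v j * exp (\<eta> * \<mu> j - l j)" for j
    by (simp add: v_def a_def \<mu>_def exp_add[symmetric] exp_diff[symmetric] algebra_simps)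
  have lnv: "ln (v (Suc j)) = ln (v j) + (\<eta> * \<mu> j - l j)" for j
    using vpos[of j] by (simp add: vSuc ln_mult)
  \<comment> \<open>As \<open>l\<close> increases, the factor \<open>exp (- l j)\<close> can be
    taken out of the whole tail; what remains is part of the series \<open>S\<close>.\<close>
  have tail: "summable (\<lambda>i. a (i + j)) \<and> (\<Sum>i. a (i + j)) \<le> S * exp (- l j)" for j
  proof -
    have s1: "summable (\<lambda>i. exp (- (1 - \<eta>) * \<mu> (i + j)))"
      using \<eta>(3) by (rule summable_ignore_initial_segment)
    have s2: "summable (\<lambda>i. exp (- (1 - \<eta>) * \<mu> (i + j)) * exp (- l j))"
      using s1 by (rule summable_mult2)
    have le: "a (i + j) \<le> exp (- (1 - \<eta>) * \<mu> (i + j)) * exp (- l j)" for i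
      unfolding a_def using incl by (intro mult_left_mono) (auto simp: incseq_def)
    have s3: "summable (\<lambda>i. a (i + j))"
      using s2 le apos by (intro summable_comparison_test'[OF s2, of 0]) (auto simp: less_imp_le)
    have "(\<Sum>i. exp (- (1 - \<eta>) * \<mu> (i + j))) \<le> S"
    proof -
      have "(\<Sum>i. exp (- (1 - \<eta>) * \<mu> (i + j))) = S - (\<Sum>i<j. exp (- (1 - \<eta>) * \<mu> i))"
        unfolding S_def using suminf_minus_initial_segment[OF \<eta>(3)] by simp
      also have "\<dots> \<le> S" by (simp add: sum_nonneg)
      finally show ?thesis .
    qed
    then have "(\<Sum>i. exp (- (1 - \<eta>) * \<mu> (i + j))) * exp (- l j) \<le> S * exp (- l j)"
      by (rule mult_right_mono) simp
    moreover have "(\<Sum>i. a (i + j)) \<le> (\<Sum>i. exp (- (1 - \<eta>) * \<mu> (i + j))) * exp (- l j)"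
      using suminf_le[OF le s3 s2] suminf_mult2[OF s1] by simp
    ultimately show ?thesis using s3 by linarith
  qed
  have key: "ln S - l j \<le> p * ln (v (Suc j))" for j
  proof (induction j)
    case 0
    have "B1 \<le> l 0" using \<open>B \<le> l 0\<close> by (simp add: B_def)
    then have "ln S - p * (x 0 + \<eta> * \<mu> 0) \<le> (1 - p) * l 0"
      unfolding B1_def using p by (simp add: pos_divide_le_eq mult.commute)
    moreover have "ln (v 0) = x 0" by (simp add: v_def)
    ultimately show ?case unfolding lnv[of 0] by (simp add: algebra_simps)
  next
    case (Suc j)
    then show ?case using l_step[of j] unfolding lnv[of "Suc j"] by (simp add: algebra_simps)
  qed
  have 1: "(\<Sum>i. a (i + j)) \<le> v (Suc j) powr p" for j
  proof -
    have "(\<Sum>i. a (i + j)) \<le> exp (ln S - l j)"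
      using tail[of j] Spos by (simp add: exp_diff exp_minus field_simps)
    also have "\<dots> \<le> exp (p * ln (v (Suc j)))" using key by simp
    also have "\<dots> = v (Suc j) powr p" using vpos[of "Suc j"] by (simp add: powr_def)
    finally show ?thesis .
  qed
  have 2: "suminf a \<le> \<epsilon>"
  proof -
    have "ln (S / \<epsilon>) \<le> l 0" using \<open>B \<le> l 0\<close> by (simp add: B_def)
    then have "S / \<epsilon> \<le> exp (l 0)" using Spos assms(4)
      by (metis divide_pos_pos exp_le_cancel_iff exp_ln)
    then have "S * exp (- l 0) \<le> \<epsilon>" using assms(4) by (simp add: exp_minus field_simps)
    then show ?thesis using tail[of 0] by simp
  qed
  have vconst: "v j = v n" if "j \<ge> n" for j
    using that by (induction j rule: dec_induct) (auto simp: vSuc l_ge)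
  \<comment> \<open>From \<open>n\<close> on \<open>v\<close> is constant, so minus the logarithm of
    the product differs from \<open>x j\<close> by a constant and inherits the growth bound in
    \<open>admissible\<close>.\<close>
  have 3: "\<forall>\<^sub>F j in sequentially. (1 - p) ^ j * - ln (\<Prod>i<j. a i) \<le> e" if "e > 0" for e
  proof -
    have e1: "\<forall>\<^sub>F j in sequentially. (1 - p) ^ j * x j \<le> e / 2"
      using adm that unfolding admissible_def by (meson half_gt_zero)
    have "(\<lambda>j. (1 - p) ^ j * ln (v n)) \<longlonglongrightarrow> 0"
      using p by real_asymp
    then have e2: "\<forall>\<^sub>F j in sequentially. dist ((1 - p) ^ j * ln (v n)) 0 < e / 2"
      using that by (intro tendstoD) auto
    show ?thesis using e1 e2 eventually_ge_at_top[of n]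
    proof eventually_elim
      case (elim j)
      have "ln (v j) = x j + ln (\<Prod>i<j. a i)"
        unfolding v_def using apos by (subst ln_mult) (auto simp: prod_pos less_imp_neq[symmetric])
      then have "- ln (\<Prod>i<j. a i) = x j - ln (v n)" using vconst[OF elim(3)] by simp
      then have "(1 - p) ^ j * - ln (\<Prod>i<j. a i) = (1 - p) ^ j * x j - (1 - p) ^ j * ln (v n)"
        by (simp only: right_diff_distrib)
      then show ?case using elim by (simp add: dist_real_def)
    qed
  qed
  show ?thesis
    using apos tail[of 0] 1 2 3 unfolding v_def by (intro exI[of _ a]) auto
qed

section \<open>Iterated averages of a step\<close>


text \<open>The strict inequality at \<open>r\<close> admits \<open>r = 0\<close>, the Heaviside
  step with value 0 at 0, from which the averaging starts.\<close>

definition ramp :: "real \<Rightarrow> (real \<Rightarrow> real) \<Rightarrow> bool" where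
  "ramp r g \<longleftrightarrow> mono g \<and> (\<forall>x\<le>0. g x = 0) \<and> (\<forall>x>r. g x = 1)"

text \<open>Convolution with the uniform density on [0, a]. The window lies to the left of
  \<open>x\<close>, so zeros on the left half-line survive and the transition grows to the right
  only.\<close>

definition avg :: "real \<Rightarrow> (real \<Rightarrow> real) \<Rightarrow> real \<Rightarrow> real" where
  "avg a g x = integral {x - a..x} g / a"

lemma ramp_bounds:
  assumes "ramp r g" shows "0 \<le> g x" "g x \<le> 1"
proof -
  have "g (min x 0) \<le> g x" "g x \<le> g (max x (r + 1))"
    using monoD[of g "min x 0" x] monoD[of g x "max x (r + 1)"] assms
    by (simp_all add: ramp_def)
  moreover have "g (min x 0) = 0" "g (max x (r + 1)) = 1"
    using assms by (simp_all add: ramp_def)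
  ultimately show "0 \<le> g x" "g x \<le> 1" by auto
qed

lemma mono_integrable: "mono g \<Longrightarrow> g integrable_on {a..b::real}" for g :: "real \<Rightarrow> real"
  by (intro integrable_on_mono_on) (auto simp: mono_on_def mono_def)

lemma avg_bounds:
  assumes "mono g" "0 < a"
  shows "g (x - a) \<le> avg a g x" "avg a g x \<le> g x"
proof -
  have "integral {x - a..x} (\<lambda>_. g (x - a)) \<le> integral {x - a..x} g"
    using assms by (intro integral_le mono_integrable) (auto simp: mono_def)
  then show "g (x - a) \<le> avg a g x"
    using assms by (simp add: avg_def pos_le_divide_eq mult.commute)
  have "integral {x - a..x} g \<le> integral {x - a..x} (\<lambda>_. g x)"
    using assms by (intro integral_le mono_integrable) (auto simp: mono_def)
  then show "avg a g x \<le> g x"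
    using assms by (simp add: avg_def pos_divide_le_eq mult.commute)
qed

lemma avg_mono:
  assumes "mono g" "0 < a"
  shows "mono (avg a g)"
proof (rule monoI)
  fix x y :: real assume "x \<le> y"
  have eq: "integral {y - a..y} g = integral {x - a..x} (\<lambda>t. g (t + (y - x)))"
    using integral_shift_real_ivl[of "y - a" "y - x" y g] by (simp add: algebra_simps)
  have "mono (\<lambda>t. g (t + (y - x)))"
    using assms(1) by (auto simp: mono_def)
  then have "integral {x - a..x} g \<le> integral {x - a..x} (\<lambda>t. g (t + (y - x)))"
    using assms(1) \<open>x \<le> y\<close> by (intro integral_le mono_integrable) (auto simp: mono_def)
  then show "avg a g x \<le> avg a g y"
    using assms(2) unfolding avg_def eq by (simp add: divide_right_mono)
qed

lemma avg_le_avg: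
  assumes "mono g" "mono h" "\<And>x. g x \<le> h x" "0 < a"
  shows "avg a g x \<le> avg a h x"
  using assms unfolding avg_def by (intro divide_right_mono integral_le mono_integrable) auto

lemma ramp_avg:
  assumes "ramp r g" "0 < a"
  shows "ramp (r + a) (avg a g)"
proof -
  have m: "mono g" using assms by (simp add: ramp_def)
  have 1: "avg a g x = 0" if "x \<le> 0" for x
    using avg_bounds[OF m assms(2), of x] assms that by (simp add: ramp_def)
  have 2: "avg a g x = 1" if "x > r + a" for x
    using avg_bounds[OF m assms(2), of x] assms that by (simp add: ramp_def)
  show ?thesis using avg_mono[OF m assms(2)] 1 2 by (auto simp: ramp_def)
qed

lemma avg_alt:
  assumes "mono g" "c \<le> x - a" "0 < a"
  shows "avg a g x = (integral {c..x} g - integral {c..x - a} g) / a"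
proof -
  have "integral {c..x - a} g + integral {x - a..x} g = integral {c..x} g"
    using assms by (intro Henstock_Kurzweil_Integration.integral_combine mono_integrable) auto
  then show ?thesis by (simp add: avg_def algebra_simps)
qed

text \<open>Here the argument may jump. Every function of the tower is an average of a monotone one,
  and so gains the continuity that \<open>has_derivative_avg\<close> asks of its argument.\<close>

lemma isCont_avg:
  assumes "mono g" "0 < a"
  shows "isCont (avg a g) x"
proof -
  define c where "c = x - a - 1"
  have *: "continuous_on {c..x + 1} (\<lambda>x. integral {c..x} g)"
    by (intro indefinite_integral_continuous_1 mono_integrable assms)
  have "continuous_on {x - 1..x + 1} (\<lambda>x. (integral {c..x} g - integral {c..x - a} g) / a)"
    using assms(2)
    by (intro continuous_intros continuous_on_subset[OF *] continuous_on_compose2[OF *])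
      (auto simp: c_def)
  then have "continuous_on {x - 1..x + 1} (avg a g)"
    by (rule continuous_on_eq) (subst avg_alt[OF assms(1)], use assms(2) in \<open>auto simp: c_def\<close>)
  then show ?thesis
    by (rule continuous_on_interior) (simp add: interior_atLeastAtMost_real)
qed

lemma has_derivative_avg:
  assumes "mono g" "0 < a" "\<And>x. isCont g x"
  shows "(avg a g has_real_derivative (g x - g (x - a)) / a) (at x)"
proof -
  define c where "c = x - a - 1"
  have *: "((\<lambda>x. integral {c..x} g) has_real_derivative g t) (at t)" if "c < t" "t < x + 1" for t
  proof -
    have "((\<lambda>x. integral {c..x} g) has_real_derivative g t) (at t within {c..x + 1})"
      using assms(3) that
      by (intro integral_has_real_derivative continuous_at_imp_continuous_on) auto
    then show ?thesis using that by (simp add: at_within_Icc_at)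
  qed
  have "((\<lambda>x. integral {c..x - a} g) has_real_derivative g (x - a) * 1) (at x)"
    by (rule DERIV_chain2[OF *]) (use assms(2) in \<open>auto simp: c_def intro!: derivative_eq_intros\<close>)
  then have "((\<lambda>x. (integral {c..x} g - integral {c..x - a} g) / a) has_real_derivative
      (g x - g (x - a)) / a) (at x)"
    using assms(2) *[of x] by (auto intro!: derivative_eq_intros simp: c_def)
  then show ?thesis
  proof (rule has_field_derivative_transform_within[where d = 1])
    show "(integral {c..x'} g - integral {c..x' - a} g) / a = avg a g x'" if "dist x' x < 1" for x'
      using that by (intro avg_alt[symmetric] assms) (auto simp: c_def dist_real_def)
  qed auto
qed

text \<open>The earliest width \<open>a m\<close> belongs to the outermost average. Hence the
  recursion in \<open>k\<close> raises the start index \<open>m\<close>, and in the limit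
  differentiating the function with index \<open>m\<close> removes the width \<open>a m\<close> and
  leaves the one with index \<open>Suc m\<close>.\<close>

primrec iter_avg :: "(nat \<Rightarrow> real) \<Rightarrow> nat \<Rightarrow> nat \<Rightarrow> real \<Rightarrow> real" where
  "iter_avg a 0 m = (\<lambda>x. if x > 0 then 1 else 0)"
| "iter_avg a (Suc k) m = avg (a m) (iter_avg a k (Suc m))"

lemma ramp_iter_avg:
  assumes "\<And>j. 0 < a j"
  shows "ramp (\<Sum>i<k. a (i + m)) (iter_avg a k m)"
proof (induction k arbitrary: m)
  case 0
  show ?case by (auto simp: ramp_def mono_def)
next
  case (Suc k)
  have "(\<Sum>i<Suc k. a (i + m)) = (\<Sum>i<k. a (i + Suc m)) + a m"
    by (subst sum.lessThan_Suc_shift) simp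
  then show ?case using ramp_avg[OF Suc[of "Suc m"] assms] by simp
qed

lemma iter_avg_decreasing:
  assumes "\<And>j. 0 < a j"
  shows "iter_avg a (Suc k) m x \<le> iter_avg a k m x"
proof (induction k arbitrary: m x)
  case 0
  have "mono (iter_avg a 0 (Suc m))" using ramp_iter_avg[of a "Suc m" 0, OF assms] by (simp only: ramp_def)
  then show ?case using avg_bounds(2)[OF _ assms, of "iter_avg a 0 (Suc m)" m x] by simp
next
  case (Suc k)
  have "mono (iter_avg a k (Suc m))" for k m
    using ramp_iter_avg[of a "Suc m" k, OF assms] by (simp only: ramp_def)
  then show ?case using Suc[of "Suc m"] assms
    by (subst (1 2) iter_avg.simps) (intro avg_le_avg)
qed

text \<open>An average of a nondecreasing function lies below it, so the iterated averages of the Heaviside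
  step decrease with the number of averages and converge pointwise.\<close>

lemma smoothing_tower:
  assumes pos: "\<And>j. (0::real) < a j" and "summable a"
  obtains B where "\<And>m. ramp (\<Sum>i. a (i + m)) (B m)" "\<And>m x. isCont (B m) x"
    "\<And>m x. (B m has_real_derivative (B (Suc m) x - B (Suc m) (x - a m)) / a m) (at x)"
proof -
  define G where "G = iter_avg a"
  have ramp: "ramp (\<Sum>i<k. a (i + m)) (G k m)" for k m
    unfolding G_def by (rule ramp_iter_avg[OF pos])
  have dec: "decseq (\<lambda>k. G k m x)" for m x
    unfolding G_def by (rule decseq_SucI) (rule iter_avg_decreasing[OF pos])
  define B where "B = (\<lambda>m x. lim (\<lambda>k. G k m x))"
  have lim: "(\<lambda>k. G k m x) \<longlonglongrightarrow> B m x" for m x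
  proof -
    have "convergent (\<lambda>k. G k m x)"
      using decseq_convergent[OF dec, of 0 m x] ramp_bounds(1)[OF ramp] unfolding convergent_def by metis
    then show ?thesis by (simp add: B_def convergent_LIMSEQ_iff)
  qed
  have rampB: "ramp (\<Sum>i. a (i + m)) (B m)" for m
    unfolding ramp_def
  proof (intro conjI allI impI monoI)
    fix x y :: real assume "x \<le> y"
    then have "G k m x \<le> G k m y" for k using ramp[of m k] by (auto simp: ramp_def mono_def)
    then show "B m x \<le> B m y" by (intro LIMSEQ_le[OF lim lim]) auto
  next
    fix x :: real assume "x \<le> 0"
    then have "G k m x = 0" for k using ramp[of m k] by (auto simp: ramp_def)
    then show "B m x = 0" using LIMSEQ_unique[OF lim[of m x]] by auto
  next
    fix x assume x: "(\<Sum>i. a (i + m)) < x"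
    have "(\<Sum>i<k. a (i + m)) \<le> (\<Sum>i. a (i + m))" for k
      using assms by (intro sum_le_suminf) (auto simp: less_imp_le)
    then have "G k m x = 1" for k using ramp[of m k] x unfolding ramp_def by (meson le_less_trans)
    then show "B m x = 1" using LIMSEQ_unique[OF lim[of m x]] by auto
  qed
  have monoB: "mono (B m)" for m using rampB by (simp add: ramp_def)
  \<comment> \<open>The recursion of \<open>iter_avg\<close> passes to the limit by dominated
    convergence, all functions having values in [0, 1]. Continuity and the derivative formula follow
    from this fixed relation.\<close>
  have eq: "B m = avg (a m) (B (Suc m))" for m
  proof
    fix x
    have "(\<lambda>k. integral {x - a m..x} (G k (Suc m))) \<longlonglongrightarrow> integral {x - a m..x} (B (Suc m))"
    proof (rule dominated_convergence(2))
      show "G k (Suc m) integrable_on {x - a m..x}" for k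
        using ramp by (intro mono_integrable) (simp add: ramp_def)
      show "norm (G k (Suc m) t) \<le> 1" for k t
        using ramp_bounds[OF ramp, of k "Suc m" t] by simp
    qed (use lim in auto)
    then have "(\<lambda>k. G (Suc k) m x) \<longlonglongrightarrow> avg (a m) (B (Suc m)) x"
      unfolding G_def iter_avg.simps avg_def using pos[of m] by (intro tendsto_divide) auto
    then show "B m x = avg (a m) (B (Suc m)) x"
      using LIMSEQ_unique LIMSEQ_Suc[OF lim] by blast
  qed
  have cont: "isCont (B m) x" for m x
    unfolding eq[of m] by (rule isCont_avg[OF monoB pos])
  have "(B m has_real_derivative (B (Suc m) x - B (Suc m) (x - a m)) / a m) (at x)" for m x
    by (subst eq) (rule has_derivative_avg[OF monoB pos cont])
  then show ?thesis using rampB cont that by blast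
qed

text \<open>Composition of the backward difference quotients with steps a (n - 1), ..., a 0.
  Differentiation commutes with them, so for a smoothing tower \<open>B\<close> the n-th derivative
  of \<open>B 0\<close> is \<open>diff_quot a n (B n)\<close>.\<close>

primrec diff_quot :: "(nat \<Rightarrow> real) \<Rightarrow> nat \<Rightarrow> (real \<Rightarrow> real) \<Rightarrow> real \<Rightarrow> real" where
  "diff_quot a 0 g = g"
| "diff_quot a (Suc n) g = diff_quot a n (\<lambda>x. (g x - g (x - a n)) / a n)"

lemma diff_quot_deriv:
  assumes "\<And>x. (g has_real_derivative g' x) (at x)"
  shows "(diff_quot a n g has_real_derivative diff_quot a n g' x) (at x)"
  using assms
proof (induction n arbitrary: g g' x)
  case (Suc n)
  have "((\<lambda>x. g (x - a n)) has_real_derivative g' (x - a n)) (at x)" for x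
    using Suc.prems[of "x - a n"] DERIV_shift[of g "g' (x - a n)" x "- a n"] by simp
  then have "((\<lambda>x. (g x - g (x - a n)) / a n) has_real_derivative (g' x - g' (x - a n)) / a n) (at x)" for x
    using Suc.prems by (intro DERIV_cdivide DERIV_diff)
  then show ?case by (simp add: Suc.IH)
qed simp

lemma diff_quot_abs_le:
  assumes "\<And>j. 0 < a j" "\<And>x. \<bar>g x\<bar> \<le> K"
  shows "\<bar>diff_quot a n g x\<bar> \<le> 2 ^ n * K / (\<Prod>i<n. a i)"
  using assms(2)
proof (induction n arbitrary: g K x)
  case (Suc n)
  have "\<bar>(g y - g (y - a n)) / a n\<bar> \<le> 2 * K / a n" for y
    using Suc.prems[of y] Suc.prems[of "y - a n"] assms(1)[of n]
    by (auto simp: divide_right_mono)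
  from Suc.IH[of _ "2 * K / a n", OF this] show ?case by (simp add: field_simps)
qed (simp)

lemma diff_quot_const:
  assumes "\<And>j. 0 < a j" "\<And>y. y \<le> x \<Longrightarrow> g y = 0"
  shows "diff_quot a n g x = 0"
  using assms(2)
proof (induction n arbitrary: g)
  case (Suc n)
  have "(g y - g (y - a n)) / a n = 0" if "y \<le> x" for y
    using Suc.prems[of y] Suc.prems[of "y - a n"] that assms(1)[of n] by simp
  from Suc.IH[OF this] show ?case by simp
qed simp

text \<open>By subadditivity and translation invariance each difference at most doubles the
  integral, and the division by \<open>a i\<close> contributes the factor
  \<open>a i powr - p\<close>. This replaces counting the support intervals.\<close>

lemma diff_quot_pint:
  assumes "0 < p" "p \<le> 1" "\<And>j. 0 < a j" "g \<in> borel_measurable borel"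
  shows "pint p (\<lambda>x. complex_of_real (diff_quot a n g x)) \<le>
    ennreal (2 ^ n * (\<Prod>i<n. a i) powr - p) * pint p (\<lambda>x. complex_of_real (g x))"
  using assms(4)
proof (induction n arbitrary: g)
  case (Suc n)
  have [measurable]: "g \<in> borel_measurable borel" by fact
  let ?h = "\<lambda>x. (g x - g (x - a n)) / a n"
  have "(\<lambda>x. complex_of_real (?h x)) = (\<lambda>x. complex_of_real (1 / a n) *
      (complex_of_real (g x) - complex_of_real (g (x - a n))))"
    by auto
  then have "pint p (\<lambda>x. complex_of_real (?h x)) = ennreal ((1 / a n) powr p) *
      pint p (\<lambda>x. complex_of_real (g x) - complex_of_real (g (x - a n)))"
    using assms(3)[of n] by (simp only:) (subst pint_cmult, auto simp: norm_divide)
  also have "\<dots> \<le> ennreal ((1 / a n) powr p) *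
      (pint p (\<lambda>x. complex_of_real (g x)) + pint p (\<lambda>x. complex_of_real (g (x - a n))))"
    using assms by (intro mult_left_mono pint_diff) auto
  also have "pint p (\<lambda>x. complex_of_real (g (x - a n))) = pint p (\<lambda>x. complex_of_real (g x))"
    by (rule pint_translate[of "\<lambda>x. complex_of_real (g x)"]) measurable
  also have "ennreal ((1 / a n) powr p) * (pint p (\<lambda>x. complex_of_real (g x)) + pint p (\<lambda>x. complex_of_real (g x)))
     = ennreal (2 * a n powr - p) * pint p (\<lambda>x. complex_of_real (g x))"
  proof -
    have A: "(1 / a n) powr p = a n powr - p"
      using assms(3)[of n] by (simp add: powr_divide powr_minus_divide)
    have B: "ennreal (2 * a n powr - p) = 2 * ennreal (a n powr - p)"
      by (subst ennreal_mult) auto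
    have C: "c * (I + I) = 2 * c * I" for c I :: ennreal
      by (metis distrib_left distrib_right mult_2)
    show ?thesis unfolding A B by (rule C)
  qed
  finally have *: "pint p (\<lambda>x. complex_of_real (?h x)) \<le> \<dots>" .
  have "pint p (\<lambda>x. complex_of_real (diff_quot a (Suc n) g x)) \<le>
      ennreal (2 ^ n * (\<Prod>i<n. a i) powr - p) * pint p (\<lambda>x. complex_of_real (?h x))"
    unfolding diff_quot.simps by (rule Suc.IH) measurable
  also have "\<dots> \<le> ennreal (2 ^ n * (\<Prod>i<n. a i) powr - p) *
      (ennreal (2 * a n powr - p) * pint p (\<lambda>x. complex_of_real (g x)))"
    using * by (rule mult_left_mono) simp
  also have "\<dots> = ennreal (2 ^ Suc n * (\<Prod>i<Suc n. a i) powr - p) * pint p (\<lambda>x. complex_of_real (g x))"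
  proof -
    have "(\<Prod>i<Suc n. a i) powr - p = (\<Prod>i<n. a i) powr - p * a n powr - p"
      using assms(3) by (simp add: powr_mult prod_nonneg less_imp_le)
    then have "2 ^ Suc n * (\<Prod>i<Suc n. a i) powr - p =
        (2 ^ n * (\<Prod>i<n. a i) powr - p) * (2 * a n powr - p)"
      by simp
    moreover have "ennreal \<dots> = ennreal (2 ^ n * (\<Prod>i<n. a i) powr - p) * ennreal (2 * a n powr - p)"
      by (rule ennreal_mult) auto
    ultimately show ?thesis by (simp only: mult.assoc)
  qed
  finally show ?case .
qed simp

section \<open>Jets and smooth steps\<close>


text \<open>Keeping a function and all its derivatives as one sequence makes sums, translates and
  prepended primitives termwise operations, with no iterated derivative to compute;
  \<open>jet_nth_deriv\<close> makes the link to \<open>nth_deriv\<close>.\<close>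

definition jet :: "(nat \<Rightarrow> real \<Rightarrow> complex) \<Rightarrow> bool" where
  "jet G \<longleftrightarrow> (\<forall>n t. (G n has_vector_derivative G (Suc n) t) (at t))"

text \<open>The growth condition of the test class in the most restrictive case \<open>\<theta> = 0\<close>.\<close>

definition subcritical :: "real \<Rightarrow> (nat \<Rightarrow> real \<Rightarrow> complex) \<Rightarrow> bool" where
  "subcritical p G \<longleftrightarrow>
     (\<forall>e>0. \<forall>\<^sub>F n in sequentially. \<forall>t. cmod (G n t) \<le> exp (e / (1 - p) ^ n))"

lemma jet_isCont: "jet G \<Longrightarrow> isCont (G n) t"
  unfolding jet_def by (meson has_vector_derivative_continuous)

lemma jet_measurable: "jet G \<Longrightarrow> G n \<in> borel_measurable borel"
  by (intro borel_measurable_continuous_onI continuous_at_imp_continuous_on ballI jet_isCont)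

lemma jet_add: "jet F \<Longrightarrow> jet G \<Longrightarrow> jet (\<lambda>n t. F n t + G n t)"
  unfolding jet_def by (intro allI has_vector_derivative_add) auto

lemma jet_diff: "jet F \<Longrightarrow> jet G \<Longrightarrow> jet (\<lambda>n t. F n t - G n t)"
  unfolding jet_def by (intro allI has_vector_derivative_diff) auto

lemma jet_cmult: "jet F \<Longrightarrow> jet (\<lambda>n t. c * F n t)"
  unfolding jet_def by (intro allI has_vector_derivative_mult_right) auto

lemma jet_sum: "(\<And>i. i \<in> I \<Longrightarrow> jet (F i)) \<Longrightarrow> jet (\<lambda>n t. \<Sum>i\<in>I. F i n t)"
  unfolding jet_def by (intro allI has_vector_derivative_sum) auto

lemma jet_translate:
  assumes "jet F" shows "jet (\<lambda>n t. F n (t - s))"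
  unfolding jet_def
proof (intro allI)
  fix n t
  have "((F n \<circ> (\<lambda>t. t - s)) has_vector_derivative 1 *\<^sub>R F (Suc n) (t - s)) (at t)"
  proof (rule vector_diff_chain_at)
    have "((\<lambda>t. t - s) has_vector_derivative 1 - 0) (at t)"
      by (intro has_vector_derivative_diff has_vector_derivative_id has_vector_derivative_const)
    then show "((\<lambda>t. t - s) has_vector_derivative 1) (at t)" by simp
    show "(F n has_vector_derivative F (Suc n) (t - s)) (at (t - s))"
      using assms unfolding jet_def by blast
  qed
  then show "((\<lambda>t. F n (t - s)) has_vector_derivative F (Suc n) (t - s)) (at t)"
    by (simp add: o_def)
qed

lemma jet_locally_const:
  assumes "jet G" "open S" "t \<in> S" "\<And>s. s \<in> S \<Longrightarrow> G n s = c"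
  shows "G (Suc n) t = 0"
proof -
  have "((\<lambda>_. c) has_vector_derivative G (Suc n) t) (at t)"
  proof (rule has_vector_derivative_transform_within_open[of "G n"])
    show "(G n has_vector_derivative G (Suc n) t) (at t)" using assms(1) unfolding jet_def by blast
  qed (use assms in auto)
  then show ?thesis
    by (rule vector_derivative_unique_at) (rule has_vector_derivative_const)
qed

lemma one_over_power_at_top:
  assumes "0 < p" "p < (1::real)" "0 < e"
  shows "filterlim (\<lambda>n. e / (1 - p) ^ n) at_top sequentially"
proof -
  have "(\<lambda>n. (1 - p) ^ n) \<longlonglongrightarrow> 0"
    using assms by (intro LIMSEQ_power_zero) auto
  then have "filterlim (\<lambda>n. inverse ((1 - p) ^ n)) at_top sequentially"
    using assms by (intro filterlim_inverse_at_top) auto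
  then have "filterlim (\<lambda>n. e * inverse ((1 - p) ^ n)) at_top sequentially"
    by (rule filterlim_tendsto_pos_mult_at_top[OF tendsto_const, rotated]) (use assms in simp)
  then show ?thesis by (simp only: divide_inverse)
qed

lemma subcritical_add:
  assumes "0 < p" "p < 1" "subcritical p F" "subcritical p G"
  shows "subcritical p (\<lambda>n t. F n t + G n t)"
  unfolding subcritical_def
proof (intro allI impI)
  fix e :: real assume e: "0 < e"
  \<comment> \<open>One half of \<open>e\<close> bounds both summands; the other half absorbs the
    factor 2, because \<open>e / (1 - p) ^ n\<close> tends to infinity.\<close>
  have "\<forall>\<^sub>F n in sequentially. ln 2 \<le> (e / 2) / (1 - p) ^ n"
    using one_over_power_at_top[OF assms(1,2), of "e / 2"] e by (auto simp: filterlim_at_top)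
  moreover have "\<forall>\<^sub>F n in sequentially. \<forall>t. cmod (F n t) \<le> exp ((e / 2) / (1 - p) ^ n)"
    "\<forall>\<^sub>F n in sequentially. \<forall>t. cmod (G n t) \<le> exp ((e / 2) / (1 - p) ^ n)"
    using assms e unfolding subcritical_def by (meson half_gt_zero)+
  ultimately show "\<forall>\<^sub>F n in sequentially. \<forall>t. cmod (F n t + G n t) \<le> exp (e / (1 - p) ^ n)"
  proof eventually_elim
    case (elim n)
    define y where "y = (e / 2) / (1 - p) ^ n"
    have "exp (ln 2) \<le> exp y" unfolding y_def exp_le_cancel_iff by (rule elim(1))
    then have "2 \<le> exp y" by simp
    then have "2 * exp y \<le> exp y * exp y" by (intro mult_right_mono) auto
    also have "\<dots> = exp (e / (1 - p) ^ n)" by (simp add: y_def exp_add[symmetric] field_simps)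
    finally have *: "exp y + exp y \<le> exp (e / (1 - p) ^ n)" by simp
    show ?case
    proof
      fix t
      have "cmod (F n t + G n t) \<le> cmod (F n t) + cmod (G n t)" by (rule norm_triangle_ineq)
      also have "\<dots> \<le> exp y + exp y" using elim(2,3) unfolding y_def by (intro add_mono) auto
      finally show "cmod (F n t + G n t) \<le> exp (e / (1 - p) ^ n)" using * by simp
    qed
  qed
qed

lemma subcritical_cmult:
  assumes "0 < p" "p < 1" "subcritical p F"
  shows "subcritical p (\<lambda>n t. c * F n t)"
  unfolding subcritical_def
proof (intro allI impI)
  fix e :: real assume e: "0 < e"
  have "\<forall>\<^sub>F n in sequentially. cmod c \<le> (e / 2) / (1 - p) ^ n"
    using one_over_power_at_top[OF assms(1,2), of "e / 2"] e by (auto simp: filterlim_at_top)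
  moreover have "\<forall>\<^sub>F n in sequentially. \<forall>t. cmod (F n t) \<le> exp ((e / 2) / (1 - p) ^ n)"
    using assms e unfolding subcritical_def by (meson half_gt_zero)
  ultimately show "\<forall>\<^sub>F n in sequentially. \<forall>t. cmod (c * F n t) \<le> exp (e / (1 - p) ^ n)"
  proof eventually_elim
    case (elim n)
    define y where "y = (e / 2) / (1 - p) ^ n"
    have "cmod c \<le> y" unfolding y_def by (rule elim(1))
    then have "cmod c \<le> exp y" using exp_ge_add_one_self[of y] by linarith
    then have "cmod (c * F n t) \<le> exp y * exp y" for t
      using elim(2) unfolding y_def norm_mult by (intro mult_mono) auto
    also have "exp y * exp y = exp (e / (1 - p) ^ n)"
      by (simp add: y_def exp_add[symmetric] field_simps)
    finally show ?case by blast
  qed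
qed

lemma subcritical_0: "subcritical p (\<lambda>n t. 0)"
  by (simp add: subcritical_def)

lemma subcritical_sum:
  assumes "0 < p" "p < 1" "finite I" "\<And>i. i \<in> I \<Longrightarrow> subcritical p (F i)"
  shows "subcritical p (\<lambda>n t. \<Sum>i\<in>I. F i n t)"
  using assms(3,4)
  by (induction I rule: finite_induct) (auto intro!: subcritical_add subcritical_0 assms(1,2))

lemma subcritical_diff:
  assumes "0 < p" "p < 1" "subcritical p F" "subcritical p G"
  shows "subcritical p (\<lambda>n t. F n t - G n t)"
  using subcritical_add[OF assms(1-3) subcritical_cmult[OF assms(1,2,4), of "-1"]] by simp

lemma subcritical_translate: "subcritical p F \<Longrightarrow> subcritical p (\<lambda>n t. F n (t - s))"
  unfolding subcritical_def by (auto elim!: eventually_mono)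

text \<open>Used when a primitive is put in front of a jet: every bound moves to the next index,
  where more is allowed.\<close>

lemma subcritical_unshift:
  assumes "0 < p" "p < 1" "subcritical p (\<lambda>n. F (Suc n))"
  shows "subcritical p F"
  unfolding subcritical_def
proof (intro allI impI)
  fix e :: real assume "0 < e"
  then have "\<forall>\<^sub>F n in sequentially. \<forall>t. cmod (F (Suc n) t) \<le> exp (e / (1 - p) ^ n)"
    using assms(3) by (auto simp: subcritical_def)
  then have "\<forall>\<^sub>F n in sequentially. \<forall>t. cmod (F (Suc n) t) \<le> exp (e / (1 - p) ^ Suc n)"
  proof eventually_elim
    case (elim n)
    have "e / (1 - p) ^ n \<le> e / (1 - p) ^ Suc n"
      using assms \<open>0 < e\<close> by (intro divide_left_mono power_decreasing) auto
    then have "exp (e / (1 - p) ^ n) \<le> exp (e / (1 - p) ^ Suc n)" by simp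
    then show ?case using elim order_trans by blast
  qed
  then show "\<forall>\<^sub>F n in sequentially. \<forall>t. cmod (F n t) \<le> exp (e / (1 - p) ^ n)"
    by (subst (asm) eventually_sequentially_Suc)
qed

lemma smooth_step:
  assumes adm: "admissible p x" and p: "0 < p" "p < 1" and "0 < e"
  obtains \<Phi> where "jet \<Phi>" "subcritical p \<Phi>" "\<And>n t. t \<le> 0 \<Longrightarrow> \<Phi> n t = 0"
    "\<And>t. e < t \<Longrightarrow> \<Phi> 0 t = 1" "\<And>t. cmod (\<Phi> 0 t) \<le> 1"
    "\<And>n t. e < t \<Longrightarrow> \<Phi> (Suc n) t = 0"
    "\<And>n. pint p (\<Phi> (Suc n)) \<le> ennreal (e * exp (p * x (Suc n)))"
proof -
  \<comment> \<open>Chosen such that \<open>exp (p * x' n)\<close> is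
    \<open>e * exp (p * x n) / 2 ^ n\<close>: the power of 2 pays for the difference quotients, the
    factor \<open>e\<close> is the smallness claimed in the end.\<close>
  define x' where "x' = (\<lambda>n. x n - ln 2 / p * real n - (- ln e / p))"
  have adm': "admissible p x'" unfolding x'_def by (rule admissible_affine[OF adm p])
  obtain a where a': "(\<forall>j. 0 < a j) \<and> summable a \<and> suminf a \<le> e \<and>
    (\<forall>j. (\<Sum>i. a (i + j)) \<le> (exp (x' (Suc j)) * (\<Prod>i<Suc j. a i)) powr p) \<and>
    (\<forall>e>0. \<forall>\<^sub>F n in sequentially. (1 - p) ^ n * - ln (\<Prod>i<n. a i) \<le> e)"
    using width_sequence[OF adm' p \<open>0 < e\<close>] by (elim exE)
  have a: "\<And>j. 0 < a j" "summable a" "suminf a \<le> e"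
    "\<And>j. (\<Sum>i. a (i + j)) \<le> (exp (x' (Suc j)) * (\<Prod>i<Suc j. a i)) powr p"
    "\<And>e. e > 0 \<Longrightarrow> \<forall>\<^sub>F n in sequentially. (1 - p) ^ n * - ln (\<Prod>i<n. a i) \<le> e"
  proof -
    note c = a' conjunct2[OF a'] conjunct2[OF conjunct2[OF a']] conjunct2[OF conjunct2[OF conjunct2[OF a']]]
    note 1 = conjunct1[OF c(1)] and 2 = conjunct1[OF c(2)] and 3 = conjunct1[OF c(3)]
      and 4 = conjunct1[OF c(4)] and 5 = conjunct2[OF c(4)]
    show "0 < a j" for j by (rule spec[OF 1])
    show "summable a" "suminf a \<le> e" by (fact 2, fact 3)
    show "(\<Sum>i. a (i + j)) \<le> (exp (x' (Suc j)) * (\<Prod>i<Suc j. a i)) powr p" for j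
      by (rule spec[OF 4])
    show "\<forall>\<^sub>F n in sequentially. (1 - p) ^ n * - ln (\<Prod>i<n. a i) \<le> e" if "e > 0" for e
      by (rule mp[OF spec[OF 5] that])
  qed
  \<comment> \<open>The widths from index \<open>m\<close> on add up to \<open>r m\<close>, the
    length of the transition of \<open>B m\<close>.\<close>
  define r where "r = (\<lambda>m. \<Sum>i. a (i + m))"
  have r_Suc: "r m = r (Suc m) + a m" for m
    using suminf_split_head[of "\<lambda>i. a (i + m)"] a(2) by (simp add: r_def summable_iff_shift)
  have r_nonneg: "0 \<le> r m" for m
    unfolding r_def using a(1,2) by (intro suminf_nonneg) (auto simp: summable_iff_shift less_imp_le)
  have "\<exists>B. (\<forall>m. ramp (r m) (B m)) \<and> (\<forall>m t. isCont (B m) t) \<and>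
      (\<forall>m t. (B m has_real_derivative (B (Suc m) t - B (Suc m) (t - a m)) / a m) (at t))"
  proof (rule smoothing_tower[OF a(1,2)])
    fix B
    assume "\<And>m. ramp (\<Sum>i. a (i + m)) (B m)" "\<And>m t. isCont (B m) t"
      "\<And>m t. (B m has_real_derivative (B (Suc m) t - B (Suc m) (t - a m)) / a m) (at t)"
    then show ?thesis unfolding r_def by (intro exI[of _ B] conjI allI)
  qed
  then obtain B where B': "(\<forall>m. ramp (r m) (B m)) \<and> (\<forall>m t. isCont (B m) t) \<and>
      (\<forall>m t. (B m has_real_derivative (B (Suc m) t - B (Suc m) (t - a m)) / a m) (at t))"
    by (elim exE)
  have B: "\<And>m. ramp (r m) (B m)" "\<And>m t. isCont (B m) t"
    "\<And>m t. (B m has_real_derivative (B (Suc m) t - B (Suc m) (t - a m)) / a m) (at t)"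
  proof -
    note 1 = conjunct1[OF B'] and 2 = conjunct1[OF conjunct2[OF B']] and 3 = conjunct2[OF conjunct2[OF B']]
    show "ramp (r m) (B m)" for m by (rule spec[OF 1])
    show "isCont (B m) t" for m t by (rule spec[OF spec[OF 2]])
    show "(B m has_real_derivative (B (Suc m) t - B (Suc m) (t - a m)) / a m) (at t)" for m t
      by (rule spec[OF spec[OF 3]])
  qed
  have Bm: "B m \<in> borel_measurable borel" for m
    using B(2) by (intro borel_measurable_continuous_onI continuous_at_imp_continuous_on) auto
  have A: "0 < (\<Prod>i<n. a i)" for n using a(1) by (simp add: prod_pos)
  define \<Phi> where "\<Phi> = (\<lambda>n t. complex_of_real (diff_quot a n (B n) t))"
  have jet: "jet \<Phi>"
    unfolding jet_def \<Phi>_def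
  proof (intro allI)
    fix n t
    have "(diff_quot a n (B n) has_vector_derivative diff_quot a (Suc n) (B (Suc n)) t) (at t)"
      unfolding has_real_derivative_iff_has_vector_derivative[symmetric] diff_quot.simps
      by (rule diff_quot_deriv) (rule B(3))
    then show "((\<lambda>t. complex_of_real (diff_quot a n (B n) t)) has_vector_derivative
        complex_of_real (diff_quot a (Suc n) (B (Suc n)) t)) (at t)"
      by (rule bounded_linear.has_vector_derivative[OF bounded_linear_of_real])
  qed
  have one: "\<Phi> 0 t = 1" if "e < t" for t
    using B(1)[of 0] a(3) that by (simp add: \<Phi>_def ramp_def r_def)
  have zero: "\<Phi> (Suc n) t = 0" if "e < t" for n t
    using that
  proof (induction n arbitrary: t)
    case 0
    show ?case by (rule jet_locally_const[OF jet, of "{e<..}" _ _ 1]) (use 0 one in auto)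
  next
    case (Suc n)
    show ?case by (rule jet_locally_const[OF jet, of "{e<..}" _ _ 0]) (use Suc in auto)
  qed
  have sub: "subcritical p \<Phi>"
    unfolding subcritical_def
  proof (intro allI impI)
    fix e' :: real assume "0 < e'"
    have "(\<lambda>n. (1 - p) ^ n * (real n * ln 2)) \<longlonglongrightarrow> 0"
      using p by real_asymp
    then have "\<forall>\<^sub>F n in sequentially. dist ((1 - p) ^ n * (real n * ln 2)) 0 < e' / 2"
      using \<open>0 < e'\<close> by (intro tendstoD) auto
    moreover have "\<forall>\<^sub>F n in sequentially. (1 - p) ^ n * - ln (\<Prod>i<n. a i) \<le> e' / 2"
      by (rule a(5)) (use \<open>0 < e'\<close> in simp)
    ultimately show "\<forall>\<^sub>F n in sequentially. \<forall>t. cmod (\<Phi> n t) \<le> exp (e' / (1 - p) ^ n)"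
    proof eventually_elim
      case (elim n)
      have "(1 - p) ^ n * (real n * ln 2 - ln (\<Prod>i<n. a i)) =
          (1 - p) ^ n * (real n * ln 2) + (1 - p) ^ n * - ln (\<Prod>i<n. a i)"
        by (simp add: algebra_simps)
      also have "\<dots> \<le> e'" using elim by (simp add: dist_real_def)
      finally have "real n * ln 2 - ln (\<Prod>i<n. a i) \<le> e' / (1 - p) ^ n"
        using p by (simp add: pos_le_divide_eq mult.commute)
      then have "exp (real n * ln 2 - ln (\<Prod>i<n. a i)) \<le> exp (e' / (1 - p) ^ n)" by simp
      moreover have "exp (real n * ln 2 - ln (\<Prod>i<n. a i)) = 2 ^ n * 1 / (\<Prod>i<n. a i)"
        using A[of n] by (simp add: exp_diff exp_of_nat_mult)
      moreover have "cmod (\<Phi> n t) \<le> 2 ^ n * 1 / (\<Prod>i<n. a i)" for t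
        unfolding \<Phi>_def norm_of_real
        using ramp_bounds[OF B(1)[of n]] by (intro diff_quot_abs_le a(1)) auto
      ultimately show ?case by (metis order_trans)
    qed
  qed
  have bound: "pint p (\<Phi> (Suc n)) \<le> ennreal (e * exp (p * x (Suc n)))" for n
  proof -
    \<comment> \<open>The innermost quotient is estimated by hand: \<open>B (Suc n)\<close> equals 1
      far to the right and has infinite \<open>pint\<close>, while its difference \<open>h\<close>
      lives on [0, r n] and is at most 1 / a n. Only the other \<open>n\<close> quotients go through
      \<open>diff_quot_pint\<close>.\<close>
    define h where "h = (\<lambda>t. (B (Suc n) t - B (Suc n) (t - a n)) / a n)"
    have h0: "h t = 0" if "t < 0 \<or> t > r n" for t
      using that B(1)[of "Suc n"] a(1)[of n] r_Suc[of n] by (auto simp: h_def ramp_def)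
    have h1: "cmod (complex_of_real (h t)) \<le> 1 / a n" for t
      using ramp_bounds[OF B(1)[of "Suc n"], of t] ramp_bounds[OF B(1)[of "Suc n"], of "t - a n"]
        a(1)[of n] unfolding norm_of_real h_def by (simp add: divide_right_mono)
    have hm: "h \<in> borel_measurable borel"
      unfolding h_def by (intro borel_measurable_divide borel_measurable_diff Bm
          measurable_compose[OF _ Bm]) simp_all
    have "pint p (\<Phi> (Suc n)) = pint p (\<lambda>t. complex_of_real (diff_quot a n h t))"
      unfolding \<Phi>_def diff_quot.simps h_def by (rule refl)
    also have "\<dots> \<le> ennreal (2 ^ n * (\<Prod>i<n. a i) powr - p) * pint p (\<lambda>t. complex_of_real (h t))"
      using p by (intro diff_quot_pint a(1) hm) auto
    also have "\<dots> \<le> ennreal (2 ^ n * (\<Prod>i<n. a i) powr - p) * ennreal ((1 / a n) powr p * (r n - 0))"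
      using p r_nonneg h0 h1 by (intro mult_left_mono pint_le_interval) auto
    also have "\<dots> = ennreal (2 ^ n * (\<Prod>i<n. a i) powr - p * ((1 / a n) powr p * (r n - 0)))"
      using r_nonneg[of n] by (intro ennreal_mult[symmetric]) auto
    also have "\<dots> \<le> ennreal (e * exp (p * x (Suc n)))"
    proof (rule ennreal_leI)
      have eq: "(\<Prod>i<n. a i) powr - p * (1 / a n) powr p = (\<Prod>i<Suc n. a i) powr - p"
      proof -
        have "(1 / a n) powr p = a n powr - p"
          using a(1)[of n] by (simp add: powr_divide powr_minus_divide)
        then show ?thesis using a(1) by (simp add: powr_mult prod_nonneg less_imp_le)
      qed
      define P where "P = (\<Prod>i<Suc n. a i)"
      have "0 < P" unfolding P_def by (rule A)
      have "P powr - p * (exp (x' (Suc n)) * P) powr p = exp (x' (Suc n)) powr p * (P powr - p * P powr p)"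
        using \<open>0 < P\<close> by (simp add: powr_mult)
      also have "P powr - p * P powr p = 1"
        using \<open>0 < P\<close> by (simp add: powr_add[symmetric])
      also have "exp (x' (Suc n)) powr p * 1 = exp (p * x (Suc n) - ln 2 * real (Suc n) + ln e)"
      proof -
        have "x' (Suc n) * p = p * x (Suc n) - ln 2 * real (Suc n) + ln e"
          unfolding x'_def using p by (simp add: field_simps)
        then show ?thesis by (simp only: exp_powr_real mult_1_right)
      qed
      also have "\<dots> = exp (p * x (Suc n)) * e / 2 ^ Suc n"
      proof -
        have "exp (ln 2 * real (Suc n)) = (2::real) ^ Suc n"
          using exp_of_nat_mult[of "Suc n" "ln 2 :: real"] by (simp only: mult.commute exp_ln zero_less_numeral)
        moreover have "exp (ln e) = e" using \<open>0 < e\<close> by simp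
        ultimately show ?thesis by (simp only: exp_add exp_diff times_divide_eq_left)
      qed
      finally have E: "P powr - p * (exp (x' (Suc n)) * P) powr p = exp (p * x (Suc n)) * e / 2 ^ Suc n" .
      have "2 ^ n * (\<Prod>i<n. a i) powr - p * ((1 / a n) powr p * (r n - 0)) =
          2 ^ n * (P powr - p * r n)"
        unfolding P_def eq[symmetric] by simp
      also have "\<dots> \<le> 2 ^ n * (P powr - p * (exp (x' (Suc n)) * P) powr p)"
        using a(4)[of n] unfolding P_def r_def by (intro mult_left_mono) auto
      also have "\<dots> = 2 ^ n * (exp (p * x (Suc n)) * e / 2 ^ Suc n)"
        by (simp only: E)
      also have "\<dots> \<le> e * exp (p * x (Suc n))"
        using \<open>0 < e\<close> by simp
      finally show "2 ^ n * (\<Prod>i<n. a i) powr - p * ((1 / a n) powr p * (r n - 0))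
         \<le> e * exp (p * x (Suc n))" .
    qed
    finally show ?thesis .
  qed
  show ?thesis
  proof (rule that[of \<Phi>])
    show "jet \<Phi>" "subcritical p \<Phi>" by fact+
    show "\<Phi> 0 t = 1" "\<Phi> (Suc n) t = 0" if "e < t" for n t using that by (fact one, fact zero)
    show "pint p (\<Phi> (Suc n)) \<le> ennreal (e * exp (p * x (Suc n)))" for n by (fact bound)
    show "\<Phi> n t = 0" if "t \<le> 0" for n t
    proof -
      have "B n y = 0" if "y \<le> t" for y
        using B(1)[of n] that \<open>t \<le> 0\<close> unfolding ramp_def by simp
      then show ?thesis using diff_quot_const[of a t "B n" n] a(1) unfolding \<Phi>_def by simp
    qed
    show "cmod (\<Phi> 0 t) \<le> 1" for t
      using ramp_bounds[OF B(1)[of 0], of t] by (simp add: \<Phi>_def)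
  qed
qed

section \<open>Approximation by test jets\<close>


text \<open>The support is bounded uniformly in \<open>n\<close>. It is what makes a primitive
  constant far out, so that finitely many steps can cancel it there.\<close>

definition test_jet :: "real \<Rightarrow> (nat \<Rightarrow> real) \<Rightarrow> (nat \<Rightarrow> real \<Rightarrow> complex) \<Rightarrow> bool" where
  "test_jet p x G \<longleftrightarrow> jet G \<and> subcritical p G \<and> (\<exists>R. \<forall>n t. R < \<bar>t\<bar> \<longrightarrow> G n t = 0) \<and>
     (\<exists>C. \<forall>n. pint p (G n) \<le> ennreal (C * exp (p * x n)))"

text \<open>Membership in the closure of the test jets, with distances in p-th powers relative to
  the weights \<open>exp (x n)\<close>. The entries of \<open>H\<close> need not be derivatives of
  each other; that independence is the phenomenon to be proved.\<close>

definition approximable :: "real \<Rightarrow> (nat \<Rightarrow> real) \<Rightarrow> (nat \<Rightarrow> real \<Rightarrow> complex) \<Rightarrow> bool" where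
  "approximable p x H \<longleftrightarrow> (\<forall>n. H n \<in> borel_measurable borel) \<and>
     (\<forall>e>0. \<exists>G. test_jet p x G \<and> (\<forall>n. pint p (\<lambda>t. G n t - H n t) \<le> ennreal (e * exp (p * x n))))"

lemma test_jet_measurable: "test_jet p x G \<Longrightarrow> G n \<in> borel_measurable borel"
  unfolding test_jet_def by (rule jet_measurable) (rule conjunct1)

lemma ennreal_add_mult:
  assumes "0 \<le> a" "0 \<le> b" "0 \<le> y"
  shows "ennreal (a * y) + ennreal (b * y) = ennreal ((a + b) * y)"
  using assms by (subst ennreal_plus[symmetric]) (auto simp: distrib_right)

lemma test_jet_add:
  assumes "0 < p" "p < 1" and F: "test_jet p x F" and G: "test_jet p x G"
  shows "test_jet p x (\<lambda>n t. F n t + G n t)"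
proof -
  obtain R where R: "\<forall>n t. R < \<bar>t\<bar> \<longrightarrow> F n t = 0" using F unfolding test_jet_def by (elim conjE exE)
  obtain S where S: "\<forall>n t. S < \<bar>t\<bar> \<longrightarrow> G n t = 0" using G unfolding test_jet_def by (elim conjE exE)
  obtain C where C: "\<forall>n. pint p (F n) \<le> ennreal (C * exp (p * x n))"
    using F unfolding test_jet_def by (elim conjE exE)
  obtain D where D: "\<forall>n. pint p (G n) \<le> ennreal (D * exp (p * x n))"
    using G unfolding test_jet_def by (elim conjE exE)
  have "pint p (\<lambda>t. F n t + G n t) \<le> ennreal ((\<bar>C\<bar> + \<bar>D\<bar>) * exp (p * x n))" for n
  proof -
    have "pint p (\<lambda>t. F n t + G n t) \<le> pint p (F n) + pint p (G n)"
      using assms by (intro pint_add test_jet_measurable[OF F] test_jet_measurable[OF G]) auto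
    also have "\<dots> \<le> ennreal (\<bar>C\<bar> * exp (p * x n)) + ennreal (\<bar>D\<bar> * exp (p * x n))"
    proof (rule add_mono)
      show "pint p (F n) \<le> ennreal (\<bar>C\<bar> * exp (p * x n))"
        by (rule order_trans[OF spec[OF C]]) (intro ennreal_leI mult_right_mono, auto)
      show "pint p (G n) \<le> ennreal (\<bar>D\<bar> * exp (p * x n))"
        by (rule order_trans[OF spec[OF D]]) (intro ennreal_leI mult_right_mono, auto)
    qed
    also have "\<dots> = ennreal ((\<bar>C\<bar> + \<bar>D\<bar>) * exp (p * x n))" by (rule ennreal_add_mult) auto
    finally show ?thesis .
  qed
  moreover have "\<forall>n t. max R S < \<bar>t\<bar> \<longrightarrow> F n t + G n t = 0" using R S by simp
  moreover have "jet (\<lambda>n t. F n t + G n t)" "subcritical p (\<lambda>n t. F n t + G n t)"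
    using assms by (simp_all add: test_jet_def jet_add subcritical_add)
  ultimately show ?thesis unfolding test_jet_def by metis
qed

lemma test_jet_cmult:
  assumes "0 < p" "p < 1" and F: "test_jet p x F"
  shows "test_jet p x (\<lambda>n t. c * F n t)"
proof -
  obtain R where R: "\<forall>n t. R < \<bar>t\<bar> \<longrightarrow> F n t = 0" using F unfolding test_jet_def by (elim conjE exE)
  obtain C where C: "\<forall>n. pint p (F n) \<le> ennreal (C * exp (p * x n))"
    using F unfolding test_jet_def by (elim conjE exE)
  have "pint p (\<lambda>t. c * F n t) \<le> ennreal (cmod c powr p * C * exp (p * x n))" for n
  proof -
    have "pint p (\<lambda>t. c * F n t) = ennreal (cmod c powr p) * pint p (F n)"
      by (rule pint_cmult[OF test_jet_measurable[OF F]])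
    also have "\<dots> \<le> ennreal (cmod c powr p) * ennreal (C * exp (p * x n))"
      by (rule mult_left_mono[OF spec[OF C]]) simp
    also have "\<dots> = ennreal (cmod c powr p * C * exp (p * x n))"
      by (subst ennreal_mult'[symmetric]) (auto simp: mult.assoc)
    finally show ?thesis .
  qed
  moreover have "\<forall>n t. R < \<bar>t\<bar> \<longrightarrow> c * F n t = 0" using R by simp
  moreover have "jet (\<lambda>n t. c * F n t)" "subcritical p (\<lambda>n t. c * F n t)"
    using assms by (simp_all add: test_jet_def jet_cmult subcritical_cmult)
  ultimately show ?thesis unfolding test_jet_def by metis
qed

lemma test_jet_0: "test_jet p x (\<lambda>n t. 0)"
proof -
  have "\<forall>n. pint p (\<lambda>t. 0) \<le> ennreal (0 * exp (p * x n))" by simp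
  then show ?thesis unfolding test_jet_def by (auto simp: jet_def subcritical_0)
qed

lemma approximable_0: "approximable p x (\<lambda>n t. 0)"
  unfolding approximable_def
  by (intro conjI allI impI exI[of _ "\<lambda>n t. 0"] test_jet_0) auto

lemma approximable_add:
  assumes p: "0 < p" "p < 1" and F: "approximable p x F" and G: "approximable p x G"
  shows "approximable p x (\<lambda>n t. F n t + G n t)"
  unfolding approximable_def
proof (intro conjI allI impI)
  have m [measurable]: "F n \<in> borel_measurable borel" "G n \<in> borel_measurable borel" for n
    using F G unfolding approximable_def by simp_all
  show "(\<lambda>t. F n t + G n t) \<in> borel_measurable borel" for n by measurable
  fix e :: real assume "0 < e"
  then have e2: "0 < e / 2" by simp
  obtain F' where F': "test_jet p x F'"
    "\<forall>n. pint p (\<lambda>t. F' n t - F n t) \<le> ennreal (e / 2 * exp (p * x n))"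
    using F e2 unfolding approximable_def by meson
  obtain G' where G': "test_jet p x G'"
    "\<forall>n. pint p (\<lambda>t. G' n t - G n t) \<le> ennreal (e / 2 * exp (p * x n))"
    using G e2 unfolding approximable_def by meson
  show "\<exists>H. test_jet p x H \<and> (\<forall>n. pint p (\<lambda>t. H n t - (F n t + G n t)) \<le> ennreal (e * exp (p * x n)))"
  proof (intro exI[of _ "\<lambda>n t. F' n t + G' n t"] conjI allI)
    show "test_jet p x (\<lambda>n t. F' n t + G' n t)" by (rule test_jet_add[OF p F'(1) G'(1)])
    fix n
    have [measurable]: "F' n \<in> borel_measurable borel" "G' n \<in> borel_measurable borel"
      using test_jet_measurable F'(1) G'(1) by auto
    have "pint p (\<lambda>t. F' n t + G' n t - (F n t + G n t)) =
        pint p (\<lambda>t. (F' n t - F n t) + (G' n t - G n t))"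
      by (simp add: algebra_simps)
    also have "\<dots> \<le> pint p (\<lambda>t. F' n t - F n t) + pint p (\<lambda>t. G' n t - G n t)"
      using p by (intro pint_add) auto
    also have "\<dots> \<le> ennreal (e / 2 * exp (p * x n)) + ennreal (e / 2 * exp (p * x n))"
      by (rule add_mono[OF spec[OF F'(2)] spec[OF G'(2)]])
    also have "\<dots> = ennreal (e * exp (p * x n))"
      using \<open>0 < e\<close> by (subst ennreal_add_mult) auto
    finally show "pint p (\<lambda>t. F' n t + G' n t - (F n t + G n t)) \<le> ennreal (e * exp (p * x n))" .
  qed
qed

lemma approximable_cmult:
  assumes p: "0 < p" "p < 1" and F: "approximable p x F"
  shows "approximable p x (\<lambda>n t. c * F n t)"
  unfolding approximable_def
proof (intro conjI allI impI)
  have m [measurable]: "F n \<in> borel_measurable borel" for n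
    using F unfolding approximable_def by simp_all
  show "(\<lambda>t. c * F n t) \<in> borel_measurable borel" for n by measurable
  fix e :: real assume "0 < e"
  define d where "d = e / (cmod c powr p + 1)"
  have "0 \<le> cmod c powr p" by simp
  then have d: "0 < d" "cmod c powr p * d \<le> e"
    using \<open>0 < e\<close> by (auto simp: d_def pos_divide_le_eq add_nonneg_pos distrib_left mult.commute)
  obtain F' where F': "test_jet p x F'"
    "\<forall>n. pint p (\<lambda>t. F' n t - F n t) \<le> ennreal (d * exp (p * x n))"
    using F d(1) unfolding approximable_def by meson
  show "\<exists>H. test_jet p x H \<and> (\<forall>n. pint p (\<lambda>t. H n t - c * F n t) \<le> ennreal (e * exp (p * x n)))"
  proof (intro exI[of _ "\<lambda>n t. c * F' n t"] conjI allI)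
    show "test_jet p x (\<lambda>n t. c * F' n t)" by (rule test_jet_cmult[OF p F'(1)])
    fix n
    have [measurable]: "F' n \<in> borel_measurable borel"
      using test_jet_measurable F'(1) by auto
    have "pint p (\<lambda>t. c * F' n t - c * F n t) = pint p (\<lambda>t. c * (F' n t - F n t))"
      by (simp add: right_diff_distrib)
    also have "\<dots> = ennreal (cmod c powr p) * pint p (\<lambda>t. F' n t - F n t)"
      by (rule pint_cmult) measurable
    also have "\<dots> \<le> ennreal (cmod c powr p) * ennreal (d * exp (p * x n))"
      by (rule mult_left_mono[OF spec[OF F'(2)]]) simp
    also have "\<dots> = ennreal (cmod c powr p * d * exp (p * x n))"
      by (subst ennreal_mult'[symmetric]) (auto simp: mult.assoc)
    also have "\<dots> \<le> ennreal (e * exp (p * x n))"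
      using d(2) by (intro ennreal_leI mult_right_mono) auto
    finally show "pint p (\<lambda>t. c * F' n t - c * F n t) \<le> ennreal (e * exp (p * x n))" .
  qed
qed

lemma approximable_sum:
  assumes p: "0 < p" "p < 1" and "finite I" "\<And>i. i \<in> I \<Longrightarrow> approximable p x (F i)"
  shows "approximable p x (\<lambda>n t. \<Sum>i\<in>I. F i n t)"
  using assms(3,4)
proof (induction I rule: finite_induct)
  case empty
  then show ?case by (simp add: approximable_0)
next
  case (insert i I)
  have "approximable p x (\<lambda>n t. F i n t + (\<Sum>i\<in>I. F i n t))"
    using insert.prems insert.IH by (intro approximable_add p) auto
  then show ?case using insert.hyps by simp
qed

lemma approximable_limit:
  assumes p: "0 < p" "p < 1" and m [measurable]: "\<And>n. H n \<in> borel_measurable borel"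
    and lim: "\<And>e. 0 < e \<Longrightarrow> \<exists>F. approximable p x F \<and>
      (\<forall>n. pint p (\<lambda>t. F n t - H n t) \<le> ennreal (e * exp (p * x n)))"
  shows "approximable p x H"
  unfolding approximable_def
proof (intro conjI allI impI m)
  fix e :: real assume "0 < e"
  then have e2: "0 < e / 2" by simp
  obtain F where F: "approximable p x F"
    "\<forall>n. pint p (\<lambda>t. F n t - H n t) \<le> ennreal (e / 2 * exp (p * x n))"
    using lim[OF e2] by meson
  have Fm [measurable]: "F n \<in> borel_measurable borel" for n
    using F(1) unfolding approximable_def by simp
  obtain G where G: "test_jet p x G"
    "\<forall>n. pint p (\<lambda>t. G n t - F n t) \<le> ennreal (e / 2 * exp (p * x n))"
    using F(1) e2 unfolding approximable_def by meson
  show "\<exists>G. test_jet p x G \<and> (\<forall>n. pint p (\<lambda>t. G n t - H n t) \<le> ennreal (e * exp (p * x n)))"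
  proof (intro exI[of _ G] conjI allI G(1))
    fix n
    have [measurable]: "G n \<in> borel_measurable borel"
      using test_jet_measurable G(1) by auto
    have "pint p (\<lambda>t. G n t - H n t) \<le> pint p (\<lambda>t. G n t - F n t) + pint p (\<lambda>t. F n t - H n t)"
      using p by (intro pint_triangle) auto
    also have "\<dots> \<le> ennreal (e / 2 * exp (p * x n)) + ennreal (e / 2 * exp (p * x n))"
      by (rule add_mono[OF spec[OF G(2)] spec[OF F(2)]])
    also have "\<dots> = ennreal (e * exp (p * x n))"
      using \<open>0 < e\<close> by (subst ennreal_add_mult) auto
    finally show "pint p (\<lambda>t. G n t - H n t) \<le> ennreal (e * exp (p * x n))" .
  qed
qed

definition single :: "nat \<Rightarrow> (real \<Rightarrow> complex) \<Rightarrow> nat \<Rightarrow> real \<Rightarrow> complex" where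
  "single k g n = (if n = k then g else (\<lambda>t. 0))"

lemma approximable_indicator:
  assumes adm: "admissible p x" and p: "0 < p" "p < 1" and "a \<le> b"
  shows "approximable p x (single 0 (indicator {a..<b}))"
  unfolding approximable_def
proof (intro conjI allI impI)
  show "single 0 (indicator {a..<b}) n \<in> borel_measurable borel" for n
    by (simp add: single_def)
  fix e :: real assume "0 < e"
  \<comment> \<open>\<open>e / 2\<close> serves the derivatives, where two steps add up. In the
    zeroth entry the error is at most 2 on two intervals of length \<open>d\<close>, and 2^p <= 2,
    which costs at most \<open>4 * d\<close>.\<close>
  define d where "d = min (e / 2) (e * exp (p * x 0) / 4)"
  have d: "0 < d" "2 * d \<le> e" "4 * d \<le> e * exp (p * x 0)"
    using \<open>0 < e\<close> by (auto simp: d_def)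
  obtain \<Phi> where \<Phi>: "jet \<Phi>" "subcritical p \<Phi>" "\<And>n t. t \<le> 0 \<Longrightarrow> \<Phi> n t = 0"
    "\<And>t. d < t \<Longrightarrow> \<Phi> 0 t = 1" "\<And>t. cmod (\<Phi> 0 t) \<le> 1"
    "\<And>n t. d < t \<Longrightarrow> \<Phi> (Suc n) t = 0"
    "\<And>n. pint p (\<Phi> (Suc n)) \<le> ennreal (d * exp (p * x (Suc n)))"
    by (rule smooth_step[OF adm p d(1)]) metis
  define G where "G = (\<lambda>n t. \<Phi> n (t - a) - \<Phi> n (t - b))"
  have [measurable]: "\<Phi> n \<in> borel_measurable borel" for n by (rule jet_measurable[OF \<Phi>(1)])
  have jetG: "jet G" unfolding G_def by (intro jet_diff jet_translate \<Phi>(1))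
  have subG: "subcritical p G"
    unfolding G_def by (intro subcritical_diff subcritical_translate p \<Phi>(2))
  have supp: "G n t = 0" if "\<bar>a\<bar> + \<bar>b\<bar> + d < \<bar>t\<bar>" for n t
  proof -
    have "t - a \<le> 0 \<and> t - b \<le> 0 \<or> d < t - a \<and> d < t - b" using that d(1) by linarith
    then show ?thesis using \<Phi>(3,4,6) by (cases n) (auto simp: G_def)
  qed
  have bound: "pint p (G (Suc n)) \<le> ennreal (e * exp (p * x (Suc n)))" for n
  proof -
    have "pint p (G (Suc n)) \<le> pint p (\<lambda>t. \<Phi> (Suc n) (t - a)) + pint p (\<lambda>t. \<Phi> (Suc n) (t - b))"
      unfolding G_def using p by (intro pint_diff) auto
    also have "\<dots> = pint p (\<Phi> (Suc n)) + pint p (\<Phi> (Suc n))"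
      by (subst (1 2) pint_translate) auto
    also have "\<dots> \<le> ennreal (d * exp (p * x (Suc n))) + ennreal (d * exp (p * x (Suc n)))"
      by (intro add_mono \<Phi>(7))
    also have "\<dots> = ennreal ((d + d) * exp (p * x (Suc n)))"
      using d(1) by (intro ennreal_add_mult) auto
    also have "\<dots> \<le> ennreal (e * exp (p * x (Suc n)))"
      using d(2) by (intro ennreal_leI mult_right_mono) auto
    finally show ?thesis .
  qed
  have fin0: "pint p (G 0) \<le> ennreal (2 powr p * (2 * (\<bar>a\<bar> + \<bar>b\<bar> + d)))"
  proof -
    have "cmod (G 0 t) \<le> 2" for t
      unfolding G_def using norm_triangle_ineq4[of "\<Phi> 0 (t - a)" "\<Phi> 0 (t - b)"]
        \<Phi>(5)[of "t - a"] \<Phi>(5)[of "t - b"] by linarith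
    then have "pint p (G 0) \<le> ennreal (2 powr p * ((\<bar>a\<bar> + \<bar>b\<bar> + d) - (- (\<bar>a\<bar> + \<bar>b\<bar> + d))))"
      using p d(1) by (intro pint_le_interval supp) auto
    then show ?thesis by (simp add: algebra_simps)
  qed
  have test: "test_jet p x G"
    unfolding test_jet_def
  proof (intro conjI jetG subG)
    show "\<exists>R. \<forall>n t. R < \<bar>t\<bar> \<longrightarrow> G n t = 0" using supp by metis
    define C where "C = 2 powr p * (2 * (\<bar>a\<bar> + \<bar>b\<bar> + d)) / exp (p * x 0)"
    have "pint p (G n) \<le> ennreal (max C e * exp (p * x n))" for n
    proof (cases n)
      case 0
      have "2 powr p * (2 * (\<bar>a\<bar> + \<bar>b\<bar> + d)) = C * exp (p * x 0)" by (simp add: C_def)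
      also have "\<dots> \<le> max C e * exp (p * x 0)" by (intro mult_right_mono) auto
      finally show ?thesis using fin0 0 by (meson ennreal_leI order_trans)
    next
      case (Suc m)
      have "e * exp (p * x (Suc m)) \<le> max C e * exp (p * x (Suc m))" by (intro mult_right_mono) auto
      then show ?thesis using bound[of m] Suc by (meson ennreal_leI order_trans)
    qed
    then show "\<exists>C. \<forall>n. pint p (G n) \<le> ennreal (C * exp (p * x n))" by blast
  qed
  have "pint p (\<lambda>t. G 0 t - indicator {a..<b} t) \<le> ennreal (e * exp (p * x 0))"
  proof -
    \<comment> \<open>\<open>f s\<close> is the smooth step at \<open>s\<close> minus the jump at
      \<open>s\<close>; for \<open>a \<le> b\<close> the indicator is the difference of two jumps,
      so the error splits into \<open>f a\<close> and \<open>f b\<close>.\<close>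
    define f where "f = (\<lambda>s t. \<Phi> 0 (t - s) - (if t < s then 0 else 1))"
    have [measurable]: "f s \<in> borel_measurable borel" for s
      unfolding f_def by measurable
    have f0: "f s t = 0" if "t < s \<or> t > s + d" for s t
      using that d(1) \<Phi>(3)[of "t - s" 0] \<Phi>(4)[of "t - s"] by (auto simp: f_def)
    have f1: "cmod (f s t) \<le> 2" for s t
      using norm_triangle_ineq4[of "\<Phi> 0 (t - s)" 1] \<Phi>(5)[of "t - s"] by (auto simp: f_def)
    have "(\<lambda>t. G 0 t - indicator {a..<b} t) = (\<lambda>t. f a t - f b t)"
      using \<open>a \<le> b\<close> by (auto simp: G_def f_def indicator_def fun_eq_iff)
    then have "pint p (\<lambda>t. G 0 t - indicator {a..<b} t) \<le> pint p (f a) + pint p (f b)"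
      using p by (simp only:) (intro pint_diff, auto)
    also have "\<dots> \<le> ennreal (2 powr p * (a + d - a)) + ennreal (2 powr p * (b + d - b))"
      using p d(1) f0 f1 by (intro add_mono pint_le_interval) auto
    also have "\<dots> = ennreal (2 powr p * (2 * d))"
      using d(1) by (subst ennreal_plus[symmetric]) auto
    also have "\<dots> \<le> ennreal (e * exp (p * x 0))"
    proof (rule ennreal_leI)
      have "2 powr p \<le> (2::real) powr 1" using p by (intro powr_mono) auto
      then have "2 powr p * (2 * d) \<le> 2 * (2 * d)" using d(1) by (intro mult_right_mono) auto
      then show "2 powr p * (2 * d) \<le> e * exp (p * x 0)" using d(3) by linarith
    qed
    finally show ?thesis .
  qed
  then have "pint p (\<lambda>t. G n t - single 0 (indicator {a..<b}) n t) \<le> ennreal (e * exp (p * x n))" for n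
    using bound by (cases n) (auto simp: single_def)
  then show "\<exists>G. test_jet p x G \<and>
      (\<forall>n. pint p (\<lambda>t. G n t - single 0 (indicator {a..<b}) n t) \<le> ennreal (e * exp (p * x n)))"
    using test by blast
qed


section \<open>Primitives and the shift of an entry by one place\<close>

lemma has_vector_derivative_primitive:
  fixes f :: "real \<Rightarrow> complex"
  assumes cont: "\<And>t. isCont f t" and zero: "\<And>t. t \<le> a \<Longrightarrow> f t = 0"
  shows "((\<lambda>t. integral {a..t} f) has_vector_derivative f t) (at t)"
proof -
  \<comment> \<open>The base point moves to the left of both \<open>t\<close> and \<open>a\<close>,
    so that \<open>t\<close> becomes interior. Nothing changes, as \<open>f\<close> vanishes up to
    \<open>a\<close> and the integral over the empty interval is 0.\<close>
  define c where "c = min t a - 1"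
  have c_le: "integral {c..s} f = integral {a..s} f" if "c \<le> s" for s
  proof (cases "a \<le> s")
    case True
    have "integral {c..a} f = integral {c..a} (\<lambda>_. 0)"
      using zero by (intro integral_cong) auto
    moreover have "integral {c..a} f + integral {a..s} f = integral {c..s} f"
      using True cont by (intro Henstock_Kurzweil_Integration.integral_combine integrable_continuous_real
          continuous_at_imp_continuous_on) (auto simp: c_def)
    ultimately show ?thesis by simp
  next
    case False
    have "integral {c..s} f = integral {c..s} (\<lambda>_. 0)"
      using zero False by (intro integral_cong) auto
    then show ?thesis using False by simp
  qed
  have "((\<lambda>s. integral {c..s} f) has_vector_derivative f t) (at t within {c..t + 1})"
    using cont by (intro integral_has_vector_derivative continuous_at_imp_continuous_on) (auto simp: c_def)
  then have "((\<lambda>s. integral {c..s} f) has_vector_derivative f t) (at t)"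
    by (subst (asm) at_within_Icc_at) (auto simp: c_def)
  then show ?thesis
  proof (rule has_vector_derivative_transform_within_open)
    show "open {c<..}" "t \<in> {c<..}" by (auto simp: c_def)
  qed (simp add: c_le)
qed

text \<open>Steps before \<open>j\<close> are complete and those after \<open>j\<close> have not
  begun, so the sum telescopes except for the unfinished term \<open>j\<close>, which is absent when
  \<open>j = K\<close>.\<close>

lemma telescoping_steps:
  fixes c :: "nat \<Rightarrow> complex"
  assumes "j \<le> K" "\<And>k. k < j \<Longrightarrow> \<phi> k = 1" "\<And>k. j < k \<Longrightarrow> \<phi> k = 0" "cmod (\<phi> j) \<le> 1"
    and "\<And>k. cmod (P (Suc k) - P k) \<le> D"
  shows "cmod ((\<Sum>k<K. (P (Suc k) - P k) * \<phi> k) - (P j - P 0)) \<le> D"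
proof -
  have "(\<Sum>k<K. (P (Suc k) - P k) * \<phi> k) =
      (\<Sum>k<K. (if k < j then P (Suc k) - P k else 0) + (if k = j then (P (Suc k) - P k) * \<phi> k else 0))"
    using assms(2,3) by (intro sum.cong) (auto simp: not_less le_less)
  also have "\<dots> = (\<Sum>k<K. if k < j then P (Suc k) - P k else 0) +
      (if j < K then (P (Suc j) - P j) * \<phi> j else 0)"
    by (simp add: sum.distrib)
  also have "(\<Sum>k<K. if k < j then P (Suc k) - P k else 0) = (\<Sum>k<j. P (Suc k) - P k)"
    using assms(1) by (intro sum.mono_neutral_cong_right) auto
  also have "\<dots> = P j - P 0" by (rule sum_lessThan_telescope)
  finally have "(\<Sum>k<K. (P (Suc k) - P k) * \<phi> k) - (P j - P 0) =
      (if j < K then (P (Suc j) - P j) * \<phi> j else 0)" by simp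
  moreover have "0 \<le> D" using norm_ge_zero order_trans assms(5) by blast
  moreover have "cmod (P (Suc j) - P j) * cmod (\<phi> j) \<le> D * 1"
    using assms(4,5) \<open>0 \<le> D\<close> by (intro mult_mono) auto
  ultimately show ?thesis by (simp add: norm_mult)
qed

text \<open>The primitive \<open>P\<close> of a test function is replaced by \<open>P\<close> minus a sum of smooth steps that reproduces the
  increments of \<open>P\<close> on a fine partition. The difference is small, and the steps contribute little to the
  derivatives.\<close>

lemma approximable_lift:
  assumes adm: "admissible p x" and p: "0 < p" "p < 1" and H: "approximable p (\<lambda>n. x (Suc n)) H"
  shows "approximable p x (\<lambda>n. case n of 0 \<Rightarrow> (\<lambda>t. 0) | Suc m \<Rightarrow> H m)"
  unfolding approximable_def
proof (intro conjI allI impI)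
  have Hm [measurable]: "H n \<in> borel_measurable borel" for n
    using H unfolding approximable_def by simp
  show "(case n of 0 \<Rightarrow> (\<lambda>t. 0) | Suc m \<Rightarrow> H m) \<in> borel_measurable borel" for n
    by (cases n) auto
  fix e :: real assume e: "0 < e"
  then have e2: "0 < e / 2" by simp
  obtain f where f: "test_jet p (\<lambda>n. x (Suc n)) f"
    "\<forall>n. pint p (\<lambda>t. f n t - H n t) \<le> ennreal (e / 2 * exp (p * x (Suc n)))"
    using H e2 unfolding approximable_def by meson
  have jf: "jet f" and sf: "subcritical p f" using f(1) unfolding test_jet_def by auto
  have [measurable]: "f n \<in> borel_measurable borel" for n by (rule jet_measurable[OF jf])
  obtain R0 where R0: "\<forall>n t. R0 < \<bar>t\<bar> \<longrightarrow> f n t = 0"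
    using f(1) unfolding test_jet_def by (elim conjE exE)
  obtain C where C: "\<forall>n. pint p (f n) \<le> ennreal (C * exp (p * x (Suc n)))"
    using f(1) unfolding test_jet_def by (elim conjE exE)
  define R where "R = \<bar>R0\<bar> + 1"
  have R: "0 < R" "f n t = 0" if "R \<le> \<bar>t\<bar>" for n t
    using R0 that by (auto simp: R_def)
  have Rpos: "0 < R" by (simp add: R_def)
  have cont: "isCont (f 0) t" for t by (rule jet_isCont[OF jf])
  have "bounded (f 0 ` {-R..R})"
    using cont by (intro compact_imp_bounded compact_continuous_image continuous_at_imp_continuous_on) auto
  then obtain S where S: "0 < S" "\<forall>y\<in>f 0 ` {-R..R}. cmod y \<le> S"
    unfolding bounded_pos by blast
  define P where "P = (\<lambda>t. integral {-R..t} (f 0))"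
  have P0: "P t = 0" if "t \<le> - R" for t
    using that by (cases "t = - R") (auto simp: P_def)
  have Plip: "cmod (P t - P s) \<le> S * (t - s)" if "- R \<le> s" "s \<le> t" "t \<le> R" for s t
  proof -
    have "P s + integral {s..t} (f 0) = P t"
      unfolding P_def using that cont
      by (intro Henstock_Kurzweil_Integration.integral_combine integrable_continuous_real
          continuous_at_imp_continuous_on) auto
    moreover have "cmod (integral {s..t} (f 0)) \<le> S * (t - s)"
      using that cont S by (intro integral_bound continuous_at_imp_continuous_on) auto
    ultimately show ?thesis by (metis add_diff_cancel_left')
  qed
  have PR: "P t = P R" if "R \<le> t" for t
  proof -
    have "integral {-R..R} (f 0) + integral {R..t} (f 0) = integral {-R..t} (f 0)"
      using that Rpos cont
      by (intro Henstock_Kurzweil_Integration.integral_combine integrable_continuous_real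
          continuous_at_imp_continuous_on) auto
    moreover have "integral {R..t} (f 0) = integral {R..t} (\<lambda>_. 0)"
      using R by (intro integral_cong) auto
    ultimately show ?thesis by (simp add: P_def)
  qed
  have Pder: "(P has_vector_derivative f 0 t) (at t)" for t
    unfolding P_def using R Rpos by (intro has_vector_derivative_primitive cont) auto
  \<comment> \<open>The height for which a function bounded by \<open>y\<close> and supported in
    [-R, R] has \<open>pint\<close> at most \<open>e * exp (p * x 0)\<close>.\<close>
  define y where "y = (e * exp (p * x 0) / (2 * R)) powr (1 / p)"
  have y: "0 < y" "y powr p = e * exp (p * x 0) / (2 * R)"
    using e Rpos p by (auto simp: y_def powr_powr)
  \<comment> \<open>With \<open>K\<close> cells of length \<open>2 * R / K\<close> this gives
    \<open>2 * S * h \<le> y\<close>. Two errors of size \<open>S * h\<close> occur in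
    \<open>small\<close>: the variation of \<open>P\<close> within a cell and the unfinished
    step.\<close>
  obtain K where K: "4 * S * R / y < real K" using reals_Archimedean2 by blast
  have "0 < 4 * S * R / y" using S Rpos y by simp
  then have Kpos: "0 < real K" using K by linarith
  define h where "h = 2 * R / real K"
  have h: "0 < h" "real K * h = 2 * R" using Rpos Kpos by (auto simp: h_def)
  have hy: "2 * S * h \<le> y"
  proof -
    have "4 * S * R < real K * y" using K y(1) by (simp add: pos_divide_less_eq)
    then have "4 * S * R / real K < y" using Kpos by (simp add: pos_divide_less_eq mult.commute)
    then show ?thesis by (simp add: h_def)
  qed
  define \<tau> where "\<tau> = (\<lambda>k::nat. - R + real k * h)"
  have \<tau>_Suc: "\<tau> (Suc k) = \<tau> k + h" for k by (simp add: \<tau>_def algebra_simps)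
  have \<tau>_le: "\<tau> k + h \<le> R" if "k < K" for k
  proof -
    have "real (Suc k) * h \<le> real K * h" using that h(1) by (intro mult_right_mono) auto
    then show ?thesis using h(2) by (simp add: \<tau>_def algebra_simps)
  qed
  have \<tau>_ge: "- R \<le> \<tau> k" for k using h(1) by (simp add: \<tau>_def)
  define c where "c = (\<lambda>k. P (\<tau> (Suc k)) - P (\<tau> k))"
  have cS: "cmod (c k) \<le> S * h" for k
  proof -
    have Pmin: "P t = P (min t R)" for t using PR[of t] by (auto simp: min_def)
    have "cmod (P (min (\<tau> (Suc k)) R) - P (min (\<tau> k) R)) \<le> S * (min (\<tau> (Suc k)) R - min (\<tau> k) R)"
      using \<tau>_ge[of k] \<tau>_Suc[of k] h(1) Rpos by (intro Plip) auto
    also have "\<dots> \<le> S * h" using \<tau>_Suc[of k] h(1) S(1) by (intro mult_left_mono) auto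
    finally show ?thesis unfolding c_def using Pmin by metis
  qed
  define Q where "Q = (\<Sum>k<K. cmod (c k) powr p)"
  have Q: "0 \<le> Q" by (simp add: Q_def sum_nonneg)
  \<comment> \<open>The partition, and with it \<open>Q\<close>, is fixed before the step width
    \<open>d\<close>. However large \<open>Q\<close> is, all steps together then cost at most
    \<open>e / 2\<close> in the derivatives; \<open>d < h\<close> makes each step end before the
    next node.\<close>
  define d where "d = min (h / 2) (e / 2 / (Q + 1))"
  have d: "0 < d" "d < h" "d \<le> e / 2 / (Q + 1)" using h e Q by (auto simp: d_def)
  have Qd: "Q * d \<le> e / 2"
  proof -
    have "(Q + 1) * d \<le> e / 2" using d(3) Q by (subst (asm) pos_le_divide_eq) (auto simp: mult.commute)
    then show ?thesis using d(1) by (simp add: distrib_right)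
  qed
  obtain \<Phi> where \<Phi>: "jet \<Phi>" "subcritical p \<Phi>" "\<And>n t. t \<le> 0 \<Longrightarrow> \<Phi> n t = 0"
    "\<And>t. d < t \<Longrightarrow> \<Phi> 0 t = 1" "\<And>t. cmod (\<Phi> 0 t) \<le> 1"
    "\<And>n t. d < t \<Longrightarrow> \<Phi> (Suc n) t = 0"
    "\<And>n. pint p (\<Phi> (Suc n)) \<le> ennreal (d * exp (p * x (Suc n)))"
    by (rule smooth_step[OF adm p d(1)]) metis
  have \<Phi>m [measurable]: "\<Phi> n \<in> borel_measurable borel" for n by (rule jet_measurable[OF \<Phi>(1)])
  define f' where "f' = (\<lambda>n. case n of 0 \<Rightarrow> P | Suc m \<Rightarrow> f m)"
  define g where "g = (\<lambda>n t. \<Sum>k<K. c k * \<Phi> n (t - \<tau> k))"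
  define F where "F = (\<lambda>n t. f' n t - g n t)"
  have jf': "jet f'"
    unfolding jet_def
  proof (intro allI)
    fix n t show "(f' n has_vector_derivative f' (Suc n) t) (at t)"
      using Pder jf by (cases n) (auto simp: f'_def jet_def)
  qed
  have jg: "jet g" unfolding g_def by (intro jet_sum jet_cmult jet_translate \<Phi>(1))
  have jF: "jet F" unfolding F_def by (intro jet_diff jf' jg)
  have sF: "subcritical p F"
    unfolding F_def g_def
    by (intro subcritical_diff subcritical_sum subcritical_cmult subcritical_translate \<Phi>(2) p
        subcritical_unshift[of p f']) (use sf in \<open>auto simp: f'_def\<close>)
  \<comment> \<open>The increments add up to the final value of \<open>P\<close>, so beyond
    \<open>R\<close> the steps cancel the primitive and the support stays bounded.\<close>
  have c_sum: "(\<Sum>k<K. c k) = P R"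
  proof -
    have "(\<Sum>k<K. c k) = P (\<tau> K) - P (\<tau> 0)" unfolding c_def by (rule sum_lessThan_telescope)
    moreover have "\<tau> K = R" "\<tau> 0 = - R" using h(2) by (auto simp: \<tau>_def)
    ultimately show ?thesis using P0 by simp
  qed
  have supp: "F n t = 0" if "R < \<bar>t\<bar>" for n t
  proof (cases "t < 0")
    case True
    then have t: "t < - R" using that by simp
    then have "\<Phi> n (t - \<tau> k) = 0" for k using \<tau>_ge[of k] by (intro \<Phi>(3)) linarith
    moreover have "f' n t = 0" using P0[of t] R(2)[of t] t by (cases n) (auto simp: f'_def)
    ultimately show ?thesis by (simp add: F_def g_def)
  next
    case False
    then have t: "R < t" using that by simp
    have *: "d < t - \<tau> k" if "k < K" for k using \<tau>_le[OF that] t d(2) by linarith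
    show ?thesis
    proof (cases n)
      case 0
      have "g 0 t = (\<Sum>k<K. c k)" unfolding g_def using \<Phi>(4) * by (intro sum.cong) auto
      then show ?thesis using PR[of t] t 0 c_sum by (simp add: F_def f'_def)
    next
      case (Suc m)
      have "g (Suc m) t = 0" unfolding g_def using \<Phi>(6) * by (intro sum.neutral) auto
      then show ?thesis using R(2)[of t m] t Suc by (simp add: F_def f'_def)
    qed
  qed
  have small: "cmod (F 0 t) \<le> y" for t
  proof (cases "\<bar>t\<bar> \<le> R")
    case True
    define j where "j = nat \<lfloor>(t + R) / h\<rfloor>"
    have nn: "0 \<le> (t + R) / h" using True h(1) by simp
    have "real j \<le> (t + R) / h" "(t + R) / h < real j + 1"
      using nn unfolding j_def by linarith+
    then have "real j * h \<le> t + R" "t + R < (real j + 1) * h"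
      using h(1) by (simp_all add: pos_le_divide_eq pos_divide_less_eq)
    then have j: "\<tau> j \<le> t" "t < \<tau> j + h" by (auto simp: \<tau>_def algebra_simps)
    have jK: "j \<le> K"
    proof -
      have "real j * h \<le> real K * h" using \<open>real j * h \<le> t + R\<close> True h(2) by linarith
      then show ?thesis using h(1) by simp
    qed
    have gap: "\<tau> k + h \<le> \<tau> l" if "k < l" for k l
    proof -
      have "real (Suc k) * h \<le> real l * h" using that h(1) by (intro mult_right_mono) auto
      then show ?thesis by (simp add: \<tau>_def algebra_simps)
    qed
    have "cmod (g 0 t - (P (\<tau> j) - P (\<tau> 0))) \<le> S * h"
      unfolding g_def c_def
    proof (rule telescoping_steps[OF jK, where P = "\<lambda>k. P (\<tau> k)"])
      show "\<Phi> 0 (t - \<tau> k) = 1" if "k < j" for k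
        using gap[OF that] j d(2) by (intro \<Phi>(4)) linarith
      show "\<Phi> 0 (t - \<tau> k) = 0" if "j < k" for k
        using gap[OF that] j by (intro \<Phi>(3)) linarith
      show "cmod (\<Phi> 0 (t - \<tau> j)) \<le> 1" by (rule \<Phi>(5))
      show "cmod (P (\<tau> (Suc k)) - P (\<tau> k)) \<le> S * h" for k using cS[of k] by (simp add: c_def)
    qed
    moreover have "P (\<tau> 0) = 0" by (rule P0) (simp add: \<tau>_def)
    moreover have "cmod (P t - P (\<tau> j)) \<le> S * h"
    proof -
      have "cmod (P t - P (\<tau> j)) \<le> S * (t - \<tau> j)"
        using \<tau>_ge[of j] j True by (intro Plip) auto
      also have "\<dots> \<le> S * h" using j S(1) by (intro mult_left_mono) auto
      finally show ?thesis .
    qed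
    moreover have "F 0 t = (P t - P (\<tau> j)) - (g 0 t - P (\<tau> j))"
      by (simp add: F_def f'_def)
    then have "cmod (F 0 t) \<le> cmod (P t - P (\<tau> j)) + cmod (g 0 t - P (\<tau> j))"
      by (simp only: norm_triangle_ineq4)
    ultimately show ?thesis using hy by simp
  next
    case False
    then show ?thesis using supp[of t 0] y(1) by simp
  qed
  have gpint: "pint p (g (Suc m)) \<le> ennreal (e / 2 * exp (p * x (Suc m)))" for m
  proof -
    have "pint p (g (Suc m)) \<le> (\<Sum>k<K. pint p (\<lambda>t. c k * \<Phi> (Suc m) (t - \<tau> k)))"
      unfolding g_def using p by (intro pint_sum) auto
    also have "\<dots> \<le> (\<Sum>k<K. ennreal (cmod (c k) powr p * (d * exp (p * x (Suc m)))))"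
    proof (rule sum_mono)
      fix k
      have "pint p (\<lambda>t. c k * \<Phi> (Suc m) (t - \<tau> k)) = ennreal (cmod (c k) powr p) * pint p (\<lambda>t. \<Phi> (Suc m) (t - \<tau> k))"
        by (rule pint_cmult) measurable
      also have "pint p (\<lambda>t. \<Phi> (Suc m) (t - \<tau> k)) = pint p (\<Phi> (Suc m))"
        by (rule pint_translate) measurable
      also have "ennreal (cmod (c k) powr p) * pint p (\<Phi> (Suc m)) \<le>
          ennreal (cmod (c k) powr p) * ennreal (d * exp (p * x (Suc m)))"
        by (rule mult_left_mono[OF \<Phi>(7)]) simp
      also have "\<dots> = ennreal (cmod (c k) powr p * (d * exp (p * x (Suc m))))"
        by (rule ennreal_mult'[symmetric]) simp
      finally show "pint p (\<lambda>t. c k * \<Phi> (Suc m) (t - \<tau> k)) \<le> \<dots>" .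
    qed
    also have "\<dots> = ennreal (\<Sum>k<K. cmod (c k) powr p * (d * exp (p * x (Suc m))))"
      using d(1) by (intro sum_ennreal) auto
    also have "(\<Sum>k<K. cmod (c k) powr p * (d * exp (p * x (Suc m)))) = Q * d * exp (p * x (Suc m))"
      by (simp add: Q_def sum_distrib_right mult.assoc)
    also have "ennreal \<dots> \<le> ennreal (e / 2 * exp (p * x (Suc m)))"
      using Qd by (intro ennreal_leI mult_right_mono) auto
    finally show ?thesis .
  qed
  have [measurable]: "g n \<in> borel_measurable borel" for n by (rule jet_measurable[OF jg])
  have F0: "pint p (F 0) \<le> ennreal (e * exp (p * x 0))"
  proof -
    have "pint p (F 0) \<le> ennreal (y powr p * (R - - R))"
      using supp small p Rpos by (intro pint_le_interval) auto
    also have "y powr p * (R - - R) = e * exp (p * x 0)" using y(2) Rpos by simp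
    finally show ?thesis .
  qed
  have FS: "F (Suc m) = (\<lambda>t. f m t - g (Suc m) t)" for m by (simp add: F_def f'_def)
  have test: "test_jet p x F"
    unfolding test_jet_def
  proof (intro conjI jF sF)
    show "\<exists>R. \<forall>n t. R < \<bar>t\<bar> \<longrightarrow> F n t = 0" using supp by metis
    have "pint p (F n) \<le> ennreal ((\<bar>C\<bar> + e) * exp (p * x n))" for n
    proof (cases n)
      case 0
      have "e * exp (p * x 0) \<le> (\<bar>C\<bar> + e) * exp (p * x 0)" by (intro mult_right_mono) auto
      then show ?thesis using F0 0 by (meson ennreal_leI order_trans)
    next
      case (Suc m)
      have "pint p (F (Suc m)) \<le> pint p (f m) + pint p (g (Suc m))"
        unfolding FS using p by (intro pint_diff) auto
      also have "\<dots> \<le> ennreal (\<bar>C\<bar> * exp (p * x (Suc m))) + ennreal (e / 2 * exp (p * x (Suc m)))"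
        by (intro add_mono gpint order_trans[OF spec[OF C]] ennreal_leI mult_right_mono) auto
      also have "\<dots> = ennreal ((\<bar>C\<bar> + e / 2) * exp (p * x (Suc m)))"
        using e by (intro ennreal_add_mult) auto
      also have "\<dots> \<le> ennreal ((\<bar>C\<bar> + e) * exp (p * x (Suc m)))"
        using e by (intro ennreal_leI mult_right_mono) auto
      finally show ?thesis using Suc by simp
    qed
    then show "\<exists>C. \<forall>n. pint p (F n) \<le> ennreal (C * exp (p * x n))" by blast
  qed
  have "pint p (\<lambda>t. F n t - (case n of 0 \<Rightarrow> (\<lambda>t. 0) | Suc m \<Rightarrow> H m) t) \<le> ennreal (e * exp (p * x n))" for n
  proof (cases n)
    case 0
    then show ?thesis using F0 by simp
  next
    case (Suc m)
    have "pint p (\<lambda>t. F (Suc m) t - H m t) = pint p (\<lambda>t. (f m t - H m t) - g (Suc m) t)"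
      by (simp add: FS algebra_simps)
    also have "\<dots> \<le> pint p (\<lambda>t. f m t - H m t) + pint p (g (Suc m))"
      using p by (intro pint_diff) auto
    also have "\<dots> \<le> ennreal (e / 2 * exp (p * x (Suc m))) + ennreal (e / 2 * exp (p * x (Suc m)))"
      by (intro add_mono gpint spec[OF f(2)])
    also have "\<dots> = ennreal (e * exp (p * x (Suc m)))"
      using e by (subst ennreal_add_mult) auto
    finally show ?thesis using Suc by simp
  qed
  then show "\<exists>G. test_jet p x G \<and> (\<forall>n. pint p (\<lambda>t. G n t -
      (case n of 0 \<Rightarrow> (\<lambda>t. 0) | Suc m \<Rightarrow> H m) t) \<le> ennreal (e * exp (p * x n)))"
    using test by blast
qed

section \<open>Density in L^p\<close>


lemma pint_dominated:
  assumes "0 < p" and [measurable]: "\<And>i. s i \<in> borel_measurable borel" "f \<in> borel_measurable borel"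
      "w \<in> borel_measurable borel"
    and lim: "\<And>t. (\<lambda>i. s i t) \<longlonglongrightarrow> f t" and dom: "\<And>i t. cmod (s i t - f t) powr p \<le> w t"
    and fin: "(\<integral>\<^sup>+t. ennreal (w t) \<partial>lborel) < \<infinity>"
  shows "(\<lambda>i. pint p (\<lambda>t. s i t - f t)) \<longlonglongrightarrow> 0"
proof -
  have "(\<lambda>i. \<integral>\<^sup>+t. ennreal (cmod (s i t - f t) powr p) \<partial>lborel) \<longlonglongrightarrow> (\<integral>\<^sup>+t. 0 \<partial>(lborel :: real measure))"
  proof (rule nn_integral_dominated_convergence[where w = "\<lambda>t. ennreal (w t)"])
    show "AE t in lborel. ennreal (cmod (s i t - f t) powr p) \<le> ennreal (w t)" for i
      using dom by (auto intro: ennreal_leI)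
    have "(\<lambda>i. ennreal (cmod (s i t - f t) powr p)) \<longlonglongrightarrow> 0" for t
    proof -
      have "(\<lambda>i. cmod (s i t - f t)) \<longlonglongrightarrow> 0"
        using lim[of t] by (intro tendsto_norm_zero) (simp add: LIM_zero)
      then have "(\<lambda>i. cmod (s i t - f t) powr p) \<longlonglongrightarrow> 0"
        using \<open>0 < p\<close> by (intro tendsto_zero_powrI[OF _ tendsto_const]) auto
      then have "(\<lambda>i. ennreal (cmod (s i t - f t) powr p)) \<longlonglongrightarrow> ennreal 0"
        by (rule tendsto_ennrealI)
      then show ?thesis by simp
    qed
    then show "AE t in lborel. (\<lambda>i. ennreal (cmod (s i t - f t) powr p)) \<longlonglongrightarrow> 0" by simp
  qed (use fin in auto)
  then show ?thesis by (simp add: pint_def)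
qed

lemma approximable_single_add:
  assumes "0 < p" "p < 1" "approximable p x (single k f)" "approximable p x (single k g)"
  shows "approximable p x (single k (\<lambda>t. f t + g t))"
proof -
  have "single k (\<lambda>t. f t + g t) = (\<lambda>n t. single k f n t + single k g n t)"
    by (auto simp: single_def fun_eq_iff)
  then show ?thesis using approximable_add[OF assms] by simp
qed

lemma approximable_single_cmult:
  assumes "0 < p" "p < 1" "approximable p x (single k f)"
  shows "approximable p x (single k (\<lambda>t. c * f t))"
proof -
  have "single k (\<lambda>t. c * f t) = (\<lambda>n t. c * single k f n t)"
    by (auto simp: single_def fun_eq_iff)
  then show ?thesis using approximable_cmult[OF assms] by simp
qed

lemma approximable_single_0: "approximable p x (single k (\<lambda>t. 0))"
proof -
  have "single k (\<lambda>t. 0) = (\<lambda>n t. 0)" by (auto simp: single_def)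
  then show ?thesis using approximable_0 by simp
qed

lemma approximable_single_limit:
  assumes p: "0 < p" "p < 1" and s: "\<And>i. approximable p x (single k (s i))"
    and f: "f \<in> borel_measurable borel" and lim: "(\<lambda>i. pint p (\<lambda>t. s i t - f t)) \<longlonglongrightarrow> 0"
  shows "approximable p x (single k f)"
proof (rule approximable_limit[OF p])
  show "single k f n \<in> borel_measurable borel" for n using f by (simp add: single_def)
  fix e :: real assume "0 < e"
  then have "0 < ennreal (e * exp (p * x k))" by simp
  then have "\<forall>\<^sub>F i in sequentially. pint p (\<lambda>t. s i t - f t) < ennreal (e * exp (p * x k))"
    using lim by (rule order_tendstoD(2)[rotated])
  then obtain i where "pint p (\<lambda>t. s i t - f t) < ennreal (e * exp (p * x k))"
    by (auto dest: eventually_happens)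
  then have "\<forall>n. pint p (\<lambda>t. single k (s i) n t - single k f n t) \<le> ennreal (e * exp (p * x n))"
    by (auto simp: single_def)
  then show "\<exists>F. approximable p x F \<and> (\<forall>n. pint p (\<lambda>t. F n t - single k f n t) \<le> ennreal (e * exp (p * x n)))"
    using s by blast
qed

text \<open>Half-open intervals form an intersection-stable generator; complements come from
  linearity and disjoint unions from the limit lemma. Intersecting with a fixed bounded interval
  provides the integrable majorant for that limit.\<close>

lemma approximable_borel_set:
  assumes adm: "admissible p x" and p: "0 < p" "p < 1" and A: "A \<in> sets (borel :: real measure)"
    and ab: "a \<le> b"
  shows "approximable p x (single 0 (indicator ({a..<b} \<inter> A)))"
proof -
  let ?G = "range (\<lambda>(u, v). {u..<v::real})"
  have stable: "Int_stable ?G"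
  proof (rule Int_stableI)
    fix X Y assume "X \<in> ?G" "Y \<in> ?G"
    then obtain u v u' v' where "X = {u..<v}" "Y = {u'..<v'}" by auto
    then have "X \<inter> Y = {max u u'..<min v v'}" by auto
    then show "X \<inter> Y \<in> ?G" by auto
  qed
  have int: "approximable p x (single 0 (indicator {u..<v}))" for u v
  proof (cases "u \<le> v")
    case False
    then have "(indicator {u..<v} :: real \<Rightarrow> complex) = (\<lambda>t. 0)" by (auto simp: fun_eq_iff)
    then show ?thesis using approximable_single_0 by simp
  qed (rule approximable_indicator[OF adm p])
  have A_sigma: "A \<in> sigma_sets UNIV ?G" using A by (simp add: borel_eq_atLeastLessThan)
  note stable
  moreover have "?G \<subseteq> Pow UNIV" by auto
  moreover note A_sigma
  ultimately show ?thesis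
  proof (induction rule: sigma_sets_induct_disjoint)
    case (basic X)
    then obtain u v where "X = {u..<v}" by auto
    then have "{a..<b} \<inter> X = {max a u..<min b v}" by auto
    then show ?case using int by simp
  next
    case empty
    have "(indicator ({a..<b} \<inter> {}) :: real \<Rightarrow> complex) = (\<lambda>t. 0)" by (auto simp: fun_eq_iff)
    then show ?case using approximable_single_0 by simp
  next
    case (compl X)
    have "(indicator ({a..<b} \<inter> (UNIV - X)) :: real \<Rightarrow> complex) =
        (\<lambda>t. indicator {a..<b} t + (- 1) * indicator ({a..<b} \<inter> X) t)"
      by (auto simp: fun_eq_iff indicator_def)
    moreover have "approximable p x (single 0 (\<lambda>t. indicator {a..<b} t + (- 1) * indicator ({a..<b} \<inter> X) t))"
      by (rule approximable_single_add[OF p int approximable_single_cmult[OF p compl.IH]])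
    ultimately show ?case by (rule ssubst[where P = "\<lambda>g. approximable p x (single 0 g)"])
  next
    case (union X)
    have disj: "disjoint_family X" and "range X \<subseteq> sigma_sets UNIV ?G" by fact+
    then have "X i \<in> sigma_sets UNIV ?G" for i by (simp only: image_subset_iff UNIV_I)
    then have XG: "X i \<in> sets borel" for i
      by (simp add: borel_eq_atLeastLessThan)
    define s where "s = (\<lambda>n t. \<Sum>i<n. indicator ({a..<b} \<inter> X i) t :: complex)"
    have s: "approximable p x (single 0 (s n))" for n
    proof (induction n)
      case 0 then show ?case using approximable_single_0 by (simp add: s_def)
    next
      case (Suc n)
      then show ?case using approximable_single_add[OF p Suc union.IH[of n]] by (simp add: s_def)
    qed
    have s_eq: "s n = indicator ({a..<b} \<inter> (\<Union>i<n. X i))" for n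
    proof
      fix t show "s n t = indicator ({a..<b} \<inter> (\<Union>i<n. X i)) t"
      proof (induction n)
        case (Suc n)
        have "t \<notin> X i" if "t \<in> X n" "i < n" for i
          using disjoint_family_onD[OF disj, of i n] that by auto
        then have "indicator ({a..<b} \<inter> (\<Union>i<Suc n. X i)) t =
            (indicator ({a..<b} \<inter> (\<Union>i<n. X i)) t + indicator ({a..<b} \<inter> X n) t :: complex)"
          by (auto simp: indicator_def lessThan_Suc)
        moreover have "s (Suc n) t = s n t + indicator ({a..<b} \<inter> X n) t" by (simp add: s_def)
        ultimately show ?case using Suc by (simp only:)
      qed (simp add: s_def)
    qed
    show ?case
    proof (rule approximable_single_limit[OF p s])
      show "indicator ({a..<b} \<inter> (\<Union>i. X i)) \<in> borel_measurable borel"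
        using XG by (intro borel_measurable_indicator) auto
      show "(\<lambda>i. pint p (\<lambda>t. s i t - indicator ({a..<b} \<inter> (\<Union>i. X i)) t)) \<longlonglongrightarrow> 0"
      proof (rule pint_dominated[OF p(1), where w = "indicator {a..<b}"])
        show "s i \<in> borel_measurable borel" for i
          unfolding s_eq using XG by (intro borel_measurable_indicator) auto
        show "indicator ({a..<b} \<inter> (\<Union>i. X i)) \<in> borel_measurable borel"
          using XG by (intro borel_measurable_indicator) auto
        show "(indicator {a..<b} :: real \<Rightarrow> real) \<in> borel_measurable borel" by simp
        fix t
        show "(\<lambda>i. s i t) \<longlonglongrightarrow> indicator ({a..<b} \<inter> (\<Union>i. X i)) t"
        proof (cases "t \<in> (\<Union>i. X i)")
          case True
          then obtain i where i: "t \<in> X i" by auto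
          have "\<forall>\<^sub>F n in sequentially. s n t = indicator ({a..<b} \<inter> (\<Union>i. X i)) t"
            using eventually_gt_at_top[of i]
            by eventually_elim (use i in \<open>auto simp: s_eq indicator_def\<close>)
          then show ?thesis by (rule tendsto_eventually)
        next
          case False
          then have "s n t = 0" for n by (auto simp: s_eq indicator_def)
          then show ?thesis using False by simp
        qed
        show "cmod (s i t - indicator ({a..<b} \<inter> (\<Union>i. X i)) t) powr p \<le> indicator {a..<b} t" for i
          by (auto simp: s_eq indicator_def)
      next
        show "(\<integral>\<^sup>+t. ennreal (indicator {a..<b} t) \<partial>lborel) < \<infinity>"
          using ab by (simp add: ennreal_indicator)
      qed
    qed
  qed
qed

lemma powr_le_1_plus: "0 < p \<Longrightarrow> p < 1 \<Longrightarrow> 0 \<le> (y::real) \<Longrightarrow> y powr p \<le> 1 + y"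
proof (cases "y \<le> 1")
  case True
  moreover assume "0 < p" "0 \<le> y"
  ultimately have "y powr p \<le> 1 powr p" by (intro powr_mono2) auto
  then show ?thesis using \<open>0 \<le> y\<close> by simp
next
  case False
  moreover assume "p < 1"
  ultimately have "y powr p \<le> y powr 1" by (intro powr_mono) auto
  then show ?thesis using False by simp
qed

text \<open>On a bounded interval integrability implies p-integrability, because y^p <= 1 + y. The
  cut-off thus makes the standard induction over integrable functions usable for p < 1.\<close>

lemma approximable_integrable:
  assumes adm: "admissible p x" and p: "0 < p" "p < 1" and ab: "a \<le> b"
    and f: "integrable lborel f"
  shows "approximable p x (single 0 (\<lambda>t. indicator {a..<b} t * f t))"
  using f
proof (induction rule: integrable_induct)
  case (base A c)
  have "(\<lambda>t. indicator {a..<b} t * (indicator A t *\<^sub>R c)) = (\<lambda>t. c * indicator ({a..<b} \<inter> A) t)"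
    by (auto simp: fun_eq_iff indicator_def)
  then show ?case
    using approximable_single_cmult[OF p approximable_borel_set[OF adm p _ ab], of A c] base(1) by simp
next
  case (add f g)
  then show ?case using approximable_single_add[OF p add.IH] by (simp add: distrib_left)
next
  case (lim f s)
  have [measurable]: "f \<in> borel_measurable borel" "s i \<in> borel_measurable borel" for i
    using borel_measurable_integrable[OF lim.hyps(4)] borel_measurable_integrable[OF lim.hyps(1)] by simp_all
  show ?case
  proof (rule approximable_single_limit[OF p lim.IH])
    show "(\<lambda>t. indicator {a..<b} t * f t) \<in> borel_measurable borel" by measurable
    \<comment> \<open>The approximants in this induction satisfy |s i| <= 2 |f|, whence the factor
      3.\<close>
    define w where "w = (\<lambda>t. indicator {a..<b} t + 3 * cmod (f t))"
    show "(\<lambda>i. pint p (\<lambda>t. indicator {a..<b} t * s i t - indicator {a..<b} t * f t)) \<longlonglongrightarrow> 0"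
    proof (rule pint_dominated[OF p(1), where w = w])
      show "(\<lambda>i. indicator {a..<b} t * s i t) \<longlonglongrightarrow> indicator {a..<b} t * f t" for t
        using lim.hyps(2)[of t] by (intro tendsto_mult_left) auto
      show "cmod (indicator {a..<b} t * s i t - indicator {a..<b} t * f t) powr p \<le> w t" for i t
      proof (cases "t \<in> {a..<b}")
        case True
        have "cmod (s i t - f t) \<le> 3 * cmod (f t)"
          using norm_triangle_ineq4[of "s i t" "f t"] lim.hyps(3)[of t i] by auto
        then have "cmod (s i t - f t) powr p \<le> 1 + 3 * cmod (f t)"
          using powr_le_1_plus[OF p, of "cmod (s i t - f t)"] by simp
        then show ?thesis using True by (simp add: w_def)
      qed (simp add: w_def)
      have "integrable lborel w"
        unfolding w_def using ab lim.hyps(4) by (intro Bochner_Integration.integrable_add integrable_mult_right integrable_norm) auto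
      then show "(\<integral>\<^sup>+t. ennreal (w t) \<partial>lborel) < \<infinity>"
        by (simp add: integrable_iff_bounded w_def)
    qed (simp_all add: w_def)
  qed
qed

text \<open>A function in L^p need not be locally integrable. Truncating argument and value at
  \<open>N\<close> makes it so, and |g|^p dominates the error.\<close>

lemma approximable_Lp:
  assumes adm: "admissible p x" and p: "0 < p" "p < 1"
    and [measurable]: "g \<in> borel_measurable borel" and fin: "pint p g < \<infinity>"
  shows "approximable p x (single 0 g)"
proof -
  define s where "s = (\<lambda>N t. indicator {- real N..<real N} t * (if cmod (g t) \<le> real N then g t else 0))"
  show ?thesis
  proof (rule approximable_single_limit[OF p])
    show "approximable p x (single 0 (s N))" for N
    proof -
      have "integrable lborel (\<lambda>t. indicator {- real N..<real N} t *\<^sub>R (if cmod (g t) \<le> real N then g t else 0))"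
        by (rule integrableI_bounded_set_indicator[where B = "real N"]) auto
      moreover have "(\<lambda>t. indicator {- real N..<real N} t *\<^sub>R (if cmod (g t) \<le> real N then g t else 0)) = s N"
        by (auto simp: s_def fun_eq_iff indicator_def)
      ultimately have "integrable lborel (s N)" by (simp only:)
      from approximable_integrable[OF adm p _ this, of "- real N" "real N"]
      have "approximable p x (single 0 (\<lambda>t. indicator {- real N..<real N} t * s N t))"
        by simp
      moreover have "(\<lambda>t. indicator {- real N..<real N} t * s N t) = s N"
        by (auto simp: s_def fun_eq_iff indicator_def)
      ultimately show ?thesis by simp
    qed
    show "(\<lambda>i. pint p (\<lambda>t. s i t - g t)) \<longlonglongrightarrow> 0"
    proof (rule pint_dominated[OF p(1), where w = "\<lambda>t. cmod (g t) powr p"])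
      show "s i \<in> borel_measurable borel" for i unfolding s_def by measurable
      show "(\<lambda>i. s i t) \<longlonglongrightarrow> g t" for t
      proof (rule tendsto_eventually)
        obtain n :: nat where "max (\<bar>t\<bar> + 1) (cmod (g t)) \<le> real n" using real_arch_simple by blast
        then have "s i t = g t" if "i \<ge> n" for i
          using that by (auto simp: s_def indicator_def)
        then show "\<forall>\<^sub>F i in sequentially. s i t = g t" by (auto simp: eventually_sequentially)
      qed
      show "cmod (s i t - g t) powr p \<le> cmod (g t) powr p" for i t
        by (auto simp: s_def indicator_def)
      show "(\<integral>\<^sup>+t. ennreal (cmod (g t) powr p) \<partial>lborel) < \<infinity>" using fin by (simp add: pint_def)
    qed auto
  qed simp
qed

text \<open>The weights \<open>x\<close> vary in the induction, since
  \<open>approximable_lift\<close> consumes an approximation for the shifted weights.\<close>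

lemma approximable_single:
  assumes adm: "admissible p x" and p: "0 < p" "p < 1"
    and g: "g \<in> borel_measurable borel" "pint p g < \<infinity>"
  shows "approximable p x (single k g)"
  using adm
proof (induction k arbitrary: x)
  case 0
  then show ?case by (rule approximable_Lp[OF _ p g])
next
  case (Suc k)
  have "single (Suc k) g = (\<lambda>n. case n of 0 \<Rightarrow> (\<lambda>t. 0) | Suc m \<Rightarrow> single k g m)"
    by (auto simp: single_def fun_eq_iff split: nat.split)
  then show ?case
    using approximable_lift[OF Suc.prems p Suc.IH[OF admissible_shift[OF Suc.prems p(2)]]] by simp
qed

lemma approximable_finite:
  assumes adm: "admissible p x" and p: "0 < p" "p < 1"
    and g: "\<And>n. g n \<in> borel_measurable borel" "\<And>n. pint p (g n) < \<infinity>"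
  shows "approximable p x (\<lambda>n t. if n < N then g n t else 0)"
proof -
  have "(\<lambda>n t. if n < N then g n t else 0) = (\<lambda>n t. \<Sum>k<N. single k (g k) n t)"
  proof (intro ext)
    fix n t
    have "(\<Sum>k<N. single k (g k) n t) = (\<Sum>k<N. if k = n then g k t else 0)"
      by (intro sum.cong) (auto simp: single_def)
    then show "(if n < N then g n t else 0) = (\<Sum>k<N. single k (g k) n t)" by simp
  qed
  then show ?thesis
    using approximable_sum[OF p, of "{..<N}" x "\<lambda>k. single k (g k)"] approximable_single[OF adm p g] by simp
qed

section \<open>Regular weights\<close>


lemma p_characteristic_frequently:
  assumes "p_characteristic p M = \<infinity>"
  shows "\<exists>\<^sub>F n in sequentially. B \<le> (\<Sum>j=1..n. (1 - p) ^ j * ln (M j))"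
proof (rule ccontr)
  assume "\<not> ?thesis"
  then have "\<forall>\<^sub>F n in sequentially. \<not> B \<le> (\<Sum>j=1..n. (1 - p) ^ j * ln (M j))"
    by (simp add: not_frequently)
  then have "\<forall>\<^sub>F n in sequentially. ereal (\<Sum>j=1..n. (1 - p) ^ j * ln (M j)) \<le> ereal B"
    by (rule eventually_mono) simp
  then have "p_characteristic p M \<le> ereal B"
    unfolding p_characteristic_def by (rule Limsup_bounded)
  then show False using assms by simp
qed

lemma summable_exp_increments:
  fixes z :: "nat \<Rightarrow> real"
  assumes "\<forall>\<^sub>F n in sequentially. s * ln (real n) - K \<le> z n" "1 < s"
  shows "summable (\<lambda>n. exp (- z n))"
proof (rule summable_comparison_test_ev)
  show "\<forall>\<^sub>F n in sequentially. norm (exp (- z n)) \<le> exp K * real n powr - s"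
    using assms(1) eventually_gt_at_top[of 0]
  proof eventually_elim
    case (elim n)
    then have "exp (- z n) \<le> exp (K - s * ln (real n))" by simp
    also have "\<dots> = exp K * real n powr - s" using elim(2) by (simp add: exp_diff powr_def exp_minus field_simps)
    finally show ?case by simp
  qed
  show "summable (\<lambda>n. exp K * real n powr - s)"
    using assms(2) by (intro summable_mult) (simp add: summable_real_powr_iff)
qed

text \<open>Multiplied by (1 - p)^n these weights become c / (n + K), which tends to 0 although its
  sum diverges like the harmonic series. They are thus slow enough for the growth condition and
  still have infinite characteristic.\<close>

lemma admissible_slow:
  assumes p: "0 < p" "p < 1" and "0 < c"
  obtains K where "1 \<le> K" "admissible p (\<lambda>n. c * inverse (1 - p) ^ n / (real n + K))"
proof -
  define q where "q = inverse (1 - p)"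
  have q: "1 < q" "0 < q" using p by (auto simp: q_def one_less_inverse)
  have pq: "(1 - p) ^ n * q ^ n = 1" for n
    using p by (simp add: q_def power_mult_distrib[symmetric])
  \<comment> \<open>From here on (q - 1) t >= q + 1 for t >= K. This fixes the sign of the second
    differences and bounds the increments from below.\<close>
  define K where "K = max 1 ((q + 1) / (q - 1))"
  have K: "1 \<le> K" by (simp add: K_def)
  have Kq: "q + 1 \<le> (q - 1) * t" if "K \<le> t" for t
  proof -
    have "(q + 1) / (q - 1) \<le> t" using that by (simp add: K_def)
    then show ?thesis using q by (simp add: pos_divide_le_eq mult.commute)
  qed
  define z where "z = (\<lambda>n. c * q ^ n / (real n + K))"
  have "admissible p z"
    unfolding admissible_def
  proof (intro conjI allI impI)
    fix n
    define t where "t = real n + K + 1"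
    have t: "1 < t" "K \<le> t" using K by (auto simp: t_def)
    have "0 \<le> (q - 1) * t * ((q - 1) * t - (q + 1)) + 2 * q"
      using Kq[OF t(2)] q t by (intro add_nonneg_nonneg mult_nonneg_nonneg) auto
    also have "\<dots> = q\<^sup>2 * t * (t - 1) - 2 * q * (t + 1) * (t - 1) + t * (t + 1)"
      by (simp add: algebra_simps power2_eq_square)
    finally have "0 \<le> (q\<^sup>2 * t * (t - 1) - 2 * q * (t + 1) * (t - 1) + t * (t + 1)) / ((t + 1) * t * (t - 1))"
      using t by (intro divide_nonneg_nonneg) auto
    also have "\<dots> = q\<^sup>2 / (t + 1) - 2 * q / t + 1 / (t - 1)"
    proof -
      have "q\<^sup>2 * t * (t - 1) / ((t + 1) * t * (t - 1)) = q\<^sup>2 / (t + 1)"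
        "2 * q * (t + 1) * (t - 1) / ((t + 1) * t * (t - 1)) = 2 * q / t"
        "t * (t + 1) / ((t + 1) * t * (t - 1)) = 1 / (t - 1)"
        using t by (simp_all add: frac_eq_eq)
      then show ?thesis by (simp only: add_divide_distrib diff_divide_distrib)
    qed
    finally have "0 \<le> c * q ^ n * (q\<^sup>2 / (t + 1) - 2 * q / t + 1 / (t - 1))"
      using assms q by simp
    also have "\<dots> = z (Suc (Suc n)) - 2 * z (Suc n) + z n"
      by (simp add: z_def t_def algebra_simps power2_eq_square)
    finally show "z (Suc n) - z n \<le> z (Suc (Suc n)) - z (Suc n)" by simp
  next
    fix B
    have pz: "(1 - p) ^ n * z n = c / (real n + K)" for n
      using pq[of n] by (simp add: z_def mult.left_commute)
    have "c * (ln (real n + 1 + K) - ln (1 + K)) \<le> (\<Sum>j=1..n. (1 - p) ^ j * z j)" for n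
    proof (induction n)
      case (Suc n)
      have "ln (1 + 1 / (real (Suc n) + K)) \<le> 1 / (real (Suc n) + K)"
        using K by (intro ln_add_one_self_le_self) auto
      moreover have "1 + 1 / (real (Suc n) + K) = (real (Suc n) + 1 + K) / (real n + 1 + K)"
        using K by (simp add: field_simps)
      ultimately have "ln (real (Suc n) + 1 + K) - ln (real n + 1 + K) \<le> 1 / (real (Suc n) + K)"
        using K by (simp add: ln_div)
      then have "c * (ln (real (Suc n) + 1 + K) - ln (real n + 1 + K)) \<le> c * (1 / (real (Suc n) + K))"
        using assms by (intro mult_left_mono) auto
      then have "c * (ln (real (Suc n) + 1 + K) - ln (real n + 1 + K)) \<le> (1 - p) ^ Suc n * z (Suc n)"
        unfolding pz by simp
      then show ?case using Suc by (simp add: right_diff_distrib)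
    qed simp
    moreover have "\<forall>\<^sub>F n in sequentially. B \<le> c * (ln (real n + 1 + K) - ln (1 + K))"
    proof -
      have "filterlim (\<lambda>n. c * (ln (real n + 1 + K) - ln (1 + K))) at_top sequentially"
        using assms K by real_asymp
      then show ?thesis by (simp add: filterlim_at_top)
    qed
    ultimately have "\<forall>\<^sub>F n in sequentially. B \<le> (\<Sum>j=1..n. (1 - p) ^ j * z j)"
      by (auto elim!: eventually_mono intro: order_trans)
    then show "\<exists>\<^sub>F n in sequentially. B \<le> (\<Sum>j=1..n. (1 - p) ^ j * z j)"
      by (intro eventually_frequently) auto
  next
    fix e :: real assume "0 < e"
    have "(\<lambda>n. c / (real n + K)) \<longlonglongrightarrow> 0" by real_asymp
    then have "\<forall>\<^sub>F n in sequentially. c / (real n + K) < e"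
      using \<open>0 < e\<close> by (rule order_tendstoD)
    then show "\<forall>\<^sub>F n in sequentially. (1 - p) ^ n * z n \<le> e"
      by (rule eventually_mono) (use pq in \<open>simp add: z_def mult.left_commute\<close>)
  next
    \<comment> \<open>The constant 4 leaves the exponent 2 after multiplication by
      \<open>1 - \<eta>\<close>, which is 1/2 here, so the exponentials are dominated by
      n^-2.\<close>
    have ev: "\<forall>\<^sub>F n in sequentially. 4 * ln (real n) \<le> c * q ^ n / ((real n + K) * (real n + K + 1))"
    proof -
      have "(\<lambda>n. 4 * ln (real n) * ((real n + K) * (real n + K + 1)) * (1 - p) ^ n) \<longlonglongrightarrow> 0"
        using p by real_asymp
      then have "\<forall>\<^sub>F n in sequentially. 4 * ln (real n) * ((real n + K) * (real n + K + 1)) * (1 - p) ^ n < c"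
        using assms(3) by (rule order_tendstoD)
      then show ?thesis
      proof eventually_elim
        case (elim n)
        have "4 * ln (real n) * ((real n + K) * (real n + K + 1)) =
            4 * ln (real n) * ((real n + K) * (real n + K + 1)) * ((1 - p) ^ n * q ^ n)"
          by (simp only: pq mult_1_right)
        also have "\<dots> = 4 * ln (real n) * ((real n + K) * (real n + K + 1)) * (1 - p) ^ n * q ^ n"
          by (simp only: mult.assoc)
        also have "\<dots> \<le> c * q ^ n" using elim q by (intro mult_right_mono) auto
        finally show ?case using K by (subst pos_le_divide_eq) auto
      qed
    qed
    have ge: "c * q ^ n / ((real n + K) * (real n + K + 1)) \<le> z (Suc n) - z n" for n
    proof -
      define t where "t = real n + K"
      have t: "1 \<le> t" "K \<le> t" using K by (auto simp: t_def)
      have "1 \<le> q * t - (t + 1)" using Kq[OF t(2)] q by (simp add: algebra_simps)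
      then have "1 / (t * (t + 1)) \<le> (q * t - (t + 1)) / (t * (t + 1))"
        using t by (intro divide_right_mono) auto
      also have "\<dots> = q / (t + 1) - 1 / t" using t by (simp add: diff_divide_distrib)
      finally have "c * q ^ n * (1 / (t * (t + 1))) \<le> c * q ^ n * (q / (t + 1) - 1 / t)"
        using assms q by (intro mult_left_mono) auto
      then show ?thesis by (simp add: z_def t_def algebra_simps)
    qed
    have "\<forall>\<^sub>F n in sequentially. 2 * ln (real n) - 0 \<le> (1 - 1 / 2) * (z (Suc n) - z n)"
      using ev
    proof eventually_elim
      case (elim n)
      have "4 * ln (real n) \<le> z (Suc n) - z n" by (rule order_trans[OF elim ge])
      then show ?case by simp
    qed
    from summable_exp_increments[OF this]
    show "\<exists>\<eta>>0. \<eta> < 1 \<and> summable (\<lambda>n. exp (- (1 - \<eta>) * (z (Suc n) - z n)))"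
      by (intro exI[of _ "1 / 2"]) simp
  qed
  then show ?thesis using that K unfolding z_def q_def by blast
qed

lemma log_convex_increments:
  assumes "log_convex M"
  shows "ln (M (Suc n)) - ln (M n) \<le> ln (M (Suc (Suc n))) - ln (M (Suc n))"
proof -
  have "(real (Suc (Suc n)) - real n) * ln (M (Suc n)) \<le>
      (real (Suc (Suc n)) - real (Suc n)) * ln (M n) + (real (Suc n) - real n) * ln (M (Suc (Suc n)))"
    using assms unfolding log_convex_def by (metis lessI)
  then show ?thesis by simp
qed

text \<open>The point is summability. With n ln n <= d ln M_n for some d < 1, convexity bounds the
  n-th increment below by the mean slope, hence by (ln n) / d minus a constant, and the exponentials
  are O(n^(-(1 - \<eta>)/d)).\<close>

lemma admissible_ln_weight:
  assumes p: "0 < p" "p < 1" and lc: "log_convex M" and kappa: "p_characteristic p M = \<infinity>"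
    and small: "(\<lambda>n. ln (M n)) \<in> o(\<lambda>n. inverse ((1 - p) ^ n))"
    and \<delta>: "\<delta> < 1" "\<epsilon> \<longlonglongrightarrow> 0"
      "\<forall>\<^sub>F n in sequentially. real n * ln (real n) \<le> (\<delta> + \<epsilon> n) * ln (M n)"
  shows "admissible p (\<lambda>n. ln (M n))"
  unfolding admissible_def
proof (intro conjI allI impI log_convex_increments[OF lc] p_characteristic_frequently[OF kappa])
  fix e :: real assume "0 < e"
  with small have "\<forall>\<^sub>F n in sequentially. norm (ln (M n)) \<le> e * norm (inverse ((1 - p) ^ n))"
    by (rule landau_o.smallD)
  then show "\<forall>\<^sub>F n in sequentially. (1 - p) ^ n * ln (M n) \<le> e"
  proof (rule eventually_mono)
    fix n assume "norm (ln (M n)) \<le> e * norm (inverse ((1 - p) ^ n))"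
    then have "ln (M n) \<le> e * inverse ((1 - p) ^ n)" using p by simp
    then have "(1 - p) ^ n * ln (M n) \<le> (1 - p) ^ n * (e * inverse ((1 - p) ^ n))"
      using p by (intro mult_left_mono) auto
    then show "(1 - p) ^ n * ln (M n) \<le> e" using p by (simp add: mult.left_commute)
  qed
next
  define x where "x = (\<lambda>n. ln (M n))"
  define \<mu> where "\<mu> = (\<lambda>n. x (Suc n) - x n)"
  have "incseq \<mu>"
    unfolding \<mu>_def x_def by (intro incseq_SucI log_convex_increments[OF lc])
  then have mono: "\<mu> i \<le> \<mu> j" if "i \<le> j" for i j using that by (simp add: incseqD)
  have sum: "x n - x m = (\<Sum>i=m..<n. \<mu> i)" if "m \<le> n" for m n
    unfolding \<mu>_def using sum_Suc_diff'[OF that, of x] by simp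
  \<comment> \<open>Without a positive increment the log weights would be bounded above and the
    characteristic finite. A positive one makes \<open>x\<close> eventually positive, so that
    \<open>\<delta> + \<epsilon> n\<close> may be replaced by the larger \<open>d\<close>.\<close>
  have "\<exists>m. 0 < \<mu> m"
  proof (rule ccontr)
    assume "\<not> ?thesis"
    then have le: "x n \<le> \<bar>x 0\<bar>" for n
      using sum[of 0 n] sum_nonpos[of "{0..<n}" \<mu>] by (force simp: not_less)
    have s: "summable (\<lambda>j. (1 - p) ^ j * \<bar>x 0\<bar>)"
      using p by (intro summable_mult2 summable_geometric) auto
    have bnd: "(\<Sum>j=1..n. (1 - p) ^ j * x j) \<le> (\<Sum>j. (1 - p) ^ j * \<bar>x 0\<bar>)" for n
    proof -
      have "(\<Sum>j=1..n. (1 - p) ^ j * x j) \<le> (\<Sum>j=1..n. (1 - p) ^ j * \<bar>x 0\<bar>)"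
        using p le by (intro sum_mono mult_left_mono) auto
      also have "\<dots> \<le> (\<Sum>j. (1 - p) ^ j * \<bar>x 0\<bar>)"
        using p by (intro sum_le_suminf s) auto
      finally show ?thesis .
    qed
    have "\<exists>n. (\<Sum>j. (1 - p) ^ j * \<bar>x 0\<bar>) + 1 \<le> (\<Sum>j=1..n. (1 - p) ^ j * x j)"
      unfolding x_def by (rule frequently_ex[OF p_characteristic_frequently[OF kappa]])
    then obtain n where "(\<Sum>j. (1 - p) ^ j * \<bar>x 0\<bar>) + 1 \<le> (\<Sum>j=1..n. (1 - p) ^ j * x j)" ..
    then show False using bnd[of n] by linarith
  qed
  then obtain m where m: "0 < \<mu> m" by blast
  have xpos: "\<forall>\<^sub>F n in sequentially. 0 < x n"
  proof -
    have ge: "x m + real (n - m) * \<mu> m \<le> x n" if "m \<le> n" for n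
      using sum[OF that] sum_bounded_below[of "{m..<n}" "\<mu> m" \<mu>] mono by (simp add: algebra_simps)
    obtain N :: nat where N: "- x m / \<mu> m < real N" using reals_Archimedean2 by blast
    have "0 < x n" if "n \<ge> m + N" for n
    proof -
      have "- x m < real N * \<mu> m" by (rule pos_divide_less_eq[OF m, THEN iffD1, OF N])
      also have "\<dots> \<le> real (n - m) * \<mu> m" using that m by (intro mult_right_mono) auto
      finally show ?thesis using ge[of n] that by linarith
    qed
    then show ?thesis unfolding eventually_sequentially by blast
  qed
  \<comment> \<open>A number strictly between \<open>\<delta>\<close> and 1 that is also positive,
    as \<open>\<delta>\<close> may be negative and \<open>d\<close> is divided by.\<close>
  define d where "d = (1 + max \<delta> 0) / 2"
  have d: "0 < d" "d < 1" "\<delta> < d" using \<delta>(1) by (auto simp: d_def)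
  have "\<forall>\<^sub>F n in sequentially. \<epsilon> n < d - \<delta>"
    using \<delta>(2) d(3) by (intro order_tendstoD) auto
  then have mu_ge: "\<forall>\<^sub>F n in sequentially. 1 / d * ln (real n) - \<bar>x 0\<bar> \<le> \<mu> n"
    using \<delta>(3) xpos eventually_gt_at_top[of 0]
  proof eventually_elim
    case (elim n)
    have "real n * ln (real n) \<le> (\<delta> + \<epsilon> n) * x n" using elim(2) by (simp add: x_def)
    also have "\<dots> \<le> d * x n" using elim(1,3) by (intro mult_right_mono) auto
    finally have "1 / d * ln (real n) \<le> x n / real n"
      using d elim(4) by (simp add: field_simps)
    moreover have "x n - x 0 \<le> real n * \<mu> n"
      using sum[of 0 n] sum_bounded_above[of "{0..<n}" \<mu> "\<mu> n"] mono by (simp add: mult.commute)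
    then have "x n / real n \<le> \<mu> n + x 0 / real n" using elim(4) by (simp add: field_simps)
    moreover have "x 0 / real n \<le> \<bar>x 0\<bar>"
    proof -
      have "x 0 / real n \<le> \<bar>x 0\<bar> / real n" by (intro divide_right_mono) auto
      also have "\<dots> \<le> \<bar>x 0\<bar> / 1" using elim(4) by (intro divide_left_mono) auto
      finally show ?thesis by simp
    qed
    ultimately show ?case by linarith
  qed
  \<comment> \<open>Then (1 - \<eta>)/d = (1 + d)/(2 d), which exceeds 1.\<close>
  define \<eta> where "\<eta> = (1 - d) / 2"
  have \<eta>: "0 < \<eta>" "\<eta> < 1" "1 < (1 - \<eta>) / d" using d by (auto simp: \<eta>_def field_simps)
  have "\<forall>\<^sub>F n in sequentially. (1 - \<eta>) / d * ln (real n) - (1 - \<eta>) * \<bar>x 0\<bar> \<le> (1 - \<eta>) * \<mu> n"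
    using mu_ge
  proof eventually_elim
    case (elim n)
    then have "(1 - \<eta>) * (1 / d * ln (real n) - \<bar>x 0\<bar>) \<le> (1 - \<eta>) * \<mu> n"
      using \<eta> by (intro mult_left_mono) auto
    then show ?case by (simp add: right_diff_distrib)
  qed
  from summable_exp_increments[OF this \<eta>(3)]
  have "summable (\<lambda>n. exp (- (1 - \<eta>) * \<mu> n))" by (simp only: mult_minus_left)
  then show "\<exists>\<eta>>0. \<eta> < 1 \<and> summable (\<lambda>n. exp (- (1 - \<eta>) * (ln (M (Suc n)) - ln (M n))))"
    using \<eta> unfolding \<mu>_def x_def by blast
qed

text \<open>In the first alternative of \<^const>\<open>p_regular\<close> the weights may grow too fast for the growth condition
  of the test class and are replaced by the smaller ones of \<open>admissible_slow\<close>.\<close>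

lemma admissible_minorant:
  assumes p: "0 < p" "p < 1" and pos: "\<And>n. 0 < M n" and reg: "p_regular p M"
  shows "\<exists>x. admissible p x \<and> (\<forall>n. x n \<le> ln (M n))"
proof -
  have lc: "log_convex M" and kappa: "p_characteristic p M = \<infinity>"
    using reg by (auto simp: p_regular_def)
  consider "0 < liminf (\<lambda>n. ereal ((1 - p) ^ n * ln (M n)))"
    | \<delta> \<epsilon> where "(\<lambda>n. ln (M n)) \<in> o(\<lambda>n. inverse ((1 - p) ^ n))" "\<delta> < 1" "\<epsilon> \<longlonglongrightarrow> 0"
      "\<forall>\<^sub>F n in sequentially. real n * ln (real n) \<le> (\<delta> + \<epsilon> n) * ln (M n)"
    using reg unfolding p_regular_def by blast
  then show ?thesis
  proof cases
    case 2
    then have "admissible p (\<lambda>n. ln (M n))" by (intro admissible_ln_weight[OF p lc kappa])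
    then show ?thesis by blast
  next
    case 1
    then obtain c where c: "0 < ereal c" "ereal c < liminf (\<lambda>n. ereal ((1 - p) ^ n * ln (M n)))"
      using ereal_dense2[OF 1] by (auto simp: ereal_less_ereal_Ex)
    then have "\<forall>\<^sub>F n in sequentially. ereal c < ereal ((1 - p) ^ n * ln (M n))"
      by (intro less_LiminfD)
    then obtain n0 where n0: "\<And>n. n \<ge> n0 \<Longrightarrow> c < (1 - p) ^ n * ln (M n)"
      by (auto simp: eventually_sequentially)
    have cpos: "0 < c" using c by simp
    obtain K where K: "1 \<le> K" "admissible p (\<lambda>n. c * inverse (1 - p) ^ n / (real n + K))"
      using admissible_slow[OF p cpos] by blast
    define z where "z = (\<lambda>n. c * inverse (1 - p) ^ n / (real n + K))"
    have z_le: "z n \<le> c * inverse (1 - p) ^ n" for n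
    proof -
      have "z n \<le> c * inverse (1 - p) ^ n / 1"
        unfolding z_def using K cpos p by (intro divide_left_mono) auto
      then show ?thesis by simp
    qed
    \<comment> \<open>The asymptotic bound says nothing below \<open>n0\<close>; lowering all
      weights by the constant \<open>D\<close> repairs these finitely many indices. The summand
      \<open>0 * real n\<close> below matches the form of \<open>admissible_affine\<close>.\<close>
    define D where "D = (\<Sum>n<n0. \<bar>z n - ln (M n)\<bar>)"
    have D: "0 \<le> D" by (simp add: D_def sum_nonneg)
    have "z n - 0 * real n - D \<le> ln (M n)" for n
    proof (cases "n < n0")
      case True
      then have "\<bar>z n - ln (M n)\<bar> \<le> D"
        unfolding D_def by (intro member_le_sum) auto
      then show ?thesis by simp
    next
      case False
      then have "c < (1 - p) ^ n * ln (M n)" using n0 by simp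
      then have "c * inverse (1 - p) ^ n \<le> ln (M n)"
        using p by (simp add: power_inverse field_simps)
      then show ?thesis using z_le[of n] D by simp
    qed
    moreover have "admissible p (\<lambda>n. z n - 0 * real n - D)"
      using admissible_affine[OF K(2) p] unfolding z_def by blast
    ultimately show ?thesis by blast
  qed
qed

section \<open>Completeness and equivalence classes\<close>


lemma pint_eq_0_imp_AE:
  assumes "pint p f = 0" and [measurable]: "f \<in> borel_measurable borel"
  shows "AE t in lborel. f t = 0"
proof -
  have "AE t in lborel. ennreal (cmod (f t) powr p) = 0"
    using assms(1) unfolding pint_def by (subst (asm) nn_integral_0_iff_AE) auto
  then show ?thesis by eventually_elim (simp add: ennreal_eq_0_iff)
qed

text \<open>The terms are eventually below 1, where |d| <= |d|^p.\<close>

lemma summable_norm_if_summable_powr: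
  fixes d :: "nat \<Rightarrow> complex"
  assumes "0 < p" "p < 1" "summable (\<lambda>i. cmod (d i) powr p)"
  shows "summable (\<lambda>i. cmod (d i))"
proof (rule summable_comparison_test_ev[OF _ assms(3)])
  have "(\<lambda>i. cmod (d i) powr p) \<longlonglongrightarrow> 0" by (rule summable_LIMSEQ_zero[OF assms(3)])
  then have "\<forall>\<^sub>F i in sequentially. cmod (d i) powr p < 1" by (rule order_tendstoD) simp
  then show "\<forall>\<^sub>F i in sequentially. norm (cmod (d i)) \<le> cmod (d i) powr p"
  proof eventually_elim
    case (elim i)
    have "cmod (d i) \<le> 1"
    proof (rule ccontr)
      assume "\<not> ?thesis"
      then have "1 powr p \<le> cmod (d i) powr p" using assms by (intro powr_mono2) auto
      then show False using elim by simp
    qed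
    show ?case
    proof (cases "d i = 0")
      case False
      have "cmod (d i) powr 1 \<le> cmod (d i) powr p"
        using \<open>cmod (d i) \<le> 1\<close> assms by (intro powr_mono') auto
      then show ?thesis using False by simp
    qed simp
  qed
qed

lemma convergent_if_summable_diff:
  fixes u :: "nat \<Rightarrow> complex"
  assumes "summable (\<lambda>i. u (Suc i) - u i)"
  shows "convergent u"
proof -
  have "convergent (\<lambda>n. \<Sum>i<n. u (Suc i) - u i)" using assms by (simp add: summable_iff_convergent)
  then have "convergent (\<lambda>n. (u n - u 0) + u 0)"
    by (intro convergent_add convergent_const) (simp add: sum_lessThan_telescope)
  then show ?thesis by simp
qed

text \<open>The conclusion keeps the modulus: each Cauchy bound valid from \<open>N\<close> on holds
  for the limit from the same \<open>N\<close> on. This makes the limits of infinitely many entries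
  uniform in \<open>cauchy_seq_limit\<close>.\<close>

lemma riesz_fischer:
  fixes u :: "nat \<Rightarrow> real \<Rightarrow> complex"
  assumes p: "0 < p" "p < 1" and [measurable]: "\<And>k. u k \<in> borel_measurable borel"
    and cauchy: "\<And>e. 0 < e \<Longrightarrow> \<exists>N. \<forall>j\<ge>N. \<forall>k\<ge>N. pint p (\<lambda>t. u j t - u k t) \<le> ennreal e"
  shows "\<exists>F. F \<in> borel_measurable borel \<and>
    (\<forall>N e k. (\<forall>j\<ge>N. \<forall>k\<ge>N. pint p (\<lambda>t. u j t - u k t) \<le> ennreal e) \<longrightarrow> N \<le> k \<longrightarrow>
       pint p (\<lambda>t. u k t - F t) \<le> ennreal e)"
proof -
  have "\<forall>i. \<exists>N. \<forall>j\<ge>N. \<forall>k\<ge>N. pint p (\<lambda>t. u j t - u k t) \<le> ennreal ((1 / 2) ^ i)"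
    by (rule allI, rule cauchy) simp
  then have "\<exists>N. \<forall>i. \<forall>j\<ge>N i. \<forall>k\<ge>N i. pint p (\<lambda>t. u j t - u k t) \<le> ennreal ((1 / 2) ^ i)"
    by (rule choice)
  then obtain N where N': "\<forall>i. \<forall>j\<ge>N i. \<forall>k\<ge>N i. pint p (\<lambda>t. u j t - u k t) \<le> ennreal ((1 / 2) ^ i)" ..
  have N: "pint p (\<lambda>t. u j t - u k t) \<le> ennreal ((1 / 2) ^ i)" if "N i \<le> j" "N i \<le> k" for i j k
    by (rule N'[rule_format, OF that])
  \<comment> \<open>The sum puts \<open>r i\<close> and \<open>r (Suc i)\<close> above
    \<open>N i\<close> even if \<open>N\<close> is not monotone; the summand \<open>i\<close> makes
    \<open>r\<close> unbounded.\<close>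
  define r where "r = (\<lambda>i. (\<Sum>l\<le>i. N l) + i)"
  have r: "N i \<le> r i" "N i \<le> r (Suc i)" "i \<le> r i" for i
  proof -
    have "N i \<le> sum N {..i}" by (intro member_le_sum) auto
    then show "N i \<le> r i" "N i \<le> r (Suc i)" "i \<le> r i" by (auto simp: r_def)
  qed
  define v where "v = (\<lambda>i. u (r i))"
  have [measurable]: "v i \<in> borel_measurable borel" for i unfolding v_def by measurable
  have step: "pint p (\<lambda>t. v (Suc i) t - v i t) \<le> ennreal ((1 / 2) ^ i)" for i
    unfolding v_def by (rule N[OF r(2,1)])
  have "(\<integral>\<^sup>+t. (\<Sum>i. ennreal (cmod (v (Suc i) t - v i t) powr p)) \<partial>lborel) =
      (\<Sum>i. pint p (\<lambda>t. v (Suc i) t - v i t))"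
    unfolding pint_def by (rule nn_integral_suminf) measurable
  also have "\<dots> \<le> (\<Sum>i. ennreal ((1 / 2) ^ i))"
    by (intro suminf_le step) auto
  also have "\<dots> < \<infinity>"
  proof -
    have "summable (\<lambda>i. (1 / 2 :: real) ^ i)" by (rule summable_geometric) simp
    then show ?thesis by (subst suminf_ennreal2) auto
  qed
  finally have "AE t in lborel. (\<Sum>i. ennreal (cmod (v (Suc i) t - v i t) powr p)) \<noteq> \<infinity>"
    by (intro nn_integral_PInf_AE) auto
  then have conv: "AE t in lborel. convergent (\<lambda>i. v i t)"
  proof eventually_elim
    case (elim t)
    then have "summable (\<lambda>i. cmod (v (Suc i) t - v i t) powr p)"
      by (intro summable_suminf_not_top) auto
    then have "summable (\<lambda>i. cmod (v (Suc i) t - v i t))"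
      by (rule summable_norm_if_summable_powr[OF p])
    then show ?case by (rule convergent_if_summable_diff[OF summable_norm_cancel])
  qed
  define F where "F = (\<lambda>t. lim (\<lambda>i. v i t))"
  have Fm [measurable]: "F \<in> borel_measurable borel"
    unfolding F_def by (rule borel_measurable_lim_metric) measurable
  \<comment> \<open>Fatou's lemma along the subsequence \<open>v\<close>: for large \<open>i\<close>
    its members come from indices beyond \<open>n\<close>, where the Cauchy bound applies.\<close>
  have fatou: "pint p (\<lambda>t. u k t - F t) \<le> ennreal e"
    if *: "\<And>j k. n \<le> j \<Longrightarrow> n \<le> k \<Longrightarrow> pint p (\<lambda>t. u j t - u k t) \<le> ennreal e" and "n \<le> k" for n e k
  proof -
    have "AE t in lborel. ennreal (cmod (u k t - F t) powr p) =
        liminf (\<lambda>i. ennreal (cmod (u k t - v i t) powr p))"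
      using conv
    proof eventually_elim
      case (elim t)
      then have "(\<lambda>i. v i t) \<longlonglongrightarrow> F t" unfolding F_def by (simp add: convergent_LIMSEQ_iff)
      then have "(\<lambda>i. cmod (u k t - v i t) powr p) \<longlonglongrightarrow> cmod (u k t - F t) powr p"
        using p by (intro tendsto_powr2 tendsto_norm tendsto_diff tendsto_const) auto
      then have "(\<lambda>i. ennreal (cmod (u k t - v i t) powr p)) \<longlonglongrightarrow> ennreal (cmod (u k t - F t) powr p)"
        by (rule tendsto_ennrealI)
      then show ?case by (intro lim_imp_Liminf[symmetric]) auto
    qed
    then have "pint p (\<lambda>t. u k t - F t) = (\<integral>\<^sup>+t. liminf (\<lambda>i. ennreal (cmod (u k t - v i t) powr p)) \<partial>lborel)"
      unfolding pint_def by (rule nn_integral_cong_AE)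
    also have "\<dots> \<le> liminf (\<lambda>i. pint p (\<lambda>t. u k t - v i t))"
      unfolding pint_def by (rule nn_integral_liminf) measurable
    also have "\<dots> \<le> ennreal e"
    proof (rule Liminf_le)
      show "\<forall>\<^sub>F i in sequentially. pint p (\<lambda>t. u k t - v i t) \<le> ennreal e"
        using eventually_ge_at_top[of n]
      proof eventually_elim
        case (elim i)
        then have "n \<le> r i" using r(3)[of i] by simp
        then show ?case unfolding v_def by (rule *[OF \<open>n \<le> k\<close>])
      qed
    qed simp
    finally show ?thesis .
  qed
  show ?thesis
  proof (intro exI[of _ F] conjI allI impI)
    show "F \<in> borel_measurable borel" by (rule Fm)
    fix N e k
    assume "\<forall>j\<ge>N. \<forall>k\<ge>N. pint p (\<lambda>t. u j t - u k t) \<le> ennreal e" "N \<le> k"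
    then show "pint p (\<lambda>t. u k t - F t) \<le> ennreal e" by (intro fatou[of N]) simp_all
  qed
qed

section \<open>Jets and iterated derivatives\<close>

lemma jet_nth_deriv:
  assumes "jet G"
  shows "nth_deriv n (G 0) = G n" "smooth (G 0)"
proof -
  show *: "nth_deriv n (G 0) = G n" for n
  proof (induction n)
    case 0 show ?case by (simp add: nth_deriv_def)
  next
    case (Suc n)
    have "nth_deriv (Suc n) (G 0) = (\<lambda>t. vector_derivative (nth_deriv n (G 0)) (at t))"
      by (simp add: nth_deriv_def)
    also have "\<dots> = G (Suc n)"
      unfolding Suc using assms by (auto simp: jet_def intro!: vector_derivative_at)
    finally show ?case .
  qed
  show "smooth (G 0)"
    unfolding smooth_def * using assms by (auto simp: jet_def intro: differentiableI_vector)
qed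

lemma smooth_jet: "smooth f \<Longrightarrow> jet (\<lambda>n. nth_deriv n f)"
  unfolding jet_def smooth_def
  by (simp add: nth_deriv_def vector_derivative_works[symmetric])

lemma nth_deriv_0: "nth_deriv 0 f = f"
  by (simp add: nth_deriv_def)

lemma nth_deriv_diff:
  assumes "smooth f" "smooth g"
  shows "nth_deriv n (\<lambda>t. f t - g t) = (\<lambda>t. nth_deriv n f t - nth_deriv n g t)"
  using jet_nth_deriv(1)[OF jet_diff[OF smooth_jet[OF assms(1)] smooth_jet[OF assms(2)]], of n]
  by (simp add: nth_deriv_0)

lemma smooth_measurable: "smooth f \<Longrightarrow> nth_deriv n f \<in> borel_measurable borel"
  by (rule jet_measurable[OF smooth_jet])

text \<open>Closeness in the \<open>p\<close>-th power of the quasinorm, which satisfies the triangle inequality.\<close>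

definition lp_small :: "real \<Rightarrow> (nat \<Rightarrow> real) \<Rightarrow> real \<Rightarrow> (nat \<Rightarrow> real \<Rightarrow> complex) \<Rightarrow> bool" where
  "lp_small p M e H \<longleftrightarrow> (\<forall>n. pint p (H n) \<le> ennreal (e * M n powr p))"

lemma ennreal_divide_le_iff:
  assumes "0 < m" "0 \<le> c"
  shows "a / ennreal m \<le> ennreal c \<longleftrightarrow> a \<le> ennreal (c * m)"
proof (cases a)
  case (real r)
  then show ?thesis using assms
    by (simp add: divide_ennreal ennreal_le_iff pos_divide_le_eq)
next
  case top
  then show ?thesis using assms by (simp add: ennreal_top_divide top_unique)
qed

lemma lp_qnorm_divide_le_iff:
  assumes "0 < p" "0 < m" "0 \<le> c"
  shows "lp_qnorm p f / ennreal m \<le> ennreal c \<longleftrightarrow> pint p f \<le> ennreal (c powr p * m powr p)"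
  using assms by (simp add: ennreal_divide_le_iff lp_qnorm_le_iff powr_mult)

lemma SUP_le_iff_lp_small:
  assumes "0 < p" "\<And>n. 0 < M n" "0 \<le> c"
  shows "(SUP n. lp_qnorm p (H n) / ennreal (M n)) \<le> ennreal c \<longleftrightarrow> lp_small p M (c powr p) H"
  using assms by (simp add: SUP_le_iff lp_qnorm_divide_le_iff lp_small_def)

lemma carleman_le_iff:
  assumes "0 < p" "\<And>n. 0 < M n" "0 \<le> c"
  shows "carleman_qnorm p M f \<le> ennreal c \<longleftrightarrow> lp_small p M (c powr p) (\<lambda>n. nth_deriv n f)"
  unfolding carleman_qnorm_def by (rule SUP_le_iff_lp_small[OF assms])

lemma lp_small_add:
  assumes p: "0 < p" "p < 1" and m: "\<And>n. F n \<in> borel_measurable borel" "\<And>n. G n \<in> borel_measurable borel"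
    and F: "lp_small p M a F" "0 \<le> a" and G: "lp_small p M b G" "0 \<le> b"
  shows "lp_small p M (a + b) (\<lambda>n t. F n t + G n t)"
  unfolding lp_small_def
proof
  fix n
  have "pint p (\<lambda>t. F n t + G n t) \<le> pint p (F n) + pint p (G n)"
    using p by (intro pint_add m) auto
  also have "\<dots> \<le> ennreal (a * M n powr p) + ennreal (b * M n powr p)"
    using F G unfolding lp_small_def by (intro add_mono) auto
  also have "\<dots> = ennreal ((a + b) * M n powr p)" using F G by (intro ennreal_add_mult) auto
  finally show "pint p (\<lambda>t. F n t + G n t) \<le> \<dots>" .
qed

lemma lp_small_triangle:
  assumes "0 < p" "p < 1" "\<And>n. F n \<in> borel_measurable borel" "\<And>n. G n \<in> borel_measurable borel"
      "\<And>n. H n \<in> borel_measurable borel"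
    and "lp_small p M a (\<lambda>n t. F n t - G n t)" "0 \<le> a" "lp_small p M b (\<lambda>n t. G n t - H n t)" "0 \<le> b"
  shows "lp_small p M (a + b) (\<lambda>n t. F n t - H n t)"
proof -
  have "lp_small p M (a + b) (\<lambda>n t. (F n t - G n t) + (G n t - H n t))"
    using assms by (intro lp_small_add) auto
  then show ?thesis by simp
qed

lemma lp_small_commute: "lp_small p M a (\<lambda>n t. F n t - G n t) \<Longrightarrow> lp_small p M a (\<lambda>n t. G n t - F n t)"
  unfolding lp_small_def by (subst pint_minus_commute)

lemma lp_small_mono: "lp_small p M a H \<Longrightarrow> a \<le> b \<Longrightarrow> lp_small p M b H"
  unfolding lp_small_def by (meson ennreal_leI mult_right_mono order_trans powr_ge_zero)

text \<open>Stated for any \<open>X\<close> whose bounds translate into \<open>lp_small\<close>, so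
  it serves \<open>seq_qnorm\<close> and \<open>carleman_qnorm\<close> alike. Every positive
  \<open>e\<close> is a p-th power, so passing between c and c^p loses nothing.\<close>

lemma tendsto_0_iff_lp_small:
  assumes p: "0 < p" and le: "\<And>k c. 0 \<le> c \<Longrightarrow> X k \<le> ennreal c \<longleftrightarrow> lp_small p M (c powr p) (H k)"
  shows "X \<longlonglongrightarrow> 0 \<longleftrightarrow> (\<forall>e>0. \<forall>\<^sub>F k in sequentially. lp_small p M e (H k))"
proof
  assume X: "X \<longlonglongrightarrow> 0"
  show "\<forall>e>0. \<forall>\<^sub>F k in sequentially. lp_small p M e (H k)"
  proof (intro allI impI)
    fix e :: real assume "0 < e"
    then have "0 < ennreal (e powr (1 / p))" by simp
    with X have "\<forall>\<^sub>F k in sequentially. X k < ennreal (e powr (1 / p))" by (rule order_tendstoD)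
    then show "\<forall>\<^sub>F k in sequentially. lp_small p M e (H k)"
    proof eventually_elim
      case (elim k)
      then have "X k \<le> ennreal (e powr (1 / p))" by (rule less_imp_le)
      then have "lp_small p M ((e powr (1 / p)) powr p) (H k)" using le[of "e powr (1 / p)" k] by simp
      then show ?case using p \<open>0 < e\<close> by (simp add: powr_powr)
    qed
  qed
next
  assume *: "\<forall>e>0. \<forall>\<^sub>F k in sequentially. lp_small p M e (H k)"
  show "X \<longlonglongrightarrow> 0"
  proof (rule order_tendstoI)
    fix a :: ennreal assume "0 < a"
    then obtain b where b: "0 < b" "b < a" using dense by blast
    then obtain c where "0 \<le> c" "b = ennreal c" by (cases b) auto
    then have c: "0 < c" "ennreal c < a" using b by auto
    have "\<forall>\<^sub>F k in sequentially. lp_small p M (c powr p) (H k)" using * c by simp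
    then show "\<forall>\<^sub>F k in sequentially. X k < a"
    proof eventually_elim
      case (elim k)
      then have "X k \<le> ennreal c" using le c by simp
      then show ?case using c(2) by (rule le_less_trans)
    qed
  qed simp
qed

section \<open>Representatives of equivalence classes\<close>

lemma ae_rel_refl: "f \<in> borel_measurable borel \<Longrightarrow> ae_rel f f"
  by (simp add: ae_rel_def)

lemma mclass_repr:
  obtains f where "f \<in> borel_measurable borel" "u = mclass_of f"
  by (induction u rule: mclass.abs_induct) (auto simp: ae_rel_def)

lemma mclass_of_eqI:
  assumes "f \<in> borel_measurable borel" "g \<in> borel_measurable borel" "AE t in lborel. f t = g t"
  shows "mclass_of f = mclass_of g"
  using assms Quotient3_rel[OF Quotient3_mclass, of f g] by (simp add: ae_rel_def)

lemma mclass_qnorm_of: "f \<in> borel_measurable borel \<Longrightarrow> mclass_qnorm p (mclass_of f) = lp_qnorm p f"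
  by (rule mclass_qnorm.abs_eq) (rule ae_rel_refl)

lemma mclass_of_diff:
  "f \<in> borel_measurable borel \<Longrightarrow> g \<in> borel_measurable borel \<Longrightarrow>
    mclass_of f - mclass_of g = mclass_of (\<lambda>t. f t - g t)"
  by (rule minus_mclass.abs_eq) (rule ae_rel_refl, assumption)+

section \<open>The image of the completion\<close>


lemma seq_qnorm_le_iff:
  assumes "0 < p" "\<And>n. 0 < M n" "0 \<le> c" "\<And>n. H n \<in> borel_measurable borel"
  shows "seq_qnorm p M (\<lambda>n. mclass_of (H n)) \<le> ennreal c \<longleftrightarrow> lp_small p M (c powr p) H"
  unfolding seq_qnorm_def using SUP_le_iff_lp_small[of p M c H] assms by (simp add: mclass_qnorm_of)

lemma linfty_LpI:
  assumes p: "0 < p" and M: "\<And>n. 0 < M n" and m: "\<And>n. H n \<in> borel_measurable borel"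
    and small: "lp_small p M c H"
  shows "(\<lambda>n. mclass_of (H n)) \<in> linfty_Lp p M"
proof -
  have "lp_small p M \<bar>c\<bar> H" using small by (rule lp_small_mono) simp
  then have "lp_small p M ((\<bar>c\<bar> powr (1 / p)) powr p) H" using p by (simp add: powr_powr)
  then have "seq_qnorm p M (\<lambda>n. mclass_of (H n)) \<le> ennreal (\<bar>c\<bar> powr (1 / p))"
    by (subst seq_qnorm_le_iff) (use p M m in auto)
  also have "\<dots> < \<infinity>" by simp
  finally have "seq_qnorm p M (\<lambda>n. mclass_of (H n)) < \<infinity>" .
  moreover have "mclass_of (H n) \<in> Lp p" for n
  proof -
    have "pint p (H n) \<le> ennreal (c * M n powr p)" using small by (simp add: lp_small_def)
    also have "\<dots> < \<infinity>" by simp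
    finally show ?thesis using m by (simp add: Lp_def mclass_qnorm_of lp_qnorm_finite_iff)
  qed
  ultimately show ?thesis by (simp add: linfty_Lp_def)
qed

lemma test_class_smooth: "f \<in> test_class p \<theta> M \<Longrightarrow> smooth f"
  by (simp add: test_class_def)

lemma pi_test_tendsto_iff:
  assumes p: "0 < p" and M: "\<And>n. 0 < M n" and f: "\<And>k. smooth (f k)"
    and m: "\<And>n. H n \<in> borel_measurable borel"
  shows "(\<lambda>k. seq_qnorm p M (\<lambda>n. pi_test (f k) n - mclass_of (H n))) \<longlonglongrightarrow> 0 \<longleftrightarrow>
    (\<forall>e>0. \<forall>\<^sub>F k in sequentially. lp_small p M e (\<lambda>n t. nth_deriv n (f k) t - H n t))"
proof (rule tendsto_0_iff_lp_small[OF p])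
  fix k and c :: real assume "0 \<le> c"
  have [measurable]: "nth_deriv n (f k) \<in> borel_measurable borel" "H n \<in> borel_measurable borel" for n
    using smooth_measurable f m by auto
  have "pi_test (f k) n - mclass_of (H n) = mclass_of (\<lambda>t. nth_deriv n (f k) t - H n t)" for n
    unfolding pi_test_def by (rule mclass_of_diff) measurable
  then show "seq_qnorm p M (\<lambda>n. pi_test (f k) n - mclass_of (H n)) \<le> ennreal c \<longleftrightarrow>
      lp_small p M (c powr p) (\<lambda>n t. nth_deriv n (f k) t - H n t)"
    using seq_qnorm_le_iff[where M = M, OF p M \<open>0 \<le> c\<close>, of "\<lambda>n t. nth_deriv n (f k) t - H n t"] by simp
qed

lemma carleman_tendsto_iff:
  assumes p: "0 < p" and M: "\<And>n. 0 < M n" and f: "\<And>k. smooth (f k)" and g: "\<And>k. smooth (g k)"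
  shows "(\<lambda>k. carleman_qnorm p M (\<lambda>t. f k t - g k t)) \<longlonglongrightarrow> 0 \<longleftrightarrow>
    (\<forall>e>0. \<forall>\<^sub>F k in sequentially. lp_small p M e (\<lambda>n t. nth_deriv n (f k) t - nth_deriv n (g k) t))"
  by (rule tendsto_0_iff_lp_small[OF p]) (simp add: carleman_le_iff[where M = M, OF p M] nth_deriv_diff[OF f g])

lemma cauchy_seqs_iff:
  assumes p: "0 < p" and M: "\<And>n. 0 < M n"
  shows "f \<in> cauchy_seqs p \<theta> M \<longleftrightarrow> (\<forall>k. f k \<in> test_class p \<theta> M) \<and>
    (\<forall>e>0. \<exists>N. \<forall>j\<ge>N. \<forall>k\<ge>N. lp_small p M e (\<lambda>n t. nth_deriv n (f j) t - nth_deriv n (f k) t))"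
proof -
  have le: "carleman_qnorm p M (\<lambda>t. f j t - f k t) \<le> ennreal c \<longleftrightarrow>
      lp_small p M (c powr p) (\<lambda>n t. nth_deriv n (f j) t - nth_deriv n (f k) t)"
    if "\<forall>k. f k \<in> test_class p \<theta> M" "0 \<le> c" for j k c
  proof -
    have "smooth (f i)" for i using that(1) by (blast intro: test_class_smooth)
    then show ?thesis using that(2) by (simp add: carleman_le_iff[where M = M, OF p M] nth_deriv_diff)
  qed
  show ?thesis
  proof (intro iffI conjI)
    assume f: "f \<in> cauchy_seqs p \<theta> M"
    then show tc: "\<forall>k. f k \<in> test_class p \<theta> M" by (simp add: cauchy_seqs_def)
    show "\<forall>e>0. \<exists>N. \<forall>j\<ge>N. \<forall>k\<ge>N. lp_small p M e (\<lambda>n t. nth_deriv n (f j) t - nth_deriv n (f k) t)"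
    proof (intro allI impI)
      fix e :: real assume "0 < e"
      then have "0 < e powr (1 / p)" by simp
      then obtain N where N: "\<And>j k. N \<le> j \<Longrightarrow> N \<le> k \<Longrightarrow>
          carleman_qnorm p M (\<lambda>t. f j t - f k t) < ennreal (e powr (1 / p))"
        using f unfolding cauchy_seqs_def by blast
      have "lp_small p M e (\<lambda>n t. nth_deriv n (f j) t - nth_deriv n (f k) t)" if "N \<le> j" "N \<le> k" for j k
        using le[OF tc, of "e powr (1 / p)" j k] less_imp_le[OF N[OF that]] p \<open>0 < e\<close>
        by (simp add: powr_powr)
      then show "\<exists>N. \<forall>j\<ge>N. \<forall>k\<ge>N. lp_small p M e (\<lambda>n t. nth_deriv n (f j) t - nth_deriv n (f k) t)"
        by blast
    qed
  next
    assume *: "(\<forall>k. f k \<in> test_class p \<theta> M) \<and>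
      (\<forall>e>0. \<exists>N. \<forall>j\<ge>N. \<forall>k\<ge>N. lp_small p M e (\<lambda>n t. nth_deriv n (f j) t - nth_deriv n (f k) t))"
    have "\<exists>N. \<forall>j\<ge>N. \<forall>k\<ge>N. carleman_qnorm p M (\<lambda>t. f j t - f k t) < ennreal e" if "0 < e" for e
    proof -
      have "0 < (e / 2) powr p" using that by simp
      then obtain N where N: "\<And>j k. N \<le> j \<Longrightarrow> N \<le> k \<Longrightarrow>
          lp_small p M ((e / 2) powr p) (\<lambda>n t. nth_deriv n (f j) t - nth_deriv n (f k) t)"
        using * by blast
      have "carleman_qnorm p M (\<lambda>t. f j t - f k t) < ennreal e" if "N \<le> j" "N \<le> k" for j k
      proof -
        have "carleman_qnorm p M (\<lambda>t. f j t - f k t) \<le> ennreal (e / 2)"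
          using N[OF that] le[of "e / 2" j k] * \<open>0 < e\<close> by simp
        also have "\<dots> < ennreal e" using \<open>0 < e\<close> by (intro ennreal_lessI) auto
        finally show ?thesis .
      qed
      then show ?thesis by blast
    qed
    then show "f \<in> cauchy_seqs p \<theta> M" using * by (simp add: cauchy_seqs_def)
  qed
qed

lemma mclass_seq_repr: "\<exists>H. (\<forall>n. H n \<in> borel_measurable borel) \<and> F = (\<lambda>n. mclass_of (H n))"
proof -
  have "\<forall>n. \<exists>h. h \<in> borel_measurable borel \<and> F n = mclass_of h"
    by (metis mclass_repr)
  then obtain H where "\<forall>n. H n \<in> borel_measurable borel \<and> F n = mclass_of (H n)" by metis
  then show ?thesis by auto
qed

lemma limit_unique:
  assumes p: "0 < p" "p < 1" and f: "\<And>k. smooth (f k)"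
    and m: "\<And>n. G n \<in> borel_measurable borel" "\<And>n. H n \<in> borel_measurable borel"
    and G: "\<forall>e>0. \<forall>\<^sub>F k in sequentially. lp_small p M e (\<lambda>n t. nth_deriv n (f k) t - G n t)"
    and H: "\<forall>e>0. \<forall>\<^sub>F k in sequentially. lp_small p M e (\<lambda>n t. nth_deriv n (f k) t - H n t)"
  shows "(\<lambda>n. mclass_of (G n)) = (\<lambda>n. mclass_of (H n))"
proof
  fix n
  have small: "lp_small p M (e + e) (\<lambda>n t. G n t - H n t)" if "0 < e" for e
  proof -
    have "\<forall>\<^sub>F k in sequentially. lp_small p M e (\<lambda>n t. nth_deriv n (f k) t - G n t) \<and>
        lp_small p M e (\<lambda>n t. nth_deriv n (f k) t - H n t)"
      using G H that by (simp add: eventually_conj)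
    then obtain k where k: "lp_small p M e (\<lambda>n t. nth_deriv n (f k) t - G n t)"
        "lp_small p M e (\<lambda>n t. nth_deriv n (f k) t - H n t)"
      by (auto dest: eventually_happens)
    show ?thesis
      by (rule lp_small_triangle[OF p m(1) smooth_measurable[OF f] m(2) lp_small_commute[OF k(1)] _ k(2)])
        (use that in auto)
  qed
  have "pint p (\<lambda>t. G n t - H n t) \<le> 0 + ennreal c" if "0 < c" for c
  proof -
    define D where "D = M n powr p + 1"
    have "0 \<le> M n powr p" by simp
    then have D: "0 < D" unfolding D_def by linarith
    define e where "e = c / (2 * D)"
    have e: "0 < e" "(e + e) * D = c" using that D by (simp_all add: e_def)
    have "pint p (\<lambda>t. G n t - H n t) \<le> ennreal ((e + e) * M n powr p)"
      using small[OF e(1)] by (simp add: lp_small_def)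
    also have "\<dots> \<le> ennreal c" using e by (intro ennreal_leI) (auto simp: D_def algebra_simps)
    finally show ?thesis by simp
  qed
  then have "pint p (\<lambda>t. G n t - H n t) \<le> 0"
    by (rule ennreal_le_epsilon)
  then have "AE t in lborel. G n t - H n t = 0"
    by (intro pint_eq_0_imp_AE borel_measurable_diff m) auto
  then show "mclass_of (G n) = mclass_of (H n)"
    by (intro mclass_of_eqI m) (auto elim: eventually_mono)
qed

text \<open>The definite description in \<open>pi_map\<close> quantifies over all representatives:
  convergence passes from \<open>f\<close> to equivalent sequences by the triangle inequality. For
  uniqueness \<open>f\<close> itself, a member of its own class, suffices.\<close>

lemma pi_map_eq:
  assumes p: "0 < p" "p < 1" and M: "\<And>n. 0 < M n" and f: "f \<in> cauchy_seqs p \<theta> M"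
    and m: "\<And>n. H n \<in> borel_measurable borel"
    and H: "\<forall>e>0. \<forall>\<^sub>F k in sequentially. lp_small p M e (\<lambda>n t. nth_deriv n (f k) t - H n t)"
    and lin: "(\<lambda>n. mclass_of (H n)) \<in> linfty_Lp p M"
  shows "pi_map p M (cauchy_rel p \<theta> M `` {f}) = (\<lambda>n. mclass_of (H n))"
  unfolding pi_map_def
proof (rule the_equality)
  have sm: "smooth (g k)" if "g \<in> cauchy_seqs p \<theta> M" for g k
    using that unfolding cauchy_seqs_def by (blast intro: test_class_smooth)
  have "(\<lambda>k. seq_qnorm p M (\<lambda>n. pi_test (g k) n - mclass_of (H n))) \<longlonglongrightarrow> 0"
    if "g \<in> cauchy_rel p \<theta> M `` {f}" for g
  proof -
    have g: "g \<in> cauchy_seqs p \<theta> M" "(\<lambda>k. carleman_qnorm p M (\<lambda>t. f k t - g k t)) \<longlonglongrightarrow> 0"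
      using that by (auto simp: cauchy_rel_def)
    have fg: "\<forall>e>0. \<forall>\<^sub>F k in sequentially. lp_small p M e (\<lambda>n t. nth_deriv n (f k) t - nth_deriv n (g k) t)"
      using g(2) carleman_tendsto_iff[where M = M and f = f and g = g, OF p(1) M sm[OF f] sm[OF g(1)]] by simp
    have "\<forall>\<^sub>F k in sequentially. lp_small p M e (\<lambda>n t. nth_deriv n (g k) t - H n t)" if "0 < e" for e
    proof -
      have e2: "0 < e / 2" using that by simp
      have "\<forall>\<^sub>F k in sequentially. lp_small p M (e / 2) (\<lambda>n t. nth_deriv n (f k) t - nth_deriv n (g k) t)"
        "\<forall>\<^sub>F k in sequentially. lp_small p M (e / 2) (\<lambda>n t. nth_deriv n (f k) t - H n t)"
        using fg H e2 by blast+
      then show ?thesis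
      proof eventually_elim
        case (elim k)
        have "lp_small p M (e / 2 + e / 2) (\<lambda>n t. nth_deriv n (g k) t - H n t)"
          by (rule lp_small_triangle[OF p smooth_measurable[OF sm[OF g(1)]] smooth_measurable[OF sm[OF f]] m
                lp_small_commute[OF elim(1)] _ elim(2)]) (use e2 in auto)
        then show ?case by simp
      qed
    qed
    then show ?thesis using pi_test_tendsto_iff[where M = M and f = g and H = H, OF p(1) M sm[OF g(1)] m] by simp
  qed
  then show "(\<lambda>n. mclass_of (H n)) \<in> linfty_Lp p M \<and> (\<forall>g\<in>cauchy_rel p \<theta> M `` {f}.
      (\<lambda>k. seq_qnorm p M (\<lambda>n. pi_test (g k) n - mclass_of (H n))) \<longlonglongrightarrow> 0)"
    using lin by blast
  fix F
  assume F: "F \<in> linfty_Lp p M \<and> (\<forall>g\<in>cauchy_rel p \<theta> M `` {f}.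
      (\<lambda>k. seq_qnorm p M (\<lambda>n. pi_test (g k) n - F n)) \<longlonglongrightarrow> 0)"
  obtain G where G: "\<And>n. G n \<in> borel_measurable borel" "F = (\<lambda>n. mclass_of (G n))"
    using mclass_seq_repr[of F] by blast
  have "lp_small p M e (\<lambda>n t. nth_deriv n (f k) t - nth_deriv n (f k) t)" for k e
    by (simp add: lp_small_def)
  then have "(\<lambda>k. carleman_qnorm p M (\<lambda>t. f k t - f k t)) \<longlonglongrightarrow> 0"
    by (subst carleman_tendsto_iff[where M = M and f = f and g = f, OF p(1) M sm[OF f] sm[OF f]]) simp
  then have "f \<in> cauchy_rel p \<theta> M `` {f}" using f by (simp add: cauchy_rel_def)
  then have "(\<lambda>k. seq_qnorm p M (\<lambda>n. pi_test (f k) n - F n)) \<longlonglongrightarrow> 0" using F by blast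
  then have "\<forall>e>0. \<forall>\<^sub>F k in sequentially. lp_small p M e (\<lambda>n t. nth_deriv n (f k) t - G n t)"
    unfolding G(2) using pi_test_tendsto_iff[where M = M and f = f and H = G, OF p(1) M sm[OF f] G(1)] by simp
  then show "F = (\<lambda>n. mclass_of (H n))"
    unfolding G(2) using H by (intro limit_unique[OF p sm[OF f] G(1) m])
qed

text \<open>The limit is taken entry by entry. The index \<open>N\<close> of a Cauchy bound does not
  depend on the entry and \<open>riesz_fischer\<close> preserves it, so convergence is uniform
  relative to the weights.\<close>

lemma cauchy_seq_limit:
  assumes p: "0 < p" "p < 1" and M: "\<And>n. 0 < M n" and f: "f \<in> cauchy_seqs p \<theta> M"
  obtains H where "\<And>n. H n \<in> borel_measurable borel"
    "\<forall>e>0. \<forall>\<^sub>F k in sequentially. lp_small p M e (\<lambda>n t. nth_deriv n (f k) t - H n t)"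
    "(\<lambda>n. mclass_of (H n)) \<in> linfty_Lp p M"
proof -
  have f': "\<forall>k. f k \<in> test_class p \<theta> M"
    "\<forall>e>0. \<exists>N. \<forall>j\<ge>N. \<forall>k\<ge>N. lp_small p M e (\<lambda>n t. nth_deriv n (f j) t - nth_deriv n (f k) t)"
    using f cauchy_seqs_iff[where M = M, OF p(1) M] by blast+
  have fm: "nth_deriv n (f k) \<in> borel_measurable borel" for n k
    using f'(1) smooth_measurable test_class_smooth by blast
  have "\<exists>h. h \<in> borel_measurable borel \<and> (\<forall>N e k. (\<forall>j\<ge>N. \<forall>k\<ge>N.
      pint p (\<lambda>t. nth_deriv n (f j) t - nth_deriv n (f k) t) \<le> ennreal e) \<longrightarrow> N \<le> k \<longrightarrow>
      pint p (\<lambda>t. nth_deriv n (f k) t - h t) \<le> ennreal e)" for n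
  proof -
    have cau: "\<exists>N. \<forall>j\<ge>N. \<forall>k\<ge>N. pint p (\<lambda>t. nth_deriv n (f j) t - nth_deriv n (f k) t) \<le> ennreal e"
      if "0 < e" for e
    proof -
      have "0 < e / M n powr p" using that M[of n] by simp
      then obtain N where "\<forall>j\<ge>N. \<forall>k\<ge>N. lp_small p M (e / M n powr p) (\<lambda>n t. nth_deriv n (f j) t - nth_deriv n (f k) t)"
        using f'(2) by blast
      moreover have "e / M n powr p * M n powr p = e" using M[of n] by simp
      ultimately show ?thesis unfolding lp_small_def by metis
    qed
    show ?thesis by (rule riesz_fischer[of p "\<lambda>k. nth_deriv n (f k)", OF p fm cau])
  qed
  then have "\<forall>n. \<exists>h. h \<in> borel_measurable borel \<and> (\<forall>N e k. (\<forall>j\<ge>N. \<forall>k\<ge>N.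
      pint p (\<lambda>t. nth_deriv n (f j) t - nth_deriv n (f k) t) \<le> ennreal e) \<longrightarrow> N \<le> k \<longrightarrow>
      pint p (\<lambda>t. nth_deriv n (f k) t - h t) \<le> ennreal e)" ..
  then have "\<exists>H. \<forall>n. H n \<in> borel_measurable borel \<and> (\<forall>N e k. (\<forall>j\<ge>N. \<forall>k\<ge>N.
      pint p (\<lambda>t. nth_deriv n (f j) t - nth_deriv n (f k) t) \<le> ennreal e) \<longrightarrow> N \<le> k \<longrightarrow>
      pint p (\<lambda>t. nth_deriv n (f k) t - H n t) \<le> ennreal e)" by (rule choice)
  then obtain H where H': "\<forall>n. H n \<in> borel_measurable borel \<and> (\<forall>N e k. (\<forall>j\<ge>N. \<forall>k\<ge>N.
      pint p (\<lambda>t. nth_deriv n (f j) t - nth_deriv n (f k) t) \<le> ennreal e) \<longrightarrow> N \<le> k \<longrightarrow>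
      pint p (\<lambda>t. nth_deriv n (f k) t - H n t) \<le> ennreal e)" ..
  have H: "H n \<in> borel_measurable borel" for n
    by (rule conjunct1[OF spec[OF H', of n]])
  have H2: "pint p (\<lambda>t. nth_deriv n (f k) t - H n t) \<le> ennreal e"
    if "\<forall>j\<ge>N. \<forall>k\<ge>N. pint p (\<lambda>t. nth_deriv n (f j) t - nth_deriv n (f k) t) \<le> ennreal e" "N \<le> k"
    for n N e k
    using conjunct2[OF spec[OF H', of n]] that by blast
  have conv: "\<forall>e>0. \<forall>\<^sub>F k in sequentially. lp_small p M e (\<lambda>n t. nth_deriv n (f k) t - H n t)"
  proof (intro allI impI)
    fix e :: real assume "0 < e"
    then obtain N where N: "\<forall>j\<ge>N. \<forall>k\<ge>N. lp_small p M e (\<lambda>n t. nth_deriv n (f j) t - nth_deriv n (f k) t)"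
      using f'(2) by blast
    have "lp_small p M e (\<lambda>n t. nth_deriv n (f k) t - H n t)" if "N \<le> k" for k
      unfolding lp_small_def
    proof
      fix n show "pint p (\<lambda>t. nth_deriv n (f k) t - H n t) \<le> ennreal (e * M n powr p)"
        by (rule H2[OF _ that]) (use N in \<open>auto simp: lp_small_def\<close>)
    qed
    then show "\<forall>\<^sub>F k in sequentially. lp_small p M e (\<lambda>n t. nth_deriv n (f k) t - H n t)"
      unfolding eventually_sequentially by blast
  qed
  have "\<exists>c. lp_small p M c H"
  proof -
    have "\<forall>\<^sub>F k in sequentially. lp_small p M 1 (\<lambda>n t. nth_deriv n (f k) t - H n t)"
      using conv zero_less_one by blast
    then obtain k where k: "lp_small p M 1 (\<lambda>n t. nth_deriv n (f k) t - H n t)"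
      by (auto dest: eventually_happens)
    have "carleman_qnorm p M (f k) < \<infinity>" using f'(1) by (simp add: test_class_def)
    then obtain c where "0 \<le> c" "carleman_qnorm p M (f k) = ennreal c"
      by (cases "carleman_qnorm p M (f k)") auto
    then have c: "lp_small p M (c powr p) (\<lambda>n. nth_deriv n (f k))"
      using carleman_le_iff[where M = M, OF p(1) M, of c "f k"] by simp
    have "lp_small p M (1 + c powr p) (\<lambda>n t. H n t - (\<lambda>t. 0) t)"
      by (rule lp_small_triangle[OF p H fm _ lp_small_commute[OF k]]) (use c in auto)
    then show ?thesis by auto
  qed
  then have "(\<lambda>n. mclass_of (H n)) \<in> linfty_Lp p M"
    using linfty_LpI[where M = M and H = H, OF p(1) M H] by blast
  then show ?thesis by (rule that[OF H conv])
qed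

text \<open>Subcritical growth puts the limsup below every positive \<open>e\<close>, hence below
  \<open>\<theta>\<close>; the minorant property turns the bounds with \<open>exp (p * x n)\<close>
  into bounds with \<open>M n powr p\<close>.\<close>

lemma test_jet_in_test_class:
  assumes p: "0 < p" "p < 1" and "0 \<le> \<theta>" and M: "\<And>n. 0 < M n" and x: "\<And>n. x n \<le> ln (M n)"
    and G: "test_jet p x G"
  shows "G 0 \<in> test_class p \<theta> M"
proof -
  have jet: "jet G" and sub: "subcritical p G" using G by (auto simp: test_jet_def)
  obtain C where C: "\<And>n. pint p (G n) \<le> ennreal (C * exp (p * x n))"
    using G unfolding test_jet_def by blast
  have "lp_small p M \<bar>C\<bar> G"
    unfolding lp_small_def
  proof
    fix n
    have "exp (p * x n) \<le> M n powr p"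
      using x[of n] M[of n] p by (simp add: powr_def)
    then have "C * exp (p * x n) \<le> \<bar>C\<bar> * M n powr p" by (intro mult_mono) auto
    then show "pint p (G n) \<le> ennreal (\<bar>C\<bar> * M n powr p)"
      using C[of n] by (meson ennreal_leI order_trans)
  qed
  then have "lp_small p M ((\<bar>C\<bar> powr (1 / p)) powr p) (\<lambda>n. nth_deriv n (G 0))"
    using p by (simp add: powr_powr jet_nth_deriv(1)[OF jet])
  then have "carleman_qnorm p M (G 0) \<le> ennreal (\<bar>C\<bar> powr (1 / p))"
    by (subst carleman_le_iff[where M = M, OF p(1) M]) auto
  also have "\<dots> < \<infinity>" by simp
  finally have fin: "carleman_qnorm p M (G 0) < \<infinity>" .
  have ev: "\<forall>\<^sub>F n in sequentially. ereal ((1 - p) ^ n) * log_ereal (sup_norm (nth_deriv n (G 0))) \<le> ereal e"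
    if "0 < e" for e
    using sub[unfolded subcritical_def, rule_format, OF that]
  proof eventually_elim
    case (elim n)
    have "sup_norm (G n) \<le> ereal (exp (e / (1 - p) ^ n))"
      unfolding sup_norm_def using elim by (intro SUP_least) simp
    then have "log_ereal (sup_norm (G n)) \<le> ereal (e / (1 - p) ^ n)"
    proof (cases "sup_norm (G n)")
      case (real r)
      have "ln r \<le> e / (1 - p) ^ n" if "0 < r"
      proof -
        have "r \<le> exp (e / (1 - p) ^ n)" using \<open>sup_norm (G n) \<le> _\<close> real by simp
        then have "ln r \<le> ln (exp (e / (1 - p) ^ n))" using that by (subst ln_le_cancel_iff) auto
        then show ?thesis by simp
      qed
      then show ?thesis using real by (simp add: log_ereal_def)
    qed (auto simp: log_ereal_def)
    then have "ereal ((1 - p) ^ n) * log_ereal (sup_norm (G n)) \<le> ereal ((1 - p) ^ n) * ereal (e / (1 - p) ^ n)"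
      using p by (intro ereal_mult_left_mono) auto
    also have "\<dots> = ereal e" using p by simp
    finally show ?case by (simp add: jet_nth_deriv(1)[OF jet])
  qed
  have "limsup (\<lambda>n. ereal ((1 - p) ^ n) * log_ereal (sup_norm (nth_deriv n (G 0)))) \<le> ereal \<theta>"
  proof (rule ereal_le_epsilon2)
    fix e :: real assume "0 < e"
    have "limsup (\<lambda>n. ereal ((1 - p) ^ n) * log_ereal (sup_norm (nth_deriv n (G 0)))) \<le> ereal e"
      by (rule Limsup_bounded[OF ev[OF \<open>0 < e\<close>]])
    also have "\<dots> \<le> ereal \<theta> + ereal e" using assms(3) by simp
    finally show "limsup (\<lambda>n. ereal ((1 - p) ^ n) * log_ereal (sup_norm (nth_deriv n (G 0)))) \<le> ereal \<theta> + ereal e" .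
  qed
  then show ?thesis using fin jet_nth_deriv(2)[OF jet] by (simp add: test_class_def)
qed

text \<open>The decay makes all entries beyond some \<open>N\<close> cost at most
  \<open>e / 2\<close> when replaced by 0, and finitely many entries remain for
  \<open>approximable_finite\<close>.\<close>

lemma c0_Lp_approximation:
  assumes p: "0 < p" "p < 1" and "0 \<le> \<theta>" and M: "\<And>n. 0 < M n"
    and adm: "admissible p x" and x: "\<And>n. x n \<le> ln (M n)"
    and m: "\<And>n. H n \<in> borel_measurable borel" and c0: "(\<lambda>n. mclass_of (H n)) \<in> c0_Lp p M" and "0 < e"
  shows "\<exists>f\<in>test_class p \<theta> M. lp_small p M e (\<lambda>n t. nth_deriv n f t - H n t)"
proof -
  have fin: "pint p (H n) < \<infinity>" for n
    using c0 m by (auto simp: c0_Lp_def linfty_Lp_def Lp_def mclass_qnorm_of lp_qnorm_finite_iff)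
  have e2: "0 < e / 2" using \<open>0 < e\<close> by simp
  have "(\<lambda>n. lp_qnorm p (H n) / ennreal (M n)) \<longlonglongrightarrow> 0"
    using c0 m by (simp add: c0_Lp_def mclass_qnorm_of)
  then have "\<forall>\<^sub>F n in sequentially. lp_qnorm p (H n) / ennreal (M n) < ennreal ((e / 2) powr (1 / p))"
    by (rule order_tendstoD) (use e2 in simp)
  then obtain N where N: "\<And>n. N \<le> n \<Longrightarrow> lp_qnorm p (H n) / ennreal (M n) < ennreal ((e / 2) powr (1 / p))"
    unfolding eventually_sequentially by blast
  have tail: "pint p (H n) \<le> ennreal (e / 2 * M n powr p)" if "N \<le> n" for n
    using lp_qnorm_divide_le_iff[OF p(1) M, of "(e / 2) powr (1 / p)" "H n" n] less_imp_le[OF N[OF that]] p e2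
    by (simp add: powr_powr)
  obtain G where G: "test_jet p x G"
    "\<And>n. pint p (\<lambda>t. G n t - (if n < N then H n t else 0)) \<le> ennreal (e / 2 * exp (p * x n))"
    using approximable_finite[OF adm p m fin, of N] e2 unfolding approximable_def by meson
  have jet: "jet G" using G(1) by (simp add: test_jet_def)
  have [measurable]: "G n \<in> borel_measurable borel" "H n \<in> borel_measurable borel" for n
    using test_jet_measurable[OF G(1)] m by auto
  have "lp_small p M (e / 2 + e / 2) (\<lambda>n t. G n t - H n t)"
  proof (rule lp_small_triangle[OF p, where G = "\<lambda>n t. if n < N then H n t else 0"])
    show "lp_small p M (e / 2) (\<lambda>n t. G n t - (if n < N then H n t else 0))"
      unfolding lp_small_def
    proof
      fix n
      have "exp (p * x n) \<le> M n powr p"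
        using x[of n] M[of n] p by (simp add: powr_def)
      then have "e / 2 * exp (p * x n) \<le> e / 2 * M n powr p" using e2 by (intro mult_left_mono) auto
      then show "pint p (\<lambda>t. G n t - (if n < N then H n t else 0)) \<le> ennreal (e / 2 * M n powr p)"
        using G(2)[of n] by (meson ennreal_leI order_trans)
    qed
    show "lp_small p M (e / 2) (\<lambda>n t. (if n < N then H n t else 0) - H n t)"
      unfolding lp_small_def
    proof
      fix n
      show "pint p (\<lambda>t. (if n < N then H n t else 0) - H n t) \<le> ennreal (e / 2 * M n powr p)"
      proof (cases "n < N")
        case False
        have "pint p (\<lambda>t. 0 - H n t) = pint p (\<lambda>t. H n t - 0)" by (rule pint_minus_commute)
        then show ?thesis using False tail[of n] by simp
      qed simp
    qed
  qed (use e2 in \<open>auto\<close>)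
  then have "lp_small p M e (\<lambda>n t. nth_deriv n (G 0) t - H n t)"
    by (simp add: jet_nth_deriv(1)[OF jet])
  then show ?thesis using test_jet_in_test_class[where M = M, OF p assms(3) M x G(1)] by blast
qed

theorem proposition4p4p1:
  fixes p \<theta> :: real and M :: "nat \<Rightarrow> real"
  assumes "0 < p" and "p < 1" and "0 \<le> \<theta>"
    and "\<And>n. 0 < M n"
    and "p_regular p M"
    and "p_characteristic p M = \<infinity>"
  shows "c0_Lp p M \<subseteq> pi_map p M ` carleman_space p \<theta> M \<and>
         pi_map p M ` carleman_space p \<theta> M \<subseteq> linfty_Lp p M"
proof
  note p = assms(1,2) and M = assms(4)
  show "pi_map p M ` carleman_space p \<theta> M \<subseteq> linfty_Lp p M"
  proof
    fix F assume "F \<in> pi_map p M ` carleman_space p \<theta> M"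
    then obtain f where f: "f \<in> cauchy_seqs p \<theta> M" "F = pi_map p M (cauchy_rel p \<theta> M `` {f})"
      unfolding carleman_space_def by (auto elim!: quotientE)
    obtain H where H: "\<And>n. H n \<in> borel_measurable borel"
      "\<forall>e>0. \<forall>\<^sub>F k in sequentially. lp_small p M e (\<lambda>n t. nth_deriv n (f k) t - H n t)"
      "(\<lambda>n. mclass_of (H n)) \<in> linfty_Lp p M"
      by (rule cauchy_seq_limit[where M = M, OF p M f(1)]) blast
    show "F \<in> linfty_Lp p M"
      unfolding f(2) pi_map_eq[where M = M, OF p M f(1) H] by (rule H(3))
  qed
  obtain x where x: "admissible p x" "\<And>n. x n \<le> ln (M n)"
    using admissible_minorant[OF p M assms(5)] by blast
  show "c0_Lp p M \<subseteq> pi_map p M ` carleman_space p \<theta> M"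
  proof
    fix F assume F: "F \<in> c0_Lp p M"
    obtain H where H: "\<And>n. H n \<in> borel_measurable borel" "F = (\<lambda>n. mclass_of (H n))"
      using mclass_seq_repr[of F] by blast
    have "\<forall>k. \<exists>f. f \<in> test_class p \<theta> M \<and>
        lp_small p M (1 / real (Suc k)) (\<lambda>n t. nth_deriv n f t - H n t)"
    proof
      fix k
      have "0 < 1 / real (Suc k)" by simp
      then have "\<exists>f\<in>test_class p \<theta> M. lp_small p M (1 / real (Suc k)) (\<lambda>n t. nth_deriv n f t - H n t)"
        using F unfolding H(2) by (intro c0_Lp_approximation[where M = M and x = x, OF p assms(3) M x H(1)])
      then show "\<exists>f. f \<in> test_class p \<theta> M \<and>
          lp_small p M (1 / real (Suc k)) (\<lambda>n t. nth_deriv n f t - H n t)" by (simp only: Bex_def)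
    qed
    then have "\<exists>f. \<forall>k. f k \<in> test_class p \<theta> M \<and>
        lp_small p M (1 / real (Suc k)) (\<lambda>n t. nth_deriv n (f k) t - H n t)" by (rule choice)
    then obtain f where f': "\<forall>k. f k \<in> test_class p \<theta> M \<and>
        lp_small p M (1 / real (Suc k)) (\<lambda>n t. nth_deriv n (f k) t - H n t)" ..
    have f: "f k \<in> test_class p \<theta> M"
      "lp_small p M (1 / real (Suc k)) (\<lambda>n t. nth_deriv n (f k) t - H n t)" for k
      using spec[OF f', of k] by simp_all
    have conv: "\<exists>N. \<forall>k\<ge>N. lp_small p M e (\<lambda>n t. nth_deriv n (f k) t - H n t)" if "0 < e" for e
    proof -
      obtain N where N: "1 / real (Suc N) < e" using nat_approx_posE[OF \<open>0 < e\<close>] .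
      have "1 / real (Suc k) \<le> e" if "N \<le> k" for k
      proof -
        have "1 / real (Suc k) \<le> 1 / real (Suc N)" using that by (simp add: frac_le)
        then show ?thesis using N by linarith
      qed
      then show ?thesis using lp_small_mono[OF f(2)] by blast
    qed
    have fm: "nth_deriv n (f k) \<in> borel_measurable borel" for n k
      using f(1) smooth_measurable test_class_smooth by blast
    have "\<exists>N. \<forall>j\<ge>N. \<forall>k\<ge>N. lp_small p M e (\<lambda>n t. nth_deriv n (f j) t - nth_deriv n (f k) t)" if "0 < e" for e
    proof -
      have e2: "0 < e / 2" using that by simp
      then obtain N where N: "\<And>k. N \<le> k \<Longrightarrow> lp_small p M (e / 2) (\<lambda>n t. nth_deriv n (f k) t - H n t)"
        using conv by blast
      have "lp_small p M (e / 2 + e / 2) (\<lambda>n t. nth_deriv n (f j) t - nth_deriv n (f k) t)"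
        if "N \<le> j" "N \<le> k" for j k
        by (rule lp_small_triangle[OF p fm H(1) fm N[OF that(1)] _ lp_small_commute[OF N[OF that(2)]]])
          (use e2 in auto)
      then show ?thesis by auto
    qed
    then have cau: "f \<in> cauchy_seqs p \<theta> M"
      using f(1) cauchy_seqs_iff[where M = M, OF p(1) M] by blast
    have "pi_map p M (cauchy_rel p \<theta> M `` {f}) = F"
      unfolding H(2)
    proof (rule pi_map_eq[where M = M, OF p M cau H(1)])
      show "\<forall>e>0. \<forall>\<^sub>F k in sequentially. lp_small p M e (\<lambda>n t. nth_deriv n (f k) t - H n t)"
        using conv by (simp add: eventually_sequentially)
      show "(\<lambda>n. mclass_of (H n)) \<in> linfty_Lp p M" using F H(2) by (simp add: c0_Lp_def)
    qed
    moreover have "cauchy_rel p \<theta> M `` {f} \<in> carleman_space p \<theta> M"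
      unfolding carleman_space_def by (rule quotientI) (rule cau)
    ultimately show "F \<in> pi_map p M ` carleman_space p \<theta> M" by blast
  qed
qed

end
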